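(* Let $K$ be an infinite field of characteristic $p>2$, let $\lambda=(\lambda_1,\dots,\lambda_n)$, $\mu=(\mu_1,\dots,\mu_n)$ be partitions of $n$ and let $k,d$ be positive integers. If $p^d >\min\{\lambda_2, \mu_1-\lambda_1\}$ and $\mu_2\le \lambda_1$, then \[\Hom_{\mathfrak{S}_n}(S^{\mu}, S^{\lambda})\simeq \Hom_{\mathfrak{S}_{n'}}(S^{\mu^+}, S^{\lambda^+}),\] where $n'=n+kp^{d}$, $\lambda^+ =\lambda+(kp^{d})$ and $\mu^+=\mu+(kp^{d})$.
   Context: For a partition $\lambda$ of $n$, $S^{\lambda}$ denotes the Specht module corresponding to $\lambda$ for the group algebra $K\mathfrak{S}_n$ of the symmetric group $\mathfrak{S}_n$ (as defined in Green's book "Polynomial representations of $GL_n$"). For a partition $\lambda=(\lambda_1,\dots,\lambda_n)$ and a nonnegative integer $m$, $\lambda+(m)$ denotes the partition $(\lambda_1+m,\lambda_2,\dots,\lambda_n)$. *)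

theory Defs
  imports Main "HOL-Combinatorics.Permutations"
begin

definition is_partition :: "nat \<Rightarrow> (nat \<Rightarrow> nat) \<Rightarrow> bool" where
  "is_partition n lam \<longleftrightarrow> lam 0 = 0 \<and> (\<forall>i\<ge>1. lam (Suc i) \<le> lam i)
      \<and> (\<forall>i>n. lam i = 0) \<and> (\<Sum>i=1..n. lam i) = n"

definition add_first :: "(nat \<Rightarrow> nat) \<Rightarrow> nat \<Rightarrow> (nat \<Rightarrow> nat)" where
  "add_first lam m = lam(1 := lam 1 + m)"

definition young :: "(nat \<Rightarrow> nat) \<Rightarrow> (nat \<times> nat) set" where
  "young lam = {(i, j). 1 \<le> i \<and> 1 \<le> j \<and> j \<le> lam i}"

definition tableaux :: "nat \<Rightarrow> (nat \<Rightarrow> nat) \<Rightarrow> (nat \<times> nat \<Rightarrow> nat) set" where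
  "tableaux n lam = {t. bij_betw t (young lam) {1..n}}"

definition row_of :: "(nat \<Rightarrow> nat) \<Rightarrow> (nat \<times> nat \<Rightarrow> nat) \<Rightarrow> nat \<Rightarrow> nat" where
  "row_of lam t m = fst (inv_into (young lam) t m)"

definition col_of :: "(nat \<Rightarrow> nat) \<Rightarrow> (nat \<times> nat \<Rightarrow> nat) \<Rightarrow> nat \<Rightarrow> nat" where
  "col_of lam t m = snd (inv_into (young lam) t m)"

text \<open>A tabloid {t} is encoded by the function sending each entry m in 1..n to
  the row of t containing m.  Elements of the permutation module M^lambda are
  K-valued functions on tabloids, so the tabloid {t} is the indicator of row_of t.\<close>

definition col_stab :: "nat \<Rightarrow> (nat \<Rightarrow> nat) \<Rightarrow> (nat \<times> nat \<Rightarrow> nat) \<Rightarrow> (nat \<Rightarrow> nat) set" where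
  "col_stab n lam t = {\<pi>. \<pi> permutes {1..n} \<and> (\<forall>m\<in>{1..n}. col_of lam t (\<pi> m) = col_of lam t m)}"

text \<open>Action of sigma in S_n on M^lambda: (sigma . v)(T) = v(sigma^-1 . T),
  where (sigma^-1 . T)(m) = T(sigma m) for a tabloid T encoded as above.\<close>
definition perm_act :: "(nat \<Rightarrow> nat) \<Rightarrow> ((nat \<Rightarrow> nat) \<Rightarrow> 'a) \<Rightarrow> ((nat \<Rightarrow> nat) \<Rightarrow> 'a)" where
  "perm_act \<sigma> v = (\<lambda>T. v (T \<circ> \<sigma>))"

text \<open>Polytabloid e_t = sum over pi in C_t of sgn(pi) {pi t};
  the tabloid {pi t} is encoded by row_of t o pi^-1.\<close>
definition polytabloid :: "nat \<Rightarrow> (nat \<Rightarrow> nat) \<Rightarrow> (nat \<times> nat \<Rightarrow> nat) \<Rightarrow> ((nat \<Rightarrow> nat) \<Rightarrow> 'a::field)" where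
  "polytabloid n lam t = (\<lambda>T. \<Sum>\<pi>\<in>{\<pi>\<in>col_stab n lam t. row_of lam t \<circ> inv \<pi> = T}. of_int (sign \<pi>))"

text \<open>Specht module S^lambda (James' definition, as in Green's book): the K-span of
  the polytabloids inside M^lambda.\<close>
definition specht :: "nat \<Rightarrow> (nat \<Rightarrow> nat) \<Rightarrow> ((nat \<Rightarrow> nat) \<Rightarrow> 'a::field) set" where
  "specht n lam = {(\<lambda>T. \<Sum>t\<in>A. c t * polytabloid n lam t T) | A c.
       finite A \<and> A \<subseteq> tableaux n lam}"

text \<open>Hom_{S_n}(S^mu, S^lambda): K-linear S_n-equivariant maps S^mu -> S^lambda,
  made extensional (zero outside S^mu) so that they form a K-vector space of functions.\<close>
definition hom_specht :: "nat \<Rightarrow> (nat \<Rightarrow> nat) \<Rightarrow> (nat \<Rightarrow> nat)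
     \<Rightarrow> (((nat \<Rightarrow> nat) \<Rightarrow> 'a::field) \<Rightarrow> ((nat \<Rightarrow> nat) \<Rightarrow> 'a)) set" where
  "hom_specht n mu lam = {f.
      (\<forall>v\<in>specht n mu. f v \<in> specht n lam)
    \<and> (\<forall>c. \<forall>v\<in>specht n mu. \<forall>w\<in>specht n mu.
          f (\<lambda>T. c * v T + w T) = (\<lambda>T. c * f v T + f w T))
    \<and> (\<forall>\<sigma>. \<sigma> permutes {1..n} \<longrightarrow> (\<forall>v\<in>specht n mu. f (perm_act \<sigma> v) = perm_act \<sigma> (f v)))
    \<and> (\<forall>v. v \<notin> specht n mu \<longrightarrow> f v = (\<lambda>T. 0))}"

definition lin_iso :: "(('x \<Rightarrow> ('y \<Rightarrow> 'a::field)) set) \<Rightarrow> (('u \<Rightarrow> ('w \<Rightarrow> 'a)) set) \<Rightarrow> bool" where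
  "lin_iso H1 H2 \<longleftrightarrow> (\<exists>\<Phi>. bij_betw \<Phi> H1 H2 \<and>
     (\<forall>c. \<forall>f\<in>H1. \<forall>g\<in>H1. \<Phi> (\<lambda>v T. c * f v T + g v T) = (\<lambda>v T. c * \<Phi> f v T + \<Phi> g v T)))"

end

theory Submission
  imports Defs "HOL-Computational_Algebra.Primes"
begin

text \<open>
  A homomorphism \<open>f\<close> out of \<open>S\<^sup>\<mu>\<close> is determined by \<open>f e\<^sub>t\<close>, which is a function on the fillings of the
  diagram of \<open>\<mu>\<close> with content \<open>\<lambda>\<close>. As the characteristic is not two, this function alternates
  in the columns of \<open>t\<close>, so it is determined by its values on fillings whose ones all lie in the first
  row. Let \<open>K = k p\<^sup>d\<close>. Since \<open>\<mu>\<^sub>2 \<le> \<lambda>\<^sub>1\<close>, for \<open>\<mu>\<^sup>+\<close> and \<open>\<lambda>\<^sup>+\<close> one may moreover assume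
  that the \<open>K\<close> new boxes contain ones. Restriction to such fillings relates the homomorphisms
  \<open>S\<^sup>\<mu> \<rightarrow> M\<^sup>\<lambda>\<close> bijectively to those \<open>S\<^sup>\<mu>\<^sup>+ \<rightarrow> M\<^sup>\<lambda>\<^sup>+\<close>; it is surjective because the Garnir relations imply
  that all of them are restrictions of homomorphisms of permutation modules.

  By James' kernel intersection theorem, \<open>S\<^sup>\<lambda>\<close> is the subspace of \<open>M\<^sup>\<lambda>\<close> annihilated by the operators
  that sum over all ways of moving \<open>s \<ge> 1\<close> letters from row \<open>i\<close> to row \<open>i + 1\<close>. For \<open>i \<ge> 2\<close> the new boxes
  play no role in these conditions. For \<open>i = 1\<close> only \<open>s \<le> min {\<lambda>\<^sub>2, \<mu>\<^sub>1 - \<lambda>\<^sub>1} < p\<^sup>d\<close> matters, and the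
  terms that change \<open>0 < j \<le> s\<close> of the new boxes come with the factor \<open>K choose j\<close>, which is divisible by \<open>p\<close>.
\<close>

section \<open>Rearrangement, elimination and binomial sums\<close>

text \<open>Two leading term arguments carry the structure theory, one for vectors in the common
  kernel and one for homomorphisms into permutation modules: a relation excludes every top term
  except that of a standard tableau or a semistandard filling, and a known vector with this top term
  is subtracted. The characteristic enters through \<open>x = - x\<close>: a value that changes sign
  when two equal entries are exchanged is zero.

  The obstacle is that the kernel conditions concern all fillings \<open>U\<close>, while old and
  new fillings correspond only where the new letters carry ones. The way out is to regard
  \<open>lower\<close> applied to \<open>g e\<close>, at a fixed content, as the value at
  \<open>e\<close> of another equivariant map. The support theorem then also moves the test filling,
  which is why it must cover contents that are not partitions. Room for the move comes from
  \<open>mu 2 \<le> lam 1\<close>: at most \<open>mu 2\<close> ones of a column strict filling lie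
  under or in columns of height two or more, and the others can be permuted over the columns of
  height one. The number \<open>mu 1 - lam 1\<close> arises because ones confined to the first row
  number at most \<open>mu 1\<close>, new boxes apart.\<close>

lemma sum_subset_less:
  fixes w :: "'b \<Rightarrow> nat"
  assumes "finite A" "Y \<subseteq> A" "Z \<subseteq> A" "card Z = card Y" "Z \<noteq> Y"
    and less: "\<And>x y. y \<in> Y \<Longrightarrow> x \<in> A - Y \<Longrightarrow> w y < w x"
  shows "sum w Y < sum w Z"
proof -
  have fin: "finite Y" "finite Z" using assms(1-3) by (auto intro: finite_subset)
  have cd: "card (Y - Z) = card (Z - Y)"
    using assms(4) fin by (metis Int_commute card_Diff_subset_Int finite_Int)
  then obtain b where b: "bij_betw b (Y - Z) (Z - Y)"
    using fin by (meson finite_Diff finite_same_card_bij)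
  have ne: "Y - Z \<noteq> {}"
  proof
    assume "Y - Z = {}"
    then show False using fin assms(4,5) by (metis Diff_eq_empty_iff card_subset_eq)
  qed
  have "sum w (Y - Z) < (\<Sum>y\<in>Y - Z. w (b y))"
  proof (rule sum_strict_mono)
    fix y assume y: "y \<in> Y - Z"
    then have "b y \<in> Z - Y" using b by (auto simp: bij_betw_def)
    then show "w y < w (b y)" using y less assms(3) by auto
  qed (use fin ne in auto)
  also have "\<dots> = sum w (Z - Y)" by (rule sum.reindex_bij_betw[OF b])
  finally have "sum w (Y - Z) < sum w (Z - Y)" .
  moreover have "sum w Y = sum w (Y - Z) + sum w (Y \<inter> Z)"
    using fin by (metis add.commute sum.Int_Diff)
  moreover have "sum w Z = sum w (Z - Y) + sum w (Y \<inter> Z)"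
    using fin by (metis Int_commute add.commute sum.Int_Diff)
  ultimately show ?thesis by simp
qed

text \<open>The replaced term stands on the other side of the equation because subtraction of
  naturals is truncated.\<close>

lemma sum_fun_upd2:
  fixes f h :: "'b \<Rightarrow> nat"
  assumes "finite S" "y \<in> S"
  shows "(\<Sum>x\<in>S. f x * (h(y := a)) x) + f y * h y = (\<Sum>x\<in>S. f x * h x) + f y * a"
proof -
  have "(\<Sum>x\<in>S - {y}. f x * (h(y := a)) x) = (\<Sum>x\<in>S - {y}. f x * h x)" by (rule sum.cong) auto
  then show ?thesis
    using sum.remove[OF assms, of "\<lambda>x. f x * h x"] sum.remove[OF assms, of "\<lambda>x. f x * (h(y := a)) x"]
    by simp
qed

text \<open>Take the point \<open>z\<close> of largest weight. If \<open>h'\<close> misses the value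
  \<open>h z\<close> there, some other point \<open>y\<close> has it, and handing
  \<open>h' z\<close> to \<open>y\<close> leaves a smaller instance plus a strict gain. The clause
  on equality later makes leading terms unique.\<close>

lemma rearrangement:
  fixes f :: "'b \<Rightarrow> nat" and h h' :: "'b \<Rightarrow> nat"
  assumes "finite I" "inj_on f I"
    and "\<And>x y. x \<in> I \<Longrightarrow> y \<in> I \<Longrightarrow> f x < f y \<Longrightarrow> h x \<le> h y"
    and "image_mset h' (mset_set I) = image_mset h (mset_set I)"
  shows "(\<Sum>x\<in>I. f x * h' x) \<le> (\<Sum>x\<in>I. f x * h x) \<and>
         ((\<Sum>x\<in>I. f x * h' x) = (\<Sum>x\<in>I. f x * h x) \<longrightarrow> (\<forall>x\<in>I. h' x = h x))"
  using assms
proof (induction I arbitrary: h' rule: finite_ranking_induct[where f = f])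
  case empty
  then show ?case by simp
next
  case (insert z S)
  show ?case
  proof (cases "z \<in> S")
    case True
    then have "insert z S = S" by blast
    then show ?thesis using insert.IH[of h'] insert.prems by metis
  next
    case zS: False
    have fz: "f y < f z" if "y \<in> S" for y
      using insert.hyps(2)[OF that] insert.prems(1) zS that
      by (metis inj_on_contraD insertCI le_neq_implies_less)
    have hz: "h y \<le> h z" if "y \<in> insert z S" for y
      using that fz insert.prems(2) by auto
    have IH: "(\<Sum>x\<in>S. f x * g x) \<le> (\<Sum>x\<in>S. f x * h x) \<and>
         ((\<Sum>x\<in>S. f x * g x) = (\<Sum>x\<in>S. f x * h x) \<longrightarrow> (\<forall>x\<in>S. g x = h x))"
      if "image_mset g (mset_set S) = image_mset h (mset_set S)" for g
      using insert.IH[of g] insert.prems(1,2) that by (auto simp: inj_on_def)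
    have ms: "add_mset (h' z) (image_mset h' (mset_set S)) = add_mset (h z) (image_mset h (mset_set S))"
      using insert.prems(3) zS insert.hyps(1) by simp
    show ?thesis
    proof (cases "h' z = h z")
      case True
      then have "image_mset h' (mset_set S) = image_mset h (mset_set S)" using ms by simp
      from IH[OF this] show ?thesis using zS insert.hyps(1) True by auto
    next
      case False
      have "h z \<in># image_mset h' (mset_set S)"
        using ms False by (metis insert_noteq_member)
      then obtain y where y: "y \<in> S" "h' y = h z" using insert.hyps(1) by auto
      have "h' z \<in># add_mset (h z) (image_mset h (mset_set S))"
        using ms by (metis union_single_eq_member)
      then have "h' z \<in> h ` insert z S" using insert.hyps(1) by auto
      then have lt: "h' z < h z" using hz False by fastforce
      define g where "g = h'(y := h' z)"
      have "image_mset g (mset_set S) = add_mset (h' z) (image_mset h' (mset_set (S - {y})))"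
      proof -
        have "image_mset g (mset_set (S - {y})) = image_mset h' (mset_set (S - {y}))"
          using insert.hyps(1) by (intro image_mset_cong) (auto simp: g_def)
        then show ?thesis using mset_set.remove[OF insert.hyps(1) y(1)] by (simp add: g_def)
      qed
      moreover have "image_mset h' (mset_set S) = add_mset (h z) (image_mset h' (mset_set (S - {y})))"
        using y mset_set.remove[OF insert.hyps(1) y(1)] by simp
      ultimately have "image_mset g (mset_set S) = image_mset h (mset_set S)"
        using ms by (simp add: add_mset_commute)
      note I = IH[OF this]
      have e: "(\<Sum>x\<in>S. f x * g x) + f y * h z = (\<Sum>x\<in>S. f x * h' x) + f y * h' z"
        unfolding g_def using sum_fun_upd2[OF insert.hyps(1) y(1), of f h' "h' z"] y(2) by simp
      have "f y * h z + f z * h' z < f y * h' z + f z * h z"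
      proof -
        obtain a b where "f z = f y + a" "0 < a" "h z = h' z + b" "0 < b"
          using fz[OF y(1)] lt by (metis less_imp_add_positive)
        then show ?thesis by (simp add: algebra_simps)
      qed
      then have "(\<Sum>x\<in>S. f x * h' x) + f z * h' z < (\<Sum>x\<in>S. f x * h x) + f z * h z"
        using e I by linarith
      then show ?thesis using zS insert.hyps(1) by auto
    qed
  qed
qed

text \<open>The classes are the columns when tabloids of a polytabloid are compared, and the rows
  when images under orbit sums are. Equality of the totals forces equality in every class because
  each class obeys the inequality.\<close>

lemma rearrangement_classes:
  fixes f h h' :: "'b \<Rightarrow> nat" and q :: "'b \<Rightarrow> 'c"
  assumes "finite N"
    and inj: "\<And>x y. x \<in> N \<Longrightarrow> y \<in> N \<Longrightarrow> q x = q y \<Longrightarrow> f x = f y \<Longrightarrow> x = y"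
    and mon: "\<And>x y. x \<in> N \<Longrightarrow> y \<in> N \<Longrightarrow> q x = q y \<Longrightarrow> f x < f y \<Longrightarrow> h x \<le> h y"
    and cnt: "\<And>c v. card {x\<in>N. q x = c \<and> h' x = v} = card {x\<in>N. q x = c \<and> h x = v}"
  shows "(\<Sum>x\<in>N. f x * h' x) \<le> (\<Sum>x\<in>N. f x * h x)"
    and "(\<Sum>x\<in>N. f x * h' x) = (\<Sum>x\<in>N. f x * h x) \<Longrightarrow> x \<in> N \<Longrightarrow> h' x = h x"
proof -
  let ?I = "\<lambda>c. {x\<in>N. q x = c}"
  have R: "(\<Sum>x\<in>?I c. f x * h' x) \<le> (\<Sum>x\<in>?I c. f x * h x) \<and>
         ((\<Sum>x\<in>?I c. f x * h' x) = (\<Sum>x\<in>?I c. f x * h x) \<longrightarrow> (\<forall>x\<in>?I c. h' x = h x))" for c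
  proof (rule rearrangement)
    show "image_mset h' (mset_set (?I c)) = image_mset h (mset_set (?I c))"
    proof (rule multiset_eqI)
      fix v :: nat
      have "{a \<in> ?I c. g a = v} = {x\<in>N. q x = c \<and> g x = v}" for g by auto
      then show "count (image_mset h' (mset_set (?I c))) v = count (image_mset h (mset_set (?I c))) v"
        using assms(1) cnt by (simp add: count_image_mset_eq_card_vimage)
    qed
  qed (use assms in \<open>auto simp: inj_on_def\<close>)
  have G: "(\<Sum>c\<in>q ` N. \<Sum>x\<in>?I c. f x * g x) = (\<Sum>x\<in>N. f x * g x)" for g
    using assms(1) by (intro sum.group) auto
  show le: "(\<Sum>x\<in>N. f x * h' x) \<le> (\<Sum>x\<in>N. f x * h x)"
    unfolding G[symmetric] by (rule sum_mono) (use R in blast)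
  assume eq: "(\<Sum>x\<in>N. f x * h' x) = (\<Sum>x\<in>N. f x * h x)" and x: "x \<in> N"
  have "(\<Sum>x\<in>?I (q x). f x * h' x) = (\<Sum>x\<in>?I (q x). f x * h x)"
  proof (rule ccontr)
    assume "\<not> ?thesis"
    then have "(\<Sum>x\<in>?I (q x). f x * h' x) < (\<Sum>x\<in>?I (q x). f x * h x)" using R le_neq_implies_less by blast
    then have "(\<Sum>c\<in>q ` N. \<Sum>x\<in>?I c. f x * h' x) < (\<Sum>c\<in>q ` N. \<Sum>x\<in>?I c. f x * h x)"
      by (intro sum_strict_mono_ex1[of "q ` N"]) (use R x assms(1) in blast)+
    then show False using eq unfolding G by simp
  qed
  then show "h' x = h x" using R x by auto
qed

lemma ex_permutes_image:
  assumes "finite D" "E \<subseteq> D" "F \<subseteq> D" "card E = card F"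
  obtains \<pi> where "\<pi> permutes D" "\<pi> ` E = F"
proof -
  have fin: "finite E" "finite F" using assms(1-3) by (auto intro: finite_subset)
  obtain a where a: "bij_betw a E F" using fin assms(4) finite_same_card_bij by blast
  have "card (D - E) = card (D - F)" using assms fin by (simp add: card_Diff_subset)
  then obtain b where b: "bij_betw b (D - E) (D - F)" using assms(1) finite_same_card_bij by blast
  define \<pi> where "\<pi> x = (if x \<in> E then a x else if x \<in> D then b x else x)" for x
  have "bij_betw \<pi> E F" using a by (simp add: \<pi>_def cong: bij_betw_cong)
  moreover have "bij_betw \<pi> (D - E) (D - F)"
    using b by (subst bij_betw_cong[of _ _ b]) (auto simp: \<pi>_def)
  ultimately have "bij_betw \<pi> (E \<union> (D - E)) (F \<union> (D - F))" by (rule bij_betw_combine) auto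
  moreover have "E \<union> (D - E) = D" "F \<union> (D - F) = D" using assms by auto
  ultimately have "\<pi> permutes D" using assms(2) by (intro bij_imp_permutes) (auto simp: \<pi>_def)
  moreover have "\<pi> ` E = F" using \<open>bij_betw \<pi> E F\<close> by (simp add: bij_betw_def)
  ultimately show ?thesis using that by blast
qed

text \<open>Gaussian elimination along a level function: the support of the vector is traded for
  entries of lower level.\<close>

lemma elimination:
  fixes V D :: "('b \<Rightarrow> 'a::field) set" and l :: "'b \<Rightarrow> nat"
  assumes fin: "finite I" and supp: "\<And>x w. x \<in> V \<Longrightarrow> x w \<noteq> 0 \<Longrightarrow> w \<in> I"
    and clo: "\<And>x b c. x \<in> V \<Longrightarrow> b \<in> D \<Longrightarrow> (\<lambda>w. x w - c * b w) \<in> V"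
    and step: "\<And>x. x \<in> V \<Longrightarrow> x \<noteq> (\<lambda>_. 0) \<Longrightarrow>
       \<exists>b\<in>D. \<exists>u. x u \<noteq> 0 \<and> b u \<noteq> 0 \<and> (\<forall>w. b w \<noteq> 0 \<longrightarrow> x w \<noteq> 0 \<or> l w < l u)"
    and zero: "P (\<lambda>_. 0)"
    and add: "\<And>x b c. P x \<Longrightarrow> b \<in> D \<Longrightarrow> P (\<lambda>w. x w + c * b w)"
    and x: "x \<in> V"
  shows "P x"
proof -
  \<comment> \<open>\<open>B\<close> exceeds the number of indices, so one entry of a given level
    outweighs all entries of lower level together. Clearing \<open>u\<close> thus lowers
    \<open>\<mu>\<close> whatever appears below it.\<close>
  define B where "B = Suc (card I)"
  define \<mu> where "\<mu> x = (\<Sum>w\<in>{w. x w \<noteq> (0::'a)}. B ^ l w)" for x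
  show ?thesis using x
  proof (induction "\<mu> x" arbitrary: x rule: less_induct)
    case less
    show ?case
    proof (cases "x = (\<lambda>_. 0)")
      case True
      then show ?thesis using zero by simp
    next
      case False
      from step[OF less.prems this] obtain b u where b: "b \<in> D" "x u \<noteq> 0" "b u \<noteq> 0"
        "\<And>w. b w \<noteq> 0 \<Longrightarrow> x w \<noteq> 0 \<or> l w < l u" by blast
      define c where "c = x u / b u"
      define y where "y = (\<lambda>w. x w - c * b w)"
      have yV: "y \<in> V" unfolding y_def using clo less.prems b(1) by blast
      have yu: "y u = 0" using b by (simp add: y_def c_def)
      let ?X = "{w. x w \<noteq> 0}" and ?L = "{w\<in>I. l w < l u}"
      have fX: "finite ?X" using supp[OF less.prems] fin by (metis (mono_tags) finite_subset mem_Collect_eq subsetI)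
      have sub: "{w. y w \<noteq> 0} \<subseteq> (?X - {u}) \<union> ?L"
      proof
        fix w assume "w \<in> {w. y w \<noteq> 0}"
        then have w: "y w \<noteq> 0" by simp
        then have "w \<noteq> u" using yu by auto
        moreover have "x w \<noteq> 0 \<or> b w \<noteq> 0" using w unfolding y_def by auto
        ultimately show "w \<in> (?X - {u}) \<union> ?L" using b(4)[of w] supp[OF yV w] by blast
      qed
      have "sum (\<lambda>w. B ^ l w) ?L < B ^ l u"
      proof (cases "l u")
        case 0
        then show ?thesis by (simp add: B_def)
      next
        case (Suc k)
        have "sum (\<lambda>w. B ^ l w) ?L \<le> (\<Sum>w\<in>?L. B ^ k)"
          using Suc by (intro sum_mono power_increasing) (auto simp: B_def)
        also have "\<dots> = card ?L * B ^ k" by simp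
        also have "\<dots> \<le> card I * B ^ k" using fin by (intro mult_le_mono1 card_mono) auto
        also have "\<dots> < B ^ l u" using Suc by (simp add: B_def)
        finally show ?thesis .
      qed
      moreover have "\<mu> y \<le> sum (\<lambda>w. B ^ l w) ((?X - {u}) \<union> ?L)"
        unfolding \<mu>_def using sub fX fin by (intro sum_mono2) auto
      moreover have "\<dots> \<le> sum (\<lambda>w. B ^ l w) (?X - {u}) + sum (\<lambda>w. B ^ l w) ?L"
        using fX fin by (simp add: sum_Un_nat)
      moreover have "\<mu> x = B ^ l u + sum (\<lambda>w. B ^ l w) (?X - {u})"
        unfolding \<mu>_def using fX b(2) by (subst sum.remove[of _ u]) auto
      ultimately have "\<mu> y < \<mu> x" by linarith
      from less.hyps[OF this yV] have "P y" .
      from add[OF this b(1), of c] show ?thesis by (simp add: y_def)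
    qed
  qed
qed

text \<open>By absorption, \<open>j * (m choose j)\<close> is a multiple of
  \<open>m = k * p ^ d\<close>. If \<open>p\<close> did not divide the binomial coefficient, all of
  \<open>p ^ d\<close> would divide \<open>j\<close>, which is too small.\<close>

lemma prime_dvd_choose_mult_power:
  assumes "prime (p::nat)" "0 < j" "j < p ^ d"
  shows "p dvd ((k * p ^ d) choose j)"
proof (rule ccontr)
  assume "\<not> ?thesis"
  then have cop: "coprime (p ^ d) ((k * p ^ d) choose j)"
    using assms(1) by (simp add: prime_imp_coprime)
  obtain i where i: "j = Suc i" using assms(2) gr0_implies_Suc by blast
  have "j * (m choose j) = m * ((m - 1) choose i)" for m
    using Suc_times_binomial_eq[of "m - 1" i] i by (cases m) (auto simp: mult.commute)
  then have "p ^ d dvd j * ((k * p ^ d) choose j)" by simp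
  then have "p ^ d dvd j" using cop by (simp add: coprime_dvd_mult_left_iff)
  then show False using assms by (simp add: nat_dvd_not_less)
qed

text \<open>Subsets of equal size contribute equally, so each size gives a binomial coefficient
  times one value. The coefficient has to vanish only where the value does not: in the application
  the size is bounded by the content of a filling in the support.\<close>

lemma sum_Pow_choose:
  fixes h :: "'b set \<Rightarrow> 'a::field"
  assumes fin: "finite E"
    and sym: "\<And>S S'. S \<subseteq> E \<Longrightarrow> S' \<subseteq> E \<Longrightarrow> card S = card S' \<Longrightarrow> h S = h S'"
    and zero: "\<And>S. S \<subseteq> E \<Longrightarrow> S \<noteq> {} \<Longrightarrow> h S \<noteq> 0 \<Longrightarrow> of_nat (card E choose card S) = (0::'a)"
  shows "(\<Sum>S\<in>Pow E. h S) = h {}"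
proof -
  have "(\<Sum>S\<in>Pow E. h S) = (\<Sum>j\<in>{0..card E}. \<Sum>S\<in>{S. S \<in> Pow E \<and> card S = j}. h S)"
    using fin by (intro sum.group[symmetric]) (auto simp: card_mono)
  also have "\<dots> = (\<Sum>j\<in>{0..card E}. if j = 0 then h {} else 0)"
  proof (rule sum.cong[OF refl])
    fix j assume j: "j \<in> {0..card E}"
    show "(\<Sum>S\<in>{S. S \<in> Pow E \<and> card S = j}. h S) = (if j = 0 then h {} else 0)"
    proof (cases "j = 0")
      case True
      then have "{S. S \<in> Pow E \<and> card S = j} = {{}}"
        using fin by (auto dest: finite_subset)
      then show ?thesis using True by simp
    next
      case False
      obtain S0 where S0: "S0 \<subseteq> E" "card S0 = j"
        using j obtain_subset_with_card_n[of j E] by auto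
      have "(\<Sum>S\<in>{S. S \<in> Pow E \<and> card S = j}. h S) = (\<Sum>S\<in>{S. S \<in> Pow E \<and> card S = j}. h S0)"
        by (rule sum.cong[OF refl], rule sym) (use S0 in auto)
      also have "\<dots> = of_nat (card E choose j) * h S0"
        using n_subsets[OF fin, of j] by simp
      also have "\<dots> = 0" using zero[OF S0(1)] S0 False by (cases "S0 = {}") auto
      finally show ?thesis using False by simp
    qed
  qed
  also have "\<dots> = h {}" by simp
  finally show ?thesis .
qed

section \<open>Tabloids and polytabloids\<close>

lemma is_partition_antimono:
  assumes "is_partition n mu" "1 \<le> i" "i \<le> j"
  shows "mu j \<le> mu i"
  using assms(3,2)
proof (induction j rule: dec_induct)
  case (step j)
  then have "mu (Suc j) \<le> mu j" using assms(1) by (simp add: is_partition_def)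
  then show ?case using step by simp
qed simp

lemma young_up:
  assumes "is_partition n mu" "(i, j) \<in> young mu" "1 \<le> i'" "i' \<le> i"
  shows "(i', j) \<in> young mu"
  using is_partition_antimono[OF assms(1,3,4)] assms by (auto simp: young_def)

lemma add_first_partition:
  assumes "is_partition n mu"
  shows "is_partition (n + m) (add_first mu m)"
proof (cases "n + m = 0")
  case True
  then show ?thesis using assms by (simp add: add_first_def)
next
  case False
  have "(\<Sum>i=1..n + m. (mu(1 := mu 1 + m)) i) = (\<Sum>i=1..n + m. mu i + (if i = 1 then m else 0))"
    by (rule sum.cong) auto
  also have "\<dots> = (\<Sum>i=1..n + m. mu i) + m" using False by (auto simp: sum.distrib)
  also have "(\<Sum>i=1..n + m. mu i) = (\<Sum>i=1..n. mu i)"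
    using assms by (intro sum.mono_neutral_right) (auto simp: is_partition_def)
  finally show ?thesis using assms False
    by (auto simp: is_partition_def add_first_def le_SucI trans_le_add1)
qed

text \<open>The value of \<open>row_of\<close> and \<open>col_of\<close> outside \<open>{1..n}\<close> is the same for all tableaux.\<close>

definition junk_row :: nat where
  "junk_row = fst (SOME x :: nat \<times> nat. False)"

text \<open>The fixed value outside \<open>{1..n}\<close> makes equality of tabloids equality of
  functions. Here \<open>lam\<close> stands for any content, since the arguments of
  \<open>lower\<close> have contents that may fail to be partitions.\<close>

definition tabloids :: "nat \<Rightarrow> (nat \<Rightarrow> nat) \<Rightarrow> (nat \<Rightarrow> nat) set" where
  "tabloids n lam = {T. (\<forall>m. m \<notin> {1..n} \<longrightarrow> T m = junk_row) \<and>
     (\<forall>i. card {m\<in>{1..n}. T m = i} = lam i)}"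

definition perm_module :: "nat \<Rightarrow> (nat \<Rightarrow> nat) \<Rightarrow> ((nat \<Rightarrow> nat) \<Rightarrow> 'a::field) set" where
  "perm_module n lam = {v. \<forall>T. v T \<noteq> 0 \<longrightarrow> T \<in> tabloids n lam}"

lemma finite_tabloids: "finite (tabloids n lam)"
proof (cases "tabloids n lam = {}")
  case False
  have sub: "T ` {1..n} \<subseteq> {i. lam i \<noteq> 0}" "{i. lam i \<noteq> 0} \<subseteq> T ` {1..n}" if "T \<in> tabloids n lam" for T
  proof -
    have c: "card {m\<in>{1..n}. T m = i} = lam i" for i using that by (simp add: tabloids_def)
    show "T ` {1..n} \<subseteq> {i. lam i \<noteq> 0}" using c[symmetric] by auto
    show "{i. lam i \<noteq> 0} \<subseteq> T ` {1..n}"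
    proof
      fix i assume "i \<in> {i. lam i \<noteq> 0}"
      then have "card {m\<in>{1..n}. T m = i} > 0" using c[of i] by simp
      then show "i \<in> T ` {1..n}" unfolding card_gt_0_iff by auto
    qed
  qed
  have "finite {i. lam i \<noteq> 0}"
  proof -
    from False obtain T where "T \<in> tabloids n lam" by blast
    from sub(2)[OF this] show ?thesis by (rule finite_subset) simp
  qed
  then have "finite {T. \<forall>m. (m \<in> {1..n} \<longrightarrow> T m \<in> {i. lam i \<noteq> 0}) \<and> (m \<notin> {1..n} \<longrightarrow> T m = junk_row)}"
    by (intro finite_set_of_finite_funs) auto
  then show ?thesis
  proof (rule rev_finite_subset, intro subsetI)
    fix T assume T: "T \<in> tabloids n lam"
    show "T \<in> {T. \<forall>m. (m \<in> {1..n} \<longrightarrow> T m \<in> {i. lam i \<noteq> 0}) \<and> (m \<notin> {1..n} \<longrightarrow> T m = junk_row)}"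
      using sub(1)[OF T] T unfolding tabloids_def by blast
  qed
qed simp

lemma tabloids_comp:
  assumes \<sigma>: "\<sigma> permutes {1..n}"
  shows "T \<circ> \<sigma> \<in> tabloids n lam \<longleftrightarrow> T \<in> tabloids n lam"
proof -
  have "card {m\<in>{1..n}. (T \<circ> \<sigma>) m = i} = card {m\<in>{1..n}. T m = i}" for i
  proof -
    have "\<sigma> ` {m\<in>{1..n}. (T \<circ> \<sigma>) m = i} = {m\<in>{1..n}. T m = i}"
    proof (intro equalityI subsetI)
      fix m assume "m \<in> {m\<in>{1..n}. T m = i}"
      then have "m = \<sigma> (inv \<sigma> m)" "inv \<sigma> m \<in> {m\<in>{1..n}. (T \<circ> \<sigma>) m = i}"
        using \<sigma> permutes_in_image[OF permutes_inv[OF \<sigma>], of m] by (auto simp: permutes_inverses)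
      then show "m \<in> \<sigma> ` {m\<in>{1..n}. (T \<circ> \<sigma>) m = i}" by blast
    qed (use permutes_in_image[OF \<sigma>] in auto)
    then show ?thesis using card_image[OF permutes_inj_on[OF \<sigma>], of "{m\<in>{1..n}. (T \<circ> \<sigma>) m = i}"] by simp
  qed
  moreover have "(\<forall>m. m \<notin> {1..n} \<longrightarrow> (T \<circ> \<sigma>) m = junk_row) \<longleftrightarrow> (\<forall>m. m \<notin> {1..n} \<longrightarrow> T m = junk_row)"
    using permutes_not_in[OF \<sigma>] by auto
  ultimately show ?thesis by (simp add: tabloids_def)
qed

lemma perm_module_perm_act:
  "\<sigma> permutes {1..n} \<Longrightarrow> v \<in> perm_module n lam \<Longrightarrow> perm_act \<sigma> v \<in> perm_module n lam"
  using tabloids_comp by (auto simp: perm_module_def perm_act_def)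

lemma perm_act_linear: "perm_act \<sigma> (\<lambda>T. c * v T + w T) = (\<lambda>T. c * perm_act \<sigma> v T + perm_act \<sigma> w T)"
  by (simp add: perm_act_def)

section \<open>Rows, columns and the polytabloid of a fixed tableau\<close>

locale tableau =
  fixes n :: nat and mu :: "nat \<Rightarrow> nat" and t :: "nat \<times> nat \<Rightarrow> nat"
  assumes mu: "is_partition n mu" and t: "t \<in> tableaux n mu"
begin

abbreviation "r \<equiv> row_of mu t"
abbreviation "c \<equiv> col_of mu t"
abbreviation "C \<equiv> col_stab n mu t"
abbreviation "e \<equiv> polytabloid n mu t"

lemma bij_t: "bij_betw t (young mu) {1..n}"
  using t by (simp add: tableaux_def)

lemma box:
  assumes "m \<in> {1..n}"
  shows "(r m, c m) \<in> young mu" and "t (r m, c m) = m"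
proof -
  have "m \<in> t ` young mu" using bij_t assms by (simp add: bij_betw_def)
  then show "(r m, c m) \<in> young mu" "t (r m, c m) = m"
    using inv_into_into[of m t "young mu"] f_inv_into_f[of m t "young mu"]
    by (simp_all add: row_of_def col_of_def)
qed

lemma row_col_pos: "m \<in> {1..n} \<Longrightarrow> 1 \<le> r m \<and> 1 \<le> c m \<and> c m \<le> mu (r m)"
  using box(1) by (auto simp: young_def)

lemma row_col_t:
  assumes "(i, j) \<in> young mu"
  shows "r (t (i, j)) = i" "c (t (i, j)) = j" "t (i, j) \<in> {1..n}"
  using assms bij_t inv_into_f_f[of t "young mu" "(i, j)"]
  by (auto simp: row_of_def col_of_def bij_betw_def)

lemma box_inj: "m \<in> {1..n} \<Longrightarrow> m' \<in> {1..n} \<Longrightarrow> r m = r m' \<Longrightarrow> c m = c m' \<Longrightarrow> m = m'"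
  using box(2) by metis

lemma row_out: "m \<notin> {1..n} \<Longrightarrow> r m = junk_row"
proof -
  assume "m \<notin> {1..n}"
  then have "m \<notin> t ` young mu" using bij_t by (simp add: bij_betw_def)
  then have "(\<lambda>y. y \<in> young mu \<and> t y = m) = (\<lambda>y. False)" by auto
  then show ?thesis by (simp add: row_of_def inv_into_def junk_row_def)
qed

lemma card_row: "card {m\<in>{1..n}. r m = i} = mu i"
proof (cases "i = 0")
  case True
  have "{m\<in>{1..n}. r m = 0} = {}" using row_col_pos by force
  then have "card {m\<in>{1..n}. r m = 0} = 0" by (metis card.empty)
  then show ?thesis using True mu by (simp add: is_partition_def)
next
  case False
  then have Y: "(i, j) \<in> young mu \<longleftrightarrow> j \<in> {1..mu i}" for j by (auto simp: young_def)
  have "bij_betw (\<lambda>j. t (i, j)) {1..mu i} {m\<in>{1..n}. r m = i}"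
  proof (rule bij_betwI[where g = c])
    show "(\<lambda>j. t (i, j)) \<in> {1..mu i} \<rightarrow> {m\<in>{1..n}. r m = i}"
      using row_col_t Y by auto
    show "c \<in> {m\<in>{1..n}. r m = i} \<rightarrow> {1..mu i}" using row_col_pos by auto
  next
    show "c (t (i, j)) = j" if "j \<in> {1..mu i}" for j using row_col_t Y that by blast
    show "t (i, c m) = m" if "m \<in> {m\<in>{1..n}. r m = i}" for m using box(2)[of m] that by auto
  qed
  from bij_betw_same_card[OF this] show ?thesis by simp
qed

lemma row_tabloid: "r \<in> tabloids n mu"
  using row_out card_row by (simp add: tabloids_def)

lemma C_permutes: "\<pi> \<in> C \<Longrightarrow> \<pi> permutes {1..n}"
  by (simp add: col_stab_def)

lemma C_permutation: "\<pi> \<in> C \<Longrightarrow> permutation \<pi>"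
  using C_permutes permutation_permutes by blast

lemma C_col: "\<pi> \<in> C \<Longrightarrow> m \<in> {1..n} \<Longrightarrow> c (\<pi> m) = c m"
  by (simp add: col_stab_def)

lemma C_id: "id \<in> C"
  by (auto simp: col_stab_def permutes_id)

lemma C_comp: "\<pi> \<in> C \<Longrightarrow> \<rho> \<in> C \<Longrightarrow> \<pi> \<circ> \<rho> \<in> C"
  unfolding col_stab_def by (simp add: permutes_compose) (metis atLeastAtMost_iff One_nat_def permutes_in_image)

lemma C_inv: "\<pi> \<in> C \<Longrightarrow> inv \<pi> \<in> C"
proof -
  assume p: "\<pi> \<in> C"
  note P = C_permutes[OF p]
  have "c (inv \<pi> m) = c m" if "m \<in> {1..n}" for m
    using C_col[OF p, of "inv \<pi> m"] that permutes_in_image[OF permutes_inv[OF P], of m] permutes_inverses(1)[OF P]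
    by simp
  then show ?thesis using P permutes_inv by (auto simp: col_stab_def)
qed

lemma C_transpose: "x \<in> {1..n} \<Longrightarrow> y \<in> {1..n} \<Longrightarrow> c x = c y \<Longrightarrow> transpose x y \<in> C"
  unfolding col_stab_def by (auto simp: transpose_def intro!: permutes_swap_id)

lemma poly_nonzeroD:
  assumes "e T \<noteq> 0"
  obtains \<pi> where "\<pi> \<in> C" "T = r \<circ> inv \<pi>"
proof -
  have "{\<pi>\<in>C. r \<circ> inv \<pi> = T} \<noteq> {}"
    using assms unfolding polytabloid_def by (metis sum.empty)
  then show ?thesis using that by auto
qed

text \<open>Column permutations move letters within their columns, so a tabloid of the support still
  fits the diagram. Vanishing of \<open>e\<close> for reasons of shape is always derived from
  this.\<close>

lemma poly_young:
  assumes "e T \<noteq> 0" "m \<in> {1..n}"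
  shows "(T m, c m) \<in> young mu"
proof -
  obtain \<pi> where p: "\<pi> \<in> C" "T = r \<circ> inv \<pi>" using poly_nonzeroD[OF assms(1)] .
  have "inv \<pi> m \<in> {1..n}" using permutes_in_image[OF permutes_inv[OF C_permutes[OF p(1)]]] assms by blast
  then show ?thesis using box(1)[of "inv \<pi> m"] C_col[OF C_inv[OF p(1)] assms(2)] p(2) by simp
qed

lemma poly_perm_module: "e \<in> perm_module n mu"
  unfolding perm_module_def
proof (intro CollectI allI impI)
  fix T assume "(e T :: 'a) \<noteq> 0"
  then obtain \<pi> where p: "\<pi> \<in> C" "T = r \<circ> inv \<pi>" using poly_nonzeroD by blast
  then show "T \<in> tabloids n mu"
    using row_tabloid tabloids_comp[OF permutes_inv[OF C_permutes[OF p(1)]]] by blast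
qed

lemma poly_alternating:
  assumes \<rho>: "\<rho> \<in> C"
  shows "(e (T \<circ> \<rho>) :: 'a::field) = of_int (sign \<rho>) * e T"
proof -
  note R = C_permutes[OF \<rho>]
  have "(e (T \<circ> \<rho>) :: 'a) = (\<Sum>\<pi>\<in>{\<pi>\<in>C. r \<circ> inv \<pi> = T}. of_int (sign (inv \<rho> \<circ> \<pi>)))"
    unfolding polytabloid_def
  proof (rule sum.reindex_bij_witness[where i = "\<lambda>\<pi>. inv \<rho> \<circ> \<pi>" and j = "\<lambda>\<pi>. \<rho> \<circ> \<pi>"])
    fix a assume a: "a \<in> {\<pi>\<in>C. r \<circ> inv \<pi> = T \<circ> \<rho>}"
    show 1: "inv \<rho> \<circ> (\<rho> \<circ> a) = a"
      using R by (metis comp_assoc id_comp permutes_inv_o(2))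
    show "of_int (sign (inv \<rho> \<circ> (\<rho> \<circ> a))) = (of_int (sign a) :: 'a)" using 1 by simp
    have "inv (\<rho> \<circ> a) = inv a \<circ> inv \<rho>"
      using R a C_permutes permutes_bij by (intro o_inv_distrib) auto
    then have "r \<circ> inv (\<rho> \<circ> a) = T \<circ> (\<rho> \<circ> inv \<rho>)" using a by (metis (mono_tags, lifting) comp_assoc mem_Collect_eq)
    then show "\<rho> \<circ> a \<in> {\<pi>\<in>C. r \<circ> inv \<pi> = T}"
      using a C_comp[OF \<rho>] permutes_inv_o(1)[OF R] by auto
  next
    fix b assume b: "b \<in> {\<pi>\<in>C. r \<circ> inv \<pi> = T}"
    show "\<rho> \<circ> (inv \<rho> \<circ> b) = b" using R by (metis comp_assoc id_comp permutes_inv_o(1))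
    have "inv (inv \<rho> \<circ> b) = inv b \<circ> inv (inv \<rho>)"
      by (intro o_inv_distrib permutes_bij[OF permutes_inv[OF R]] permutes_bij[OF C_permutes]) (use b in auto)
    then have "r \<circ> inv (inv \<rho> \<circ> b) = T \<circ> \<rho>"
      using b R by (simp add: permutes_inv_inv comp_assoc[symmetric])
    then show "inv \<rho> \<circ> b \<in> {\<pi>\<in>C. r \<circ> inv \<pi> = T \<circ> \<rho>}"
      using b C_comp[OF C_inv[OF \<rho>]] by auto
  qed
  also have "\<dots> = (\<Sum>\<pi>\<in>{\<pi>\<in>C. r \<circ> inv \<pi> = T}. of_int (sign \<rho>) * of_int (sign \<pi>))"
    using sign_compose[OF permutation_inverse[OF C_permutation[OF \<rho>]] C_permutation]
    by (intro sum.cong) (auto simp: sign_inverse[OF C_permutation[OF \<rho>]])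
  finally show ?thesis by (simp add: polytabloid_def sum_distrib_left)
qed

lemma perm_tableau:
  assumes "\<sigma> permutes {1..n}"
  shows "\<sigma> \<circ> t \<in> tableaux n mu"
  using bij_t assms by (auto simp: tableaux_def intro: bij_betw_trans permutes_imp_bij)

text \<open>Conjugation by \<open>\<sigma>\<close> carries the column stabilizer of \<open>t\<close>
  to that of \<open>\<sigma> \<circ> t\<close> and preserves signs.\<close>

lemma perm_act_poly:
  assumes \<sigma>: "\<sigma> permutes {1..n}"
  shows "perm_act \<sigma> e = polytabloid n mu (\<sigma> \<circ> t)"
proof
  fix T
  interpret s: tableau n mu "\<sigma> \<circ> t" using mu perm_tableau[OF \<sigma>] by unfold_locales
  have bs: "bij \<sigma>" using permutes_bij[OF \<sigma>] .
  have inv_in: "inv \<sigma> m \<in> {1..n} \<longleftrightarrow> m \<in> {1..n}" for m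
    using permutes_in_image[OF permutes_inv[OF \<sigma>]] .
  have B: "inv_into (young mu) (\<sigma> \<circ> t) m = inv_into (young mu) t (inv \<sigma> m)" for m
  proof -
    have "(\<lambda>y. y \<in> young mu \<and> (\<sigma> \<circ> t) y = m) = (\<lambda>y. y \<in> young mu \<and> t y = inv \<sigma> m)"
      using permutes_inverses[OF \<sigma>] by auto
    then show ?thesis by (simp add: inv_into_def)
  qed
  have R: "s.r = r \<circ> inv \<sigma>" by (rule ext) (simp add: row_of_def B)
  have Cc: "s.c m = c (inv \<sigma> m)" for m by (simp add: col_of_def B)
  have CC1: "\<sigma> \<circ> \<pi> \<circ> inv \<sigma> \<in> s.C" if "\<pi> \<in> C" for \<pi>
    using C_permutes[OF that] C_col[OF that] \<sigma> inv_in permutes_inv[OF \<sigma>]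
    unfolding col_stab_def by (auto intro!: permutes_compose simp: Cc permutes_inverses)
  have CC2: "inv \<sigma> \<circ> \<pi> \<circ> \<sigma> \<in> C" if "\<pi> \<in> s.C" for \<pi>
  proof -
    have "c (inv \<sigma> (\<pi> (\<sigma> m))) = c m" if "m \<in> {1..n}" for m
      using s.C_col[OF \<open>\<pi> \<in> s.C\<close>, of "\<sigma> m"] that permutes_in_image[OF \<sigma>] by (simp add: Cc permutes_inverses[OF \<sigma>])
    then show ?thesis using s.C_permutes[OF that] \<sigma> permutes_inv[OF \<sigma>]
      unfolding col_stab_def by (auto intro!: permutes_compose)
  qed
  show "perm_act \<sigma> e T = (s.e T :: 'a::field)"
    unfolding perm_act_def polytabloid_def
  proof (rule sum.reindex_bij_witness[where i = "\<lambda>\<pi>. inv \<sigma> \<circ> \<pi> \<circ> \<sigma>" and j = "\<lambda>\<pi>. \<sigma> \<circ> \<pi> \<circ> inv \<sigma>"])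
    fix a assume a: "a \<in> {\<pi>\<in>C. r \<circ> inv \<pi> = T \<circ> \<sigma>}"
    show "inv \<sigma> \<circ> (\<sigma> \<circ> a \<circ> inv \<sigma>) \<circ> \<sigma> = a"
      by (rule ext) (simp add: permutes_inverses[OF \<sigma>])
    have "inv (\<sigma> \<circ> a \<circ> inv \<sigma>) = \<sigma> \<circ> inv a \<circ> inv \<sigma>"
      using a C_permutes[of a] permutes_inverses[of a "{1..n}"]
      by (intro inv_unique_comp) (auto simp: fun_eq_iff permutes_inverses[OF \<sigma>])
    then have "s.r \<circ> inv (\<sigma> \<circ> a \<circ> inv \<sigma>) = (r \<circ> inv a) \<circ> inv \<sigma>"
      by (auto simp: R fun_eq_iff permutes_inverses[OF \<sigma>])
    then have "s.r \<circ> inv (\<sigma> \<circ> a \<circ> inv \<sigma>) = T" using a by (auto simp: fun_eq_iff permutes_inverses[OF \<sigma>])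
    then show "\<sigma> \<circ> a \<circ> inv \<sigma> \<in> {\<pi>\<in>s.C. s.r \<circ> inv \<pi> = T}" using a CC1 by auto
    have "sign (\<sigma> \<circ> a \<circ> inv \<sigma>) = sign a"
    proof -
      have "permutation \<sigma>" "permutation a" "permutation (inv \<sigma>)"
        using \<sigma> a C_permutation permutation_permutes permutation_inverse by auto
      then show ?thesis by (simp add: sign_compose permutation_compose sign_inverse)
    qed
    then show "of_int (sign (\<sigma> \<circ> a \<circ> inv \<sigma>)) = (of_int (sign a) :: 'a)" by simp
  next
    fix b assume b: "b \<in> {\<pi>\<in>s.C. s.r \<circ> inv \<pi> = T}"
    show "\<sigma> \<circ> (inv \<sigma> \<circ> b \<circ> \<sigma>) \<circ> inv \<sigma> = b"
      by (rule ext) (simp add: permutes_inverses[OF \<sigma>])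
    have "inv (inv \<sigma> \<circ> b \<circ> \<sigma>) = inv \<sigma> \<circ> inv b \<circ> \<sigma>"
      using b s.C_permutes[of b] permutes_inverses[of b "{1..n}"]
      by (intro inv_unique_comp) (auto simp: fun_eq_iff permutes_inverses[OF \<sigma>])
    then have "r \<circ> inv (inv \<sigma> \<circ> b \<circ> \<sigma>) = s.r \<circ> inv b \<circ> \<sigma>" by (simp add: R comp_assoc)
    then show "inv \<sigma> \<circ> b \<circ> \<sigma> \<in> {\<pi>\<in>C. r \<circ> inv \<pi> = T \<circ> \<sigma>}" using b CC2 by auto
  qed
qed

text \<open>The symmetric group is transitive on tableaux, so \<open>e\<close> generates the Specht
  module. Tableaux are determined only on the diagram; \<open>inv_into\<close> does not see their
  values elsewhere.\<close>

lemma tableau_perm: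
  assumes "t' \<in> tableaux n mu"
  obtains \<sigma> where "\<sigma> permutes {1..n}" "polytabloid n mu t' = (perm_act \<sigma> e :: (nat \<Rightarrow> nat) \<Rightarrow> 'a::field)"
proof -
  have b': "bij_betw t' (young mu) {1..n}" using assms by (simp add: tableaux_def)
  define \<sigma> where "\<sigma> m = (if m \<in> {1..n} then t' (inv_into (young mu) t m) else m)" for m
  have "bij_betw (t' \<circ> inv_into (young mu) t) {1..n} {1..n}"
    using bij_betw_trans[OF bij_betw_inv_into[OF bij_t] b'] .
  then have "bij_betw \<sigma> {1..n} {1..n}" by (subst bij_betw_cong[of _ _ "t' \<circ> inv_into (young mu) t"]) (auto simp: \<sigma>_def)
  then have P: "\<sigma> permutes {1..n}" by (rule bij_imp_permutes) (auto simp: \<sigma>_def)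
  have eq: "t' x = (\<sigma> \<circ> t) x" if "x \<in> young mu" for x
    using that bij_t by (auto simp: \<sigma>_def bij_betw_def)
  have "inv_into (young mu) t' = inv_into (young mu) (\<sigma> \<circ> t)"
    unfolding inv_into_def using eq by (intro ext arg_cong[where f = Eps]) auto
  then have "row_of mu t' = row_of mu (\<sigma> \<circ> t)" "col_of mu t' = col_of mu (\<sigma> \<circ> t)"
    by (auto simp: row_of_def col_of_def fun_eq_iff)
  then have "polytabloid n mu t' = (polytabloid n mu (\<sigma> \<circ> t) :: (nat \<Rightarrow> nat) \<Rightarrow> 'a)"
    by (simp add: polytabloid_def col_stab_def)
  then show ?thesis using P that perm_act_poly by metis
qed

end

section \<open>The kernel intersection theorem\<close>

lemma specht_zero: "(\<lambda>T. 0) \<in> specht n mu"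
  unfolding specht_def by (intro CollectI exI[of _ "{}"]) auto

lemma specht_poly:
  assumes "t \<in> tableaux n mu"
  shows "polytabloid n mu t \<in> specht n mu"
  unfolding specht_def by (intro CollectI exI[of _ "{t}"] exI[of _ "\<lambda>_. 1"]) (use assms in auto)

lemma specht_lin:
  fixes v w :: "(nat \<Rightarrow> nat) \<Rightarrow> 'a::field"
  assumes "v \<in> specht n mu" "w \<in> specht n mu"
  shows "(\<lambda>T. k * v T + w T) \<in> specht n mu"
proof -
  obtain A a where A: "finite A" "A \<subseteq> tableaux n mu" "v = (\<lambda>T. \<Sum>t\<in>A. a t * polytabloid n mu t T)"
    using assms(1) unfolding specht_def by auto
  obtain B b where B: "finite B" "B \<subseteq> tableaux n mu" "w = (\<lambda>T. \<Sum>t\<in>B. b t * polytabloid n mu t T)"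
    using assms(2) unfolding specht_def by auto
  define d where "d t = k * (if t \<in> A then a t else 0) + (if t \<in> B then b t else 0)" for t
  have "k * v T + w T = (\<Sum>t\<in>A \<union> B. d t * polytabloid n mu t T)" for T
  proof -
    have "v T = (\<Sum>t\<in>A \<union> B. (if t \<in> A then a t else 0) * polytabloid n mu t T)"
      unfolding A(3) using A(1) B(1) by (intro sum.mono_neutral_cong_left) auto
    moreover have "w T = (\<Sum>t\<in>A \<union> B. (if t \<in> B then b t else 0) * polytabloid n mu t T)"
      unfolding B(3) using A(1) B(1) by (intro sum.mono_neutral_cong_left) auto
    ultimately show ?thesis
      by (simp add: d_def sum_distrib_left sum.distrib[symmetric] algebra_simps)
  qed
  then show ?thesis unfolding specht_def
    by (intro CollectI exI[of _ "A \<union> B"] exI[of _ d]) (use A B in auto)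
qed

lemma specht_sum:
  assumes "finite B" "\<And>s. s \<in> B \<Longrightarrow> v s \<in> specht n mu"
  shows "(\<lambda>T. \<Sum>s\<in>B. k s * v s T) \<in> specht n mu"
  using assms by (induction B rule: finite_induct) (auto intro: specht_zero specht_lin)

lemma specht_induct [consumes 1, case_names zero add]:
  fixes v :: "(nat \<Rightarrow> nat) \<Rightarrow> 'a::field"
  assumes "v \<in> specht n mu" "P (\<lambda>T. 0)"
    and add: "\<And>k t w. t \<in> tableaux n mu \<Longrightarrow> w \<in> specht n mu \<Longrightarrow> P w \<Longrightarrow> P (\<lambda>T. k * polytabloid n mu t T + w T)"
  shows "P v"
proof -
  obtain A a where A: "finite A" "A \<subseteq> tableaux n mu" "v = (\<lambda>T. \<Sum>t\<in>A. a t * polytabloid n mu t T)"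
    using assms(1) unfolding specht_def by auto
  have "P (\<lambda>T. \<Sum>t\<in>A. a t * polytabloid n mu t T)" using A(1,2)
  proof (induction A rule: finite_induct)
    case (insert x F)
    have "(\<lambda>T. \<Sum>t\<in>F. a t * polytabloid n mu t T) \<in> specht n mu"
      using insert unfolding specht_def by blast
    then show ?case using insert add[of x "\<lambda>T. \<Sum>t\<in>F. a t * polytabloid n mu t T" "a x"] by auto
  qed (use assms(2) in simp)
  then show ?thesis using A(3) by simp
qed

lemma specht_perm_act:
  assumes "is_partition n mu" and \<sigma>: "\<sigma> permutes {1..n}" and v: "v \<in> specht n mu"
  shows "perm_act \<sigma> v \<in> specht n mu"
  using v
proof (induction rule: specht_induct)
  case zero
  then show ?case using specht_zero by (simp add: perm_act_def)
next
  case (add k t w)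
  interpret tableau n mu t using assms(1) add by unfold_locales
  show ?case unfolding perm_act_linear perm_act_poly[OF \<sigma>]
    using add specht_lin specht_poly[OF perm_tableau[OF \<sigma>]] by blast
qed

lemma perm_module_lin:
  "v \<in> perm_module n lam \<Longrightarrow> w \<in> perm_module n lam \<Longrightarrow> (\<lambda>T. k * v T + w T) \<in> perm_module n lam"
  unfolding perm_module_def mem_Collect_eq by (metis add_0 mult_zero_right)

lemma perm_module_zero: "(\<lambda>T. 0) \<in> perm_module n lam"
  by (simp add: perm_module_def)

lemma specht_perm_module:
  assumes "is_partition n mu" and v: "v \<in> specht n mu"
  shows "v \<in> perm_module n mu"
  using v
proof (induction rule: specht_induct)
  case (add k t w)
  interpret tableau n mu t using assms(1) add by unfold_locales
  show ?case using perm_module_lin poly_perm_module add by blast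
qed (rule perm_module_zero)

section \<open>James' operators and their common kernel\<close>

definition set_on :: "nat set \<Rightarrow> nat \<Rightarrow> (nat \<Rightarrow> nat) \<Rightarrow> nat \<Rightarrow> nat" where
  "set_on S i U = (\<lambda>m. if m \<in> S then i else U m)"

abbreviation fibre :: "nat \<Rightarrow> (nat \<Rightarrow> nat) \<Rightarrow> nat \<Rightarrow> nat set" where
  "fibre n U i \<equiv> {m\<in>{1..n}. U m = i}"

text \<open>James' operators \<open>\<psi>\<^sub>i\<^sub>,\<^sub>s\<close> for all \<open>s \<ge> 1\<close> at once: on an element of the permutation module only
  the subsets \<open>S\<close> of the one size allowed by the content contribute.\<close>

definition lower :: "nat \<Rightarrow> nat \<Rightarrow> ((nat \<Rightarrow> nat) \<Rightarrow> 'a::field) \<Rightarrow> (nat \<Rightarrow> nat) \<Rightarrow> 'a" where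
  "lower n i v U = (\<Sum>S\<in>Pow (fibre n U i). v (set_on S (Suc i) U))"

text \<open>The excess of the fibre over \<open>lam i\<close> is the number \<open>s\<close> of
  letters that must go down to reach content \<open>lam\<close>. Strictness excludes
  \<open>s = 0\<close>, where the operator is the identity.\<close>

definition in_kernel :: "nat \<Rightarrow> (nat \<Rightarrow> nat) \<Rightarrow> ((nat \<Rightarrow> nat) \<Rightarrow> 'a::field) \<Rightarrow> bool" where
  "in_kernel n lam v \<longleftrightarrow> (\<forall>i\<ge>1. \<forall>U. card (fibre n U i) > lam i \<longrightarrow> lower n i v U = 0)"

lemma lower_lin: "lower n i (\<lambda>T. k * v T + w T) U = k * lower n i v U + lower n i w U"
  by (simp add: lower_def sum.distrib sum_distrib_left)

lemma fibre_comp: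
  assumes "\<sigma> permutes {1..n}"
  shows "\<sigma> ` fibre n (U \<circ> \<sigma>) i = fibre n U i"
proof (intro equalityI subsetI)
  fix m assume "m \<in> fibre n U i"
  then have "m = \<sigma> (inv \<sigma> m)" "inv \<sigma> m \<in> fibre n (U \<circ> \<sigma>) i"
    using assms permutes_in_image[OF permutes_inv[OF assms], of m] by (auto simp: permutes_inverses)
  then show "m \<in> \<sigma> ` fibre n (U \<circ> \<sigma>) i" by blast
qed (use permutes_in_image[OF assms] in auto)

lemma lower_perm_act:
  assumes \<sigma>: "\<sigma> permutes {1..n}"
  shows "lower n i (perm_act \<sigma> v) U = lower n i v (U \<circ> \<sigma>)"
proof -
  have f: "\<sigma> ` fibre n (U \<circ> \<sigma>) i = fibre n U i" by (rule fibre_comp[OF \<sigma>])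
  have inj: "inj \<sigma>" using permutes_inj[OF \<sigma>] .
  have "lower n i (perm_act \<sigma> v) U = (\<Sum>S\<in>(`) \<sigma> ` Pow (fibre n (U \<circ> \<sigma>) i). v (set_on S (Suc i) U \<circ> \<sigma>))"
    unfolding lower_def perm_act_def image_Pow_surj[OF f] by (rule refl)
  also have "\<dots> = (\<Sum>S\<in>Pow (fibre n (U \<circ> \<sigma>) i). v (set_on (\<sigma> ` S) (Suc i) U \<circ> \<sigma>))"
    using inj by (subst sum.reindex) (auto simp: inj_on_def inj_image_eq_iff)
  also have "\<dots> = lower n i v (U \<circ> \<sigma>)"
    unfolding lower_def using inj
    by (intro sum.cong refl arg_cong[where f = v]) (auto simp: set_on_def fun_eq_iff inj_image_mem_iff)
  finally show ?thesis .
qed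

lemma in_kernel_perm_act:
  assumes \<sigma>: "\<sigma> permutes {1..n}" and v: "in_kernel n lam v"
  shows "in_kernel n lam (perm_act \<sigma> v)"
  unfolding in_kernel_def
proof (intro allI impI)
  fix i U assume "1 \<le> i" and less: "lam i < card (fibre n U i)"
  have "card (fibre n (U \<circ> \<sigma>) i) = card (fibre n U i)"
    using card_image[OF permutes_inj_on[OF \<sigma>], of "fibre n (U \<circ> \<sigma>) i"] fibre_comp[OF \<sigma>, of U i] by simp
  then show "lower n i (perm_act \<sigma> v) U = 0"
    using v \<open>1 \<le> i\<close> less by (simp add: lower_perm_act[OF \<sigma>] in_kernel_def)
qed

lemma in_kernel_lin:
  "in_kernel n lam v \<Longrightarrow> in_kernel n lam w \<Longrightarrow> in_kernel n lam (\<lambda>T. k * v T + w T)"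
  by (simp add: in_kernel_def lower_lin)

lemma in_kernel_zero: "in_kernel n lam (\<lambda>T. 0)"
  by (simp add: in_kernel_def lower_def)

lemma eq_uminus_imp_zero:
  fixes x :: "'a::field"
  assumes "(2::'a) \<noteq> 0" "x = - x"
  shows "x = 0"
proof -
  have "2 * x = 0" using assms(2) by (metis add.right_inverse mult_2)
  then show ?thesis using assms(1) by simp
qed

text \<open>If a letter of the fibre lies in a column beyond \<open>mu i\<close>, it fits neither in
  row \<open>i\<close> nor in row \<open>i + 1\<close>, and all terms vanish. Otherwise two letters
  of the fibre share a column; exchanging them fixes \<open>U\<close> and negates \<open>e\<close>,
  so the sum equals its negative.\<close>

lemma (in tableau) poly_in_kernel:
  assumes two: "(2::'a::field) \<noteq> 0"
  shows "in_kernel n mu (e :: (nat \<Rightarrow> nat) \<Rightarrow> 'a)"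
  unfolding in_kernel_def
proof (intro allI impI)
  fix i U assume i: "1 \<le> i" and less: "mu i < card (fibre n U i)"
  let ?F = "fibre n U i"
  show "lower n i e U = (0::'a)"
  proof (cases "c ` ?F \<subseteq> {1..mu i}")
    case False
    have "(e (set_on S (Suc i) U) :: 'a) = 0" if S: "S \<in> Pow ?F" for S
    proof (rule ccontr)
      assume nz: "(e (set_on S (Suc i) U) :: 'a) \<noteq> 0"
      obtain m where m: "m \<in> ?F" "c m \<notin> {1..mu i}" using False by blast
      have "(set_on S (Suc i) U m, c m) \<in> young mu" using poly_young[OF nz] m by blast
      then have "(i, c m) \<in> young mu" using young_up[OF mu _ i] m(1) by (auto simp: set_on_def split: if_splits)
      then show False using m(2) by (auto simp: young_def)
    qed
    then show ?thesis unfolding lower_def by (simp add: sum.neutral)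
  next
    case True
    then have "card (c ` ?F) \<le> mu i" using card_mono[OF _ True] by simp
    then have "\<not> inj_on c ?F" using less card_image by fastforce
    then obtain x y where xy: "x \<in> ?F" "y \<in> ?F" "x \<noteq> y" "c x = c y" by (auto simp: inj_on_def)
    define \<tau> where "\<tau> = transpose x y"
    have \<tau>C: "\<tau> \<in> C" unfolding \<tau>_def using C_transpose xy by blast
    have sg: "sign \<tau> = -1" using xy(3) by (simp add: \<tau>_def sign_swap_id)
    have U: "U \<circ> \<tau> = U" using xy by (auto simp: \<tau>_def fun_eq_iff transpose_def)
    have "lower n i e U = lower n i (perm_act \<tau> e) U"
      unfolding lower_perm_act[OF C_permutes[OF \<tau>C]] U ..
    also have "\<dots> = - (lower n i e U :: 'a)"
      using poly_alternating[OF \<tau>C, where 'a = 'a] sg by (simp add: lower_def perm_act_def sum_negf)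
    finally show ?thesis using eq_uminus_imp_zero[OF two] by blast
  qed
qed

lemma specht_in_kernel:
  assumes "(2::'a::field) \<noteq> 0" "is_partition n mu" and v: "(v :: (nat \<Rightarrow> nat) \<Rightarrow> 'a) \<in> specht n mu"
  shows "in_kernel n mu v"
  using v
proof (induction rule: specht_induct)
  case (add k t w)
  interpret tableau n mu t using assms(2) add by unfold_locales
  show ?case using in_kernel_lin poly_in_kernel[OF assms(1)] add by blast
qed (rule in_kernel_zero)

text \<open>The free letters of \<open>lower\<close> may be restricted to any set of more than \<open>lam i\<close> of them:
  letting one more letter \<open>x\<close> vary splits the sum according to the row of \<open>x\<close>.\<close>

lemma in_kernel_subset:
  assumes v: "in_kernel n lam v" and "1 \<le> i"
    and "A \<subseteq> fibre n U i" "card A > lam i"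
  shows "(\<Sum>S\<in>Pow A. v (set_on S (Suc i) U)) = 0"
  using assms(3,4)
proof (induction "card (fibre n U i - A)" arbitrary: U A rule: less_induct)
  case less
  have finA: "finite A" using less.prems(1) by (rule finite_subset) simp
  show ?case
  proof (cases "fibre n U i = A")
    case True
    then show ?thesis using v assms(2) less.prems by (auto simp: in_kernel_def lower_def)
  next
    case False
    then obtain x where x: "x \<in> fibre n U i" "x \<notin> A" using less.prems by blast
    let ?U = "U(x := Suc i)"
    have "fibre n U i - insert x A \<subset> fibre n U i - A" using x by blast
    then have 1: "(\<Sum>S\<in>Pow (insert x A). v (set_on S (Suc i) U)) = 0"
      using less.prems x finA by (intro less.hyps psubset_card_mono) (auto simp: card_insert_if)
    have "fibre n ?U i \<subseteq> fibre n U i - {x}" by auto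
    then have "fibre n ?U i - A \<subset> fibre n U i - A" using x by blast
    then have 2: "(\<Sum>S\<in>Pow A. v (set_on S (Suc i) ?U)) = 0"
      using less.prems x by (intro less.hyps psubset_card_mono) auto
    have "(\<Sum>S\<in>Pow (insert x A). v (set_on S (Suc i) U)) =
      (\<Sum>S\<in>Pow A. v (set_on S (Suc i) U)) + (\<Sum>S\<in>insert x ` Pow A. v (set_on S (Suc i) U))"
      unfolding Pow_insert using finA x(2) by (intro sum.union_disjoint) auto
    also have "(\<Sum>S\<in>insert x ` Pow A. v (set_on S (Suc i) U)) = (\<Sum>S\<in>Pow A. v (set_on (insert x S) (Suc i) U))"
      using x(2) by (subst sum.reindex) (auto simp: inj_on_def)
    also have "\<dots> = (\<Sum>S\<in>Pow A. v (set_on S (Suc i) ?U))"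
      by (intro sum.cong refl arg_cong[where f = v]) (auto simp: set_on_def fun_eq_iff)
    finally show ?thesis using 1 2 by simp
  qed
qed

section \<open>Standard leading terms\<close>

lemma sorted_tableau:
  assumes lam: "is_partition n lam" and T: "T \<in> tabloids n lam"
  obtains t where "t \<in> tableaux n lam" "row_of lam t = T"
    "\<And>i j j'. (i, j') \<in> young lam \<Longrightarrow> 1 \<le> j \<Longrightarrow> j < j' \<Longrightarrow> t (i, j) < t (i, j')"
proof -
  \<comment> \<open>Rows are sorted increasingly, so that of the conditions on a standard tableau
    only the one on columns is left to prove later.\<close>
  define L where "L i = sorted_list_of_set (fibre n T i)" for i
  define t where "t = (\<lambda>(i, j). L i ! (j - 1))"
  have len: "length (L i) = lam i" for i
    using T by (simp add: L_def tabloids_def)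
  have st: "set (L i) = fibre n T i" for i by (simp add: L_def)
  have ds: "distinct (L i)" "sorted_wrt (<) (L i)" for i by (simp_all add: L_def)
  have nth: "t (i, j) \<in> fibre n T i" if "(i, j) \<in> young lam" for i j
    unfolding t_def st[symmetric] using that len by (auto simp: young_def intro!: nth_mem)
  have "bij_betw t (young lam) {1..n}"
    unfolding bij_betw_def
  proof (intro conjI inj_onI)
    fix x y assume xy: "x \<in> young lam" "y \<in> young lam" "t x = t y"
    obtain i j i' j' where ij: "x = (i, j)" "y = (i', j')" by fastforce
    have "i = i'" using nth[of i j] nth[of i' j'] xy ij by auto
    moreover have "j - 1 = j' - 1"
      using xy ij \<open>i = i'\<close> ds(1)[of i] len[of i] by (auto simp: t_def young_def nth_eq_iff_index_eq)
    ultimately show "x = y" using xy ij by (auto simp: young_def)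
  next
    show "t ` young lam = {1..n}"
    proof (intro equalityI subsetI)
      fix m assume m: "m \<in> {1..n}"
      then have mL: "m \<in> set (L (T m))" by (simp add: st)
      then obtain k where k: "k < lam (T m)" "L (T m) ! k = m" using len by (metis in_set_conv_nth)
      moreover have "T m \<noteq> 0" using k(1) lam by (metis is_partition_def not_less0)
      ultimately have "(T m, Suc k) \<in> young lam" "t (T m, Suc k) = m" by (auto simp: young_def t_def)
      then show "m \<in> t ` young lam" by (metis imageI)
    qed (use nth in auto)
  qed
  then have tt: "t \<in> tableaux n lam" by (simp add: tableaux_def)
  interpret tableau n lam t using lam tt by unfold_locales
  have "r m = T m" for m
  proof (cases "m \<in> {1..n}")
    case True
    then show ?thesis using nth[OF box(1)[OF True]] box(2)[OF True] by auto
  next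
    case False
    then show ?thesis using T row_out by (simp add: tabloids_def)
  qed
  moreover have "t (i, j) < t (i, j')" if "(i, j') \<in> young lam" "1 \<le> j" "j < j'" for i j j'
    using that ds(2)[of i] len[of i] unfolding t_def young_def sorted_wrt_iff_nth_less by auto
  ultimately show ?thesis using that tt by (metis ext)
qed

lemma ex_max_nat:
  fixes l :: "'b \<Rightarrow> nat"
  assumes "finite S" "S \<noteq> {}"
  obtains u where "u \<in> S" "\<And>w. w \<in> S \<Longrightarrow> l w \<le> l u"
proof -
  have "Max (l ` S) \<in> l ` S" using assms by simp
  then obtain u where "u \<in> S" "l u = Max (l ` S)" by auto
  then show ?thesis using that assms by simp
qed

text \<open>A column permutation that also preserves rows is the identity, so the tabloid of
  \<open>t\<close> occurs exactly once; it will be the leading term.\<close>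

lemma (in tableau) poly_row: "e r = 1"
proof -
  have "{\<pi>\<in>C. r \<circ> inv \<pi> = r} = {id}"
  proof (intro equalityI subsetI)
    fix \<pi> assume "\<pi> \<in> {\<pi>\<in>C. r \<circ> inv \<pi> = r}"
    then have p: "\<pi> \<in> C" "\<And>m. r (inv \<pi> m) = r m" by (auto simp: fun_eq_iff)
    note P = C_permutes[OF p(1)]
    have "inv \<pi> m = m" for m
    proof (cases "m \<in> {1..n}")
      case True
      then show ?thesis
        using box_inj[of "inv \<pi> m" m] p(2) C_col[OF C_inv[OF p(1)]] permutes_in_image[OF permutes_inv[OF P]] by blast
    qed (use permutes_not_in[OF permutes_inv[OF P]] in auto)
    then have "inv \<pi> = id" by auto
    then show "\<pi> \<in> {id}" using permutes_inv_inv[OF P] by auto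
  qed (use C_id in auto)
  then show ?thesis by (simp add: polytabloid_def)
qed

text \<open>Within each column of \<open>t\<close>, a tabloid of the support permutes the row
  numbers. When columns increase, rows and letters are ordered alike, and rearrangement makes
  \<open>r\<close> the unique maximum.\<close>

lemma (in tableau) poly_level:
  assumes std: "\<And>x y. x \<in> {1..n} \<Longrightarrow> y \<in> {1..n} \<Longrightarrow> c x = c y \<Longrightarrow> r x < r y \<Longrightarrow> x < y"
    and "e T \<noteq> 0" "T \<noteq> r"
  shows "(\<Sum>m\<in>{1..n}. m * T m) < (\<Sum>m\<in>{1..n}. m * r m)"
proof -
  obtain \<pi> where p: "\<pi> \<in> C" "T = r \<circ> inv \<pi>" using poly_nonzeroD[OF assms(2)] .
  note P = C_permutes[OF p(1)]
  have cnt: "card {x\<in>{1..n}. c x = a \<and> T x = v} = card {x\<in>{1..n}. c x = a \<and> r x = v}" for a v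
  proof (rule bij_betw_same_card[of "inv \<pi>"], rule bij_betwI[where g = \<pi>])
    show "inv \<pi> \<in> {x\<in>{1..n}. c x = a \<and> T x = v} \<rightarrow> {x\<in>{1..n}. c x = a \<and> r x = v}"
      using permutes_in_image[OF permutes_inv[OF P]] C_col[OF C_inv[OF p(1)]] p(2) by auto
    show "\<pi> \<in> {x\<in>{1..n}. c x = a \<and> r x = v} \<rightarrow> {x\<in>{1..n}. c x = a \<and> T x = v}"
      using permutes_in_image[OF P] C_col[OF p(1)] p(2) by (auto simp: permutes_inverses[OF P])
  qed (simp_all add: permutes_inverses[OF P])
  have mon: "r x \<le> r y" if "x \<in> {1..n}" "y \<in> {1..n}" "c x = c y" "x < y" for x y
    using std[of y x] that by linarith
  have R1: "(\<Sum>m\<in>{1..n}. m * T m) \<le> (\<Sum>m\<in>{1..n}. m * r m)"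
    by (rule rearrangement_classes(1)[where q = c and f = "\<lambda>m. m", OF finite_atLeastAtMost _ _ cnt])
      (use mon in blast)+
  have "T m = r m" if eq: "(\<Sum>m\<in>{1..n}. m * T m) = (\<Sum>m\<in>{1..n}. m * r m)" for m
  proof (cases "m \<in> {1..n}")
    case True
    show ?thesis
      by (rule rearrangement_classes(2)[where q = c and f = "\<lambda>m. m", OF finite_atLeastAtMost _ _ cnt eq True])
        (use mon in blast)+
  next
    case False
    then have "inv \<pi> m = m" using permutes_not_in[OF permutes_inv[OF P]] by auto
    then show ?thesis using p(2) by simp
  qed
  then have "(\<Sum>m\<in>{1..n}. m * T m) \<noteq> (\<Sum>m\<in>{1..n}. m * r m)" using assms(3) by (metis ext)
  then show ?thesis using R1 by simp
qed

lemma level_set_on: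
  assumes "S \<subseteq> {1..n}" "\<And>m. m \<in> S \<Longrightarrow> U m = i"
  shows "(\<Sum>m\<in>{1..n}. m * set_on S (Suc i) U m) = (\<Sum>m\<in>{1..n}. m * U m) + \<Sum>S"
proof -
  have "(\<Sum>m\<in>{1..n}. m * set_on S (Suc i) U m) = (\<Sum>m\<in>{1..n}. m * U m + (if m \<in> S then m else 0))"
    using assms(2) by (intro sum.cong) (auto simp: set_on_def)
  also have "\<dots> = (\<Sum>m\<in>{1..n}. m * U m) + (\<Sum>m\<in>{1..n} \<inter> S. m)"
    by (simp add: sum.distrib sum.inter_restrict)
  also have "{1..n} \<inter> S = S" using assms(1) by blast
  finally show ?thesis .
qed

text \<open>At a descent, row \<open>i\<close> from column \<open>j\<close> on and row
  \<open>i + 1\<close> up to column \<open>j\<close> contain \<open>lam i + 1\<close> letters,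
  enough for a kernel relation. Every letter of the second piece is smaller than every letter of the
  first, so all terms but the leading one have higher level and vanish; then the leading one
  vanishes too.\<close>

lemma kernel_leading_standard:
  fixes v :: "(nat \<Rightarrow> nat) \<Rightarrow> 'a::field"
  assumes lam: "is_partition n lam" and v: "v \<in> perm_module n lam" "in_kernel n lam v"
    and t: "t \<in> tableaux n lam"
    and inc: "\<And>i j j'. (i, j') \<in> young lam \<Longrightarrow> 1 \<le> j \<Longrightarrow> j < j' \<Longrightarrow> t (i, j) < t (i, j')"
    and nz: "v (row_of lam t) \<noteq> 0"
    and max: "\<And>w. v w \<noteq> 0 \<Longrightarrow> (\<Sum>m\<in>{1..n}. m * w m) \<le> (\<Sum>m\<in>{1..n}. m * row_of lam t m)"
    and i: "1 \<le> i" and ij: "(Suc i, j) \<in> young lam"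
  shows "t (i, j) < t (Suc i, j)"
proof (rule ccontr)
  interpret tableau n lam t using lam t by unfold_locales
  have ij': "(i, j) \<in> young lam" using young_up[OF lam ij i] by simp
  assume "\<not> ?thesis"
  moreover have "t (i, j) \<noteq> t (Suc i, j)" using row_col_t(1)[OF ij] row_col_t(1)[OF ij'] by auto
  ultimately have gt: "t (Suc i, j) < t (i, j)" by simp
  define X where "X = (\<lambda>j'. t (i, j')) ` {j..lam i}"
  define Y where "Y = (\<lambda>j'. t (Suc i, j')) ` {1..j}"
  define A where "A = X \<union> Y"
  have yX: "(i, j') \<in> young lam" if "j' \<in> {j..lam i}" for j' using that ij' by (auto simp: young_def)
  have yY: "(Suc i, j') \<in> young lam" if "j' \<in> {1..j}" for j' using that ij by (auto simp: young_def)
  have rX: "r m = i" "m \<in> {1..n}" if "m \<in> X" for m using that row_col_t yX unfolding X_def by blast+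
  have rY: "r m = Suc i" "m \<in> {1..n}" if "m \<in> Y" for m using that row_col_t yY unfolding Y_def by blast+
  have "inj_on (\<lambda>j'. t (i, j')) {j..lam i}"
    using row_col_t(2)[OF yX] by (intro inj_on_inverseI[where g = c]) blast
  then have cX: "card X = Suc (lam i) - j" by (simp add: X_def card_image)
  have "inj_on (\<lambda>j'. t (Suc i, j')) {1..j}"
    using row_col_t(2)[OF yY] by (intro inj_on_inverseI[where g = c]) blast
  then have cY: "card Y = j" by (simp add: Y_def card_image)
  have fin: "finite X" "finite Y" by (simp_all add: X_def Y_def)
  have disj: "X \<inter> Y = {}" using rX(1) rY(1) by (metis disjoint_iff n_not_Suc_n)
  have "card A = Suc (lam i)"
    using cX cY fin disj ij' by (simp add: A_def card_Un_disjoint young_def)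
  define U where "U = set_on A i r"
  have An: "A \<subseteq> {1..n}" using rX rY by (auto simp: A_def)
  have AU: "A \<subseteq> fibre n U i" using An by (auto simp: U_def set_on_def)
  have finA: "finite A" using fin by (simp add: A_def)
  have Y0: "set_on Y (Suc i) U = r" using rX rY by (auto simp: set_on_def U_def A_def fun_eq_iff)
  have zero: "v (set_on S (Suc i) U) = 0" if S: "S \<in> Pow A - {Y}" for S
  proof (rule ccontr)
    let ?w = "set_on S (Suc i) U"
    assume w: "v ?w \<noteq> 0"
    \<comment> \<open>Counting row \<open>i + 1\<close> shows that only sets as large as
      \<open>Y\<close> lead to content \<open>lam\<close>.\<close>
    then have "card (fibre n ?w (Suc i)) = lam (Suc i)" using v(1) by (auto simp: perm_module_def tabloids_def)
    moreover have "card (fibre n r (Suc i)) = lam (Suc i)" by (rule card_row)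
    moreover have "fibre n ?w (Suc i) = S \<union> (fibre n r (Suc i) - Y)"
      using S An rX rY by (auto simp: set_on_def U_def A_def)
    moreover have "fibre n r (Suc i) = Y \<union> (fibre n r (Suc i) - Y)" using rY by auto
    moreover have "card (S \<union> (fibre n r (Suc i) - Y)) = card S + card (fibre n r (Suc i) - Y)"
      using S finA rX rY by (intro card_Un_disjoint) (auto simp: A_def intro: finite_subset)
    moreover have "card (Y \<union> (fibre n r (Suc i) - Y)) = card Y + card (fibre n r (Suc i) - Y)"
      using fin by (intro card_Un_disjoint) auto
    ultimately have cS: "card S = card Y" by simp
    have "\<Sum>Y < \<Sum>S"
    proof (rule sum_subset_less[OF finA])
      fix x y assume y: "y \<in> Y" and "x \<in> A - Y"
      then have x: "x \<in> X" by (auto simp: A_def)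
      have "y \<le> t (Suc i, j)" using y inc[OF ij] unfolding Y_def by (auto simp: le_less)
      moreover have "t (i, j) \<le> x" using x inc[OF yX, of _ j] ij' unfolding X_def by (auto simp: le_less young_def)
      ultimately show "y < x" using gt by simp
    qed (use S cS in \<open>auto simp: A_def\<close>)
    moreover have "(\<Sum>m\<in>{1..n}. m * ?w m) = (\<Sum>m\<in>{1..n}. m * U m) + \<Sum>S"
      using S An by (intro level_set_on) (auto simp: U_def set_on_def)
    moreover have "(\<Sum>m\<in>{1..n}. m * set_on Y (Suc i) U m) = (\<Sum>m\<in>{1..n}. m * U m) + \<Sum>Y"
      using An by (intro level_set_on) (auto simp: U_def set_on_def A_def)
    ultimately show False using max[OF w] unfolding Y0 by linarith
  qed
  have "(\<Sum>S\<in>Pow A. v (set_on S (Suc i) U)) = 0"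
    using in_kernel_subset[OF v(2) i AU] \<open>card A = Suc (lam i)\<close> by simp
  moreover have "(\<Sum>S\<in>Pow A. v (set_on S (Suc i) U)) = v (set_on Y (Suc i) U) + (\<Sum>S\<in>Pow A - {Y}. v (set_on S (Suc i) U))"
    using finA by (intro sum.remove) (auto simp: A_def)
  ultimately show False using zero nz Y0 by (simp add: sum.neutral)
qed

text \<open>The tabloid of highest level in a kernel vector belongs to a standard tableau, and the
  polytabloid of this tableau has it as top term with coefficient 1. Subtraction stays in the kernel
  by \<open>specht_in_kernel\<close>, so elimination ends at zero.\<close>

theorem kernel_intersection:
  fixes v :: "(nat \<Rightarrow> nat) \<Rightarrow> 'a::field"
  assumes two: "(2::'a) \<noteq> 0" and lam: "is_partition n lam"
    and v: "v \<in> perm_module n lam" "in_kernel n lam v"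
  shows "v \<in> specht n lam"
proof (rule elimination[where I = "tabloids n lam" and V = "{v \<in> perm_module n lam. in_kernel n lam v}"
      and D = "polytabloid n lam ` tableaux n lam" and l = "\<lambda>T. \<Sum>m\<in>{1..n}. m * T m"
      and P = "\<lambda>v. v \<in> specht n lam"])
  fix x b :: "(nat \<Rightarrow> nat) \<Rightarrow> 'a" and k
  assume x: "x \<in> {v \<in> perm_module n lam. in_kernel n lam v}" and "b \<in> polytabloid n lam ` tableaux n lam"
  then have b: "b \<in> specht n lam" using specht_poly by blast
  have "(\<lambda>w. x w - k * b w) = (\<lambda>w. (- k) * b w + x w)" by simp
  then show "(\<lambda>w. x w - k * b w) \<in> {v \<in> perm_module n lam. in_kernel n lam v}"
    using perm_module_lin[OF specht_perm_module[OF lam b], of x "- k"]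
      in_kernel_lin[OF specht_in_kernel[OF two lam b], of x "- k"] x by auto
next
  fix x :: "(nat \<Rightarrow> nat) \<Rightarrow> 'a"
  assume x: "x \<in> {v \<in> perm_module n lam. in_kernel n lam v}" and nz: "x \<noteq> (\<lambda>_. 0)"
  have sub: "{T. x T \<noteq> 0} \<subseteq> tabloids n lam" using x by (auto simp: perm_module_def)
  obtain u where u: "x u \<noteq> 0" "\<And>w. x w \<noteq> 0 \<Longrightarrow> (\<Sum>m\<in>{1..n}. m * w m) \<le> (\<Sum>m\<in>{1..n}. m * u m)"
    using ex_max_nat[of "{T. x T \<noteq> 0}" "\<lambda>T. \<Sum>m\<in>{1..n}. m * T m"] nz finite_subset[OF sub finite_tabloids]
    by (auto simp: fun_eq_iff)
  obtain t where tt: "t \<in> tableaux n lam" "row_of lam t = u"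
    "\<And>i j j'. (i, j') \<in> young lam \<Longrightarrow> 1 \<le> j \<Longrightarrow> j < j' \<Longrightarrow> t (i, j) < t (i, j')"
    using sorted_tableau[OF lam, of u] sub u(1) by blast
  interpret tableau n lam t using lam tt by unfold_locales
  have adj: "t (i, j) < t (Suc i, j)" if "1 \<le> i" "(Suc i, j) \<in> young lam" for i j
    by (rule kernel_leading_standard[OF lam _ _ tt(1,3) _ _ that, of x]) (use x u tt(2) in auto)
  have col: "t (i, j) < t (i', j)" if "1 \<le> i" "i < i'" "(i', j) \<in> young lam" for i i' j
    using that(2,3)
  proof (induction i')
    case (Suc k)
    have "t (k, j) < t (Suc k, j)" using adj[of k j] Suc.prems that(1) by simp
    moreover have "t (i, j) < t (k, j)" if "i < k"
      using Suc.IH[OF that] young_up[OF lam Suc.prems(2), of k] that by simp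
    ultimately show ?case using Suc.prems(1) by (cases "i = k") auto
  qed simp
  show "\<exists>b\<in>(polytabloid n lam ` tableaux n lam :: ((nat \<Rightarrow> nat) \<Rightarrow> 'a) set). \<exists>u. x u \<noteq> 0 \<and> b u \<noteq> 0 \<and>
     (\<forall>w. b w \<noteq> 0 \<longrightarrow> x w \<noteq> 0 \<or> (\<Sum>m\<in>{1..n}. m * w m) < (\<Sum>m\<in>{1..n}. m * u m))"
  proof (intro bexI[of _ e] exI[of _ r] conjI allI impI)
    fix w assume w: "(e w :: 'a) \<noteq> 0"
    have "x < y" if "x \<in> {1..n}" "y \<in> {1..n}" "c x = c y" "r x < r y" for x y
      using col[of "r x" "r y" "c y"] that box[of x] box[of y] row_col_pos[of x] by auto
    then show "x w \<noteq> 0 \<or> (\<Sum>m\<in>{1..n}. m * w m) < (\<Sum>m\<in>{1..n}. m * r m)"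
      using poly_level[OF _ w] u(1) tt(2) by blast
  qed (use u(1) tt poly_row[where 'a = 'a] in auto)
next
  fix x b :: "(nat \<Rightarrow> nat) \<Rightarrow> 'a" and k
  assume x: "x \<in> specht n lam" and "b \<in> polytabloid n lam ` tableaux n lam"
  then have b: "b \<in> specht n lam" using specht_poly by blast
  show "(\<lambda>w. x w + k * b w) \<in> specht n lam"
    using specht_lin[OF b x, of k] by (simp add: add.commute)
next
  show "v \<in> {v \<in> perm_module n lam. in_kernel n lam v}" using v by simp
  show "finite (tabloids n lam)" by (rule finite_tabloids)
  show "(\<lambda>_. 0) \<in> specht n lam" by (rule specht_zero)
qed (simp add: perm_module_def)

section \<open>Garnir relations for equivariant maps\<close>

text \<open>Unlike \<open>hom_specht\<close> this leaves the target open, so that orbit sums,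
  restrictions along \<open>rho\<close> and composites with \<open>lower\<close> all fall under
  it.\<close>

definition equivariant ::
  "nat \<Rightarrow> (nat \<Rightarrow> nat) \<Rightarrow> (((nat \<Rightarrow> nat) \<Rightarrow> 'a::field) \<Rightarrow> (nat \<Rightarrow> nat) \<Rightarrow> 'a) \<Rightarrow> bool" where
  "equivariant n mu f \<longleftrightarrow>
    (\<forall>k. \<forall>v\<in>specht n mu. \<forall>w\<in>specht n mu. f (\<lambda>T. k * v T + w T) = (\<lambda>T. k * f v T + f w T)) \<and>
    (\<forall>\<sigma>. \<sigma> permutes {1..n} \<longrightarrow> (\<forall>v\<in>specht n mu. f (perm_act \<sigma> v) = perm_act \<sigma> (f v)))"

lemma equivariant_lin:
  "equivariant n mu f \<Longrightarrow> v \<in> specht n mu \<Longrightarrow> w \<in> specht n mu \<Longrightarrow>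
    f (\<lambda>T. k * v T + w T) = (\<lambda>T. k * f v T + f w T)"
  by (simp add: equivariant_def)

lemma equivariant_perm:
  "equivariant n mu f \<Longrightarrow> \<sigma> permutes {1..n} \<Longrightarrow> v \<in> specht n mu \<Longrightarrow> f (perm_act \<sigma> v) = perm_act \<sigma> (f v)"
  by (simp add: equivariant_def)

lemma equivariant_zero:
  assumes "equivariant n mu f"
  shows "f (\<lambda>T. 0) = (\<lambda>T. 0)"
proof
  fix T
  have "f (\<lambda>T. 0) T = f (\<lambda>T. 0) T + f (\<lambda>T. 0) T"
    using fun_cong[OF equivariant_lin[OF assms specht_zero specht_zero, of 1], of T] by simp
  then show "f (\<lambda>T. 0) T = 0" by (metis add_cancel_right_right)
qed

lemma equivariant_scale:
  assumes "equivariant n mu f" "v \<in> specht n mu"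
  shows "f (\<lambda>T. k * v T) = (\<lambda>T. k * f v T)"
  using equivariant_lin[OF assms specht_zero, of k] equivariant_zero[OF assms(1)] by simp

lemma equivariant_sum:
  assumes "equivariant n mu f" "finite B" "\<And>s. s \<in> B \<Longrightarrow> v s \<in> specht n mu"
  shows "f (\<lambda>T. \<Sum>s\<in>B. k s * v s T) = (\<lambda>T. \<Sum>s\<in>B. k s * f (v s) T)"
  using assms(2,3)
proof (induction B rule: finite_induct)
  case empty
  then show ?case using equivariant_zero[OF assms(1)] by simp
next
  case (insert s B)
  have "(\<lambda>T. \<Sum>s\<in>B. k s * v s T) \<in> specht n mu" using insert by (intro specht_sum) auto
  then show ?case using equivariant_lin[OF assms(1), of "v s" "\<lambda>T. \<Sum>s\<in>B. k s * v s T" "k s"] insert by simp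
qed

lemma equivariant_comb:
  assumes "equivariant n mu f" "equivariant n mu g"
  shows "equivariant n mu (\<lambda>v T. k * f v T + g v T)"
  using assms unfolding equivariant_def by (auto simp: algebra_simps perm_act_def fun_eq_iff)

context tableau
begin

lemma e_specht: "e \<in> specht n mu"
  using specht_poly[OF t] .

lemma specht_generated [consumes 1, case_names zero add]:
  fixes v :: "(nat \<Rightarrow> nat) \<Rightarrow> 'a::field"
  assumes "v \<in> specht n mu" "P (\<lambda>T. 0)"
    and add: "\<And>k \<sigma> w. \<sigma> permutes {1..n} \<Longrightarrow> w \<in> specht n mu \<Longrightarrow> P w \<Longrightarrow> P (\<lambda>T. k * perm_act \<sigma> e T + w T)"
  shows "P v"
  using assms(1)
proof (induction rule: specht_induct)
  case (add k t' w)
  obtain \<sigma> where "\<sigma> permutes {1..n}" "polytabloid n mu t' = (perm_act \<sigma> e :: (nat \<Rightarrow> nat) \<Rightarrow> 'a)"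
    using tableau_perm[OF add(1)] .
  then show ?case using assms(3) add by simp
qed (rule assms(2))

lemma equivariant_eqI:
  assumes "equivariant n mu f" "equivariant n mu g" "f e = g e" "v \<in> specht n mu"
  shows "f v = g v"
  using assms(4)
proof (induction rule: specht_generated)
  case zero
  then show ?case using assms equivariant_zero by metis
next
  case (add k \<sigma> w)
  note S = specht_perm_act[OF mu add(1) e_specht]
  show ?case
    unfolding equivariant_lin[OF assms(1) S add(2)] equivariant_lin[OF assms(2) S add(2)]
      equivariant_perm[OF assms(1) add(1) e_specht] equivariant_perm[OF assms(2) add(1) e_specht] assms(3) add(3) ..
qed

text \<open>Since \<open>e\<close> generates, a property that defines a submodule need only be
  checked at \<open>f e\<close>.\<close>

lemma equivariant_image:
  assumes f: "equivariant n mu f" and v: "v \<in> specht n mu" and "Q (f e)" "Q (\<lambda>T. 0)"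
    and lin: "\<And>k x y. Q x \<Longrightarrow> Q y \<Longrightarrow> Q (\<lambda>T. k * x T + y T)"
    and perm: "\<And>\<sigma> x. \<sigma> permutes {1..n} \<Longrightarrow> Q x \<Longrightarrow> Q (perm_act \<sigma> x)"
  shows "Q (f v)"
  using v
proof (induction rule: specht_generated)
  case zero
  then show ?case using assms(4) equivariant_zero[OF f] by simp
next
  case (add k \<sigma> w)
  note S = specht_perm_act[OF mu add(1) e_specht]
  show ?case
    unfolding equivariant_lin[OF f S add(2)] equivariant_perm[OF f add(1) e_specht]
    using lin[OF perm[OF add(1) assms(3)] add(3)] .
qed

definition alternating :: "((nat \<Rightarrow> nat) \<Rightarrow> 'a::field) \<Rightarrow> bool" where
  "alternating v \<longleftrightarrow> (\<forall>\<rho>\<in>C. \<forall>T. v (T \<circ> \<rho>) = of_int (sign \<rho>) * v T)"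

lemma alternating_e: "alternating e"
  using poly_alternating by (auto simp: alternating_def)

lemma alternating_image:
  assumes g: "equivariant n mu g"
  shows "alternating (g e)"
  unfolding alternating_def
proof (intro ballI allI)
  fix \<rho> T assume \<rho>: "\<rho> \<in> C"
  have "perm_act \<rho> e = (\<lambda>T. of_int (sign \<rho>) * e T :: 'a)"
    using poly_alternating[OF \<rho>] by (auto simp: perm_act_def)
  then have "perm_act \<rho> (g e) = (\<lambda>T. of_int (sign \<rho>) * g e T)"
    using equivariant_perm[OF g C_permutes[OF \<rho>] e_specht] equivariant_scale[OF g e_specht] by simp
  then show "g e (T \<circ> \<rho>) = of_int (sign \<rho>) * g e T" by (simp add: perm_act_def fun_eq_iff)
qed

text \<open>Columns beyond \<open>mu 2\<close> have height one. Every tabloid in the support of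
  \<open>e\<close> has their letters in row 1, so permuting these letters fixes \<open>e\<close> and
  therefore \<open>g e\<close>.\<close>

lemma symmetric_image:
  assumes g: "equivariant n mu g" and \<pi>: "\<pi> permutes D" and D: "D \<subseteq> {m\<in>{1..n}. mu 2 < c m}"
  shows "g e (T \<circ> \<pi>) = (g e T :: 'a::field)"
proof -
  have P: "\<pi> permutes {1..n}" by (rule permutes_subset[OF \<pi>]) (use D in auto)
  have "perm_act \<pi> e = (e :: (nat \<Rightarrow> nat) \<Rightarrow> 'a)"
  proof
    fix T
    have one: "T m = 1" if "(e T :: 'a) \<noteq> 0" "m \<in> D" for T m
    proof -
      have y: "(T m, c m) \<in> young mu" using poly_young[OF that(1)] D that(2) by blast
      have "\<not> 2 \<le> T m"
        using young_up[OF mu y, of 2] D that(2) by (auto simp: young_def)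
      then show ?thesis using y by (auto simp: young_def)
    qed
    have stab: "T \<circ> \<pi> = T" if "\<forall>m\<in>D. T m = 1" for T :: "nat \<Rightarrow> nat"
    proof
      fix m show "(T \<circ> \<pi>) m = T m"
        using that permutes_in_image[OF \<pi>, of m] permutes_not_in[OF \<pi>, of m] by (cases "m \<in> D") auto
    qed
    show "perm_act \<pi> e T = (e T :: 'a)"
    proof (cases "\<forall>m\<in>D. T m = 1")
      case True
      then show ?thesis using stab by (simp add: perm_act_def)
    next
      case False
      then have "(e T :: 'a) = 0" using one by blast
      moreover have "(e (T \<circ> \<pi>) :: 'a) = 0"
      proof (rule ccontr)
        assume "(e (T \<circ> \<pi>) :: 'a) \<noteq> 0"
        then have "T (\<pi> m) = 1" if "m \<in> D" for m using one[of "T \<circ> \<pi>" m] that by simp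
        then have "T m = 1" if "m \<in> D" for m
          using that permutes_inverses(1)[OF \<pi>, of m] permutes_in_image[OF permutes_inv[OF \<pi>], of m] by metis
        then show False using False by blast
      qed
      ultimately show ?thesis by (simp add: perm_act_def)
    qed
  qed
  then have "perm_act \<pi> (g e) = g e" using equivariant_perm[OF g P e_specht] by simp
  then show ?thesis by (simp add: perm_act_def fun_eq_iff)
qed

text \<open>A transversal of the permutations of \<open>A\<close> modulo those preserving
  \<open>Y\<close>, indexed by the image of \<open>Y\<close>. The signed terms built from it do not
  depend on the choice, by \<open>coset_indep\<close>.\<close>

definition coset_rep :: "nat set \<Rightarrow> nat set \<Rightarrow> nat set \<Rightarrow> nat \<Rightarrow> nat" where
  "coset_rep A Y S = (SOME \<sigma>. \<sigma> permutes A \<and> \<sigma> ` Y = S)"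

lemma coset_rep:
  assumes "finite A" "Y \<subseteq> A" "S \<subseteq> A" "card S = card Y"
  shows "coset_rep A Y S permutes A" "coset_rep A Y S ` Y = S"
proof -
  have "\<exists>\<sigma>. \<sigma> permutes A \<and> \<sigma> ` Y = S" using ex_permutes_image[OF assms(1-3)] assms(4) by metis
  from someI_ex[OF this] show "coset_rep A Y S permutes A" "coset_rep A Y S ` Y = S"
    by (simp_all add: coset_rep_def)
qed

text \<open>Two representatives differ by a permutation that preserves \<open>Y\<close> and
  \<open>A - Y\<close>, each contained in one column. It lies in \<open>C\<close>, and its sign
  appears twice.\<close>

lemma coset_indep:
  fixes v :: "(nat \<Rightarrow> nat) \<Rightarrow> 'a::field"
  assumes v: "alternating v" and A: "A \<subseteq> {1..n}" "Y \<subseteq> A"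
    and col: "\<And>m m'. m \<in> A \<Longrightarrow> m' \<in> A \<Longrightarrow> m \<in> Y \<longleftrightarrow> m' \<in> Y \<Longrightarrow> c m = c m'"
    and \<sigma>: "\<sigma> permutes A" "\<sigma>' permutes A" "\<sigma> ` Y = \<sigma>' ` Y"
  shows "of_int (sign \<sigma>') * v (T \<circ> \<sigma>') = of_int (sign \<sigma>) * v (T \<circ> \<sigma>)"
proof -
  define \<rho> where "\<rho> = inv \<sigma> \<circ> \<sigma>'"
  have \<rho>A: "\<rho> permutes A" unfolding \<rho>_def by (rule permutes_compose[OF \<sigma>(2) permutes_inv[OF \<sigma>(1)]])
  have \<rho>n: "\<rho> permutes {1..n}" using \<rho>A A(1) by (rule permutes_subset)
  have "\<rho> ` Y = Y"
    unfolding \<rho>_def image_comp[symmetric] \<sigma>(3)[symmetric] using permutes_inv_o(2)[OF \<sigma>(1)] by (simp add: image_comp)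
  then have Y: "\<rho> m \<in> Y \<longleftrightarrow> m \<in> Y" for m using permutes_inj[OF \<rho>A] by (metis inj_image_mem_iff)
  have "c (\<rho> m) = c m" if "m \<in> {1..n}" for m
    using col[of "\<rho> m" m] Y permutes_in_image[OF \<rho>A, of m] permutes_not_in[OF \<rho>A, of m] by (cases "m \<in> A") auto
  then have "\<rho> \<in> C" using \<rho>n by (simp add: col_stab_def)
  then have 1: "v (T \<circ> \<sigma> \<circ> \<rho>) = of_int (sign \<rho>) * v (T \<circ> \<sigma>)" using v by (simp add: alternating_def)
  have fin: "finite A" using A(1) by (rule finite_subset) simp
  have \<sigma>': "\<sigma>' = \<sigma> \<circ> \<rho>" unfolding \<rho>_def by (auto simp: fun_eq_iff permutes_inverses[OF \<sigma>(1)])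
  have "sign \<sigma>' = sign \<sigma> * sign \<rho>"
    unfolding \<sigma>' using \<sigma>(1) \<rho>A fin by (intro sign_compose) (auto intro: permutes_imp_permutation)
  moreover have "T \<circ> \<sigma>' = T \<circ> \<sigma> \<circ> \<rho>" by (simp add: \<sigma>' comp_assoc)
  moreover have "(of_int (sign \<rho>) * of_int (sign \<rho>) :: 'a) = 1" by (metis of_int_1 of_int_mult sign_idempotent)
  ultimately show ?thesis by (simp add: 1 mult.assoc mult.left_commute)
qed

text \<open>\<open>L\<close> bounds the height of the columns met by \<open>A\<close>. If
  \<open>T\<close> has a value outside \<open>{1..L}\<close> on \<open>A\<close>, every term places
  a letter outside the diagram. Otherwise two letters of \<open>A\<close> have equal values, and
  their transposition permutes the terms with a change of sign, so the sum equals its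
  negative.\<close>

lemma garnir_e:
  assumes two: "(2::'a::field) \<noteq> 0" and A: "A \<subseteq> {1..n}" "Y \<subseteq> A"
    and col: "\<And>m m'. m \<in> A \<Longrightarrow> m' \<in> A \<Longrightarrow> m \<in> Y \<longleftrightarrow> m' \<in> Y \<Longrightarrow> c m = c m'"
    and L: "\<And>m i. m \<in> A \<Longrightarrow> (i, c m) \<in> young mu \<Longrightarrow> i \<le> L" "L < card A"
  shows "(\<Sum>S\<in>{S. S \<subseteq> A \<and> card S = card Y}. of_int (sign (coset_rep A Y S)) * e (T \<circ> coset_rep A Y S)) = (0::'a)"
    (is "(\<Sum>S\<in>?I. ?h S) = 0")
proof (cases "T ` A \<subseteq> {1..L}")
  have fin: "finite A" using A(1) by (rule finite_subset) simp
  {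
    case False
    then obtain m where m: "m \<in> A" "T m \<notin> {1..L}" by blast
    have "?h S = 0" if S: "S \<in> ?I" for S
    proof -
      let ?\<sigma> = "coset_rep A Y S"
      have P: "?\<sigma> permutes A" using coset_rep[OF fin A(2), of S] S by blast
      have mA: "inv ?\<sigma> m \<in> A" using permutes_in_image[OF permutes_inv[OF P]] m by blast
      have "(e (T \<circ> ?\<sigma>) :: 'a) = 0"
      proof (rule ccontr)
        assume "(e (T \<circ> ?\<sigma>) :: 'a) \<noteq> 0"
        then have "((T \<circ> ?\<sigma>) (inv ?\<sigma> m), c (inv ?\<sigma> m)) \<in> young mu"
          using poly_young mA A(1) by blast
        then have "(T m, c (inv ?\<sigma> m)) \<in> young mu" by (simp add: permutes_inverses[OF P])
        then show False using L(1)[OF mA] m(2) by (auto simp: young_def)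
      qed
      then show ?thesis by simp
    qed
    then show ?thesis by (rule sum.neutral[rule_format])
  next
    case True
    then have "card (T ` A) \<le> L" using card_mono[OF _ True] by simp
    then have "\<not> inj_on T A" using L(2) card_image by fastforce
    then obtain x y where xy: "x \<in> A" "y \<in> A" "x \<noteq> y" "T x = T y" by (auto simp: inj_on_def)
    define \<tau> where "\<tau> = transpose x y"
    have \<tau>A: "\<tau> permutes A" unfolding \<tau>_def using xy by (intro permutes_swap_id)
    have \<tau>\<tau>: "\<tau> ` \<tau> ` S = S" for S by (simp add: \<tau>_def image_comp)
    have T\<tau>: "T \<circ> \<tau> = T" using xy by (auto simp: \<tau>_def fun_eq_iff transpose_def)
    have \<tau>I: "\<tau> ` S \<in> ?I" if "S \<in> ?I" for S
    proof -
      have "\<tau> ` S \<subseteq> A" using that permutes_image[OF \<tau>A] by blast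
      moreover have "card (\<tau> ` S) = card S" by (rule card_image[OF permutes_inj_on[OF \<tau>A]])
      ultimately show ?thesis using that by simp
    qed
    have neg: "?h (\<tau> ` S) = - ?h S" if S: "S \<in> ?I" for S
    proof -
      let ?\<sigma> = "coset_rep A Y S" and ?\<sigma>' = "coset_rep A Y (\<tau> ` S)"
      have P: "?\<sigma> permutes A" "?\<sigma> ` Y = S" using coset_rep[OF fin A(2), of S] S by blast+
      have P': "?\<sigma>' permutes A" "?\<sigma>' ` Y = \<tau> ` S" using coset_rep[OF fin A(2), of "\<tau> ` S"] \<tau>I[OF S] by blast+
      have "?h (\<tau> ` S) = of_int (sign (\<tau> \<circ> ?\<sigma>)) * e (T \<circ> (\<tau> \<circ> ?\<sigma>))"
        by (rule coset_indep[OF alternating_e A col])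
          (use P P' permutes_compose[OF P(1) \<tau>A] image_comp[of \<tau> ?\<sigma> Y] in simp_all)
      also have "T \<circ> (\<tau> \<circ> ?\<sigma>) = T \<circ> ?\<sigma>" by (metis comp_assoc T\<tau>)
      also have "sign (\<tau> \<circ> ?\<sigma>) = - sign ?\<sigma>"
        using xy(3) permutes_imp_permutation[OF fin P(1)] by (simp add: \<tau>_def sign_compose permutation_swap_id sign_swap_id)
      finally show ?thesis by (simp add: comp_def)
    qed
    have "(\<Sum>S\<in>?I. ?h S) = (\<Sum>S\<in>?I. ?h (\<tau> ` S))"
      by (rule sum.reindex_bij_witness[where i = "(`) \<tau>" and j = "(`) \<tau>"]) (use \<tau>\<tau> \<tau>I in auto)
    also have "\<dots> = - (\<Sum>S\<in>?I. ?h S)" using neg by (simp add: sum_negf[symmetric])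
    finally show ?thesis using eq_uminus_imp_zero[OF two] by blast
  }
qed

lemma garnir_image:
  assumes two: "(2::'a::field) \<noteq> 0" and A: "A \<subseteq> {1..n}" "Y \<subseteq> A"
    and col: "\<And>m m'. m \<in> A \<Longrightarrow> m' \<in> A \<Longrightarrow> m \<in> Y \<longleftrightarrow> m' \<in> Y \<Longrightarrow> c m = c m'"
    and L: "\<And>m i. m \<in> A \<Longrightarrow> (i, c m) \<in> young mu \<Longrightarrow> i \<le> L" "L < card A"
    and g: "equivariant n mu g"
  shows "(\<Sum>S\<in>{S. S \<subseteq> A \<and> card S = card Y}. of_int (sign (coset_rep A Y S)) * g e (T \<circ> coset_rep A Y S)) = (0::'a)"
    (is "(\<Sum>S\<in>?I. _) = 0")
proof -
  have fin: "finite A" using A(1) by (rule finite_subset) simp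
  have fI: "finite ?I" by (rule finite_subset[of _ "Pow A"]) (use fin in auto)
  have P: "coset_rep A Y S permutes {1..n}" if "S \<in> ?I" for S
    using coset_rep(1)[OF fin A(2), of S] that permutes_subset[OF _ A(1)] by blast
  have "(\<lambda>T. \<Sum>S\<in>?I. of_int (sign (coset_rep A Y S)) * perm_act (coset_rep A Y S) e T) = (\<lambda>T. 0 :: 'a)"
    unfolding perm_act_def using two A col L by (intro ext garnir_e) blast+
  then have "g (\<lambda>T. \<Sum>S\<in>?I. of_int (sign (coset_rep A Y S)) * perm_act (coset_rep A Y S) e T) = (\<lambda>T. 0)"
    using equivariant_zero[OF g] by simp
  moreover have "g (\<lambda>T. \<Sum>S\<in>?I. of_int (sign (coset_rep A Y S)) * perm_act (coset_rep A Y S) e T) =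
      (\<lambda>T. \<Sum>S\<in>?I. of_int (sign (coset_rep A Y S)) * g (perm_act (coset_rep A Y S) e) T)"
    by (rule equivariant_sum[OF g fI]) (use P specht_perm_act[OF mu _ e_specht] in blast)
  moreover have "g (perm_act (coset_rep A Y S) e) T = g e (T \<circ> coset_rep A Y S)" if "S \<in> ?I" for S T
    using equivariant_perm[OF g P[OF that] e_specht] by (simp add: perm_act_def)
  ultimately show ?thesis by (simp add: fun_eq_iff)
qed

end

section \<open>Semistandard leading terms\<close>

lemma sum_two:
  fixes f :: "'b \<Rightarrow> nat"
  assumes "finite N" "x \<in> N" "y \<in> N" "x \<noteq> y"
  shows "sum f N = f x + (f y + sum f (N - {x} - {y}))"
  using sum.remove[OF assms(1,2), of f] sum.remove[of "N - {x}" y f] assms by simp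

context tableau
begin

text \<open>High when large values stand far to the right. Column permutations do not change it, so
  a second statistic, the sum of \<open>r m * U m\<close>, has to separate fillings that differ by
  one.\<close>

abbreviation col_level :: "(nat \<Rightarrow> nat) \<Rightarrow> nat" where
  "col_level U \<equiv> \<Sum>m\<in>{1..n}. c m * U m"

lemma col_level_C:
  assumes "\<pi> \<in> C"
  shows "col_level (U \<circ> \<pi>) = col_level U"
proof -
  have "col_level (U \<circ> \<pi>) = (\<Sum>m\<in>{1..n}. c (\<pi> m) * U (\<pi> m))"
    using C_col[OF assms] by (intro sum.cong) auto
  also have "\<dots> = col_level U"
    using sum.permute[OF C_permutes[OF assms], of "\<lambda>m. c m * U m"] by (simp add: comp_def)
  finally show ?thesis .
qed

text \<open>\<open>Y\<close> weighs one column more than the rest of \<open>A\<close>, so only the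
  values on \<open>Y\<close> matter.\<close>

lemma col_level_move:
  assumes A: "A \<subseteq> {1..n}" "Y \<subseteq> A" and \<sigma>: "\<sigma> permutes A"
    and c: "\<And>m. m \<in> A - Y \<Longrightarrow> c m = j" "\<And>m. m \<in> Y \<Longrightarrow> c m = Suc j"
  shows "col_level (U \<circ> \<sigma>) + sum U Y = col_level U + sum U (\<sigma> ` Y)"
proof -
  have fin: "finite A" using A(1) by (rule finite_subset) simp
  have D: "col_level V = (\<Sum>m\<in>{1..n} - A. c m * V m) + (j * sum V A + sum V Y)" for V
  proof -
    have "col_level V = (\<Sum>m\<in>{1..n} - A. c m * V m) + (\<Sum>m\<in>A. c m * V m)"
      by (rule sum.subset_diff[OF A(1)]) simp
    also have "(\<Sum>m\<in>A. c m * V m) = (\<Sum>m\<in>A. j * V m + (if m \<in> Y then V m else 0))"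
      using c by (intro sum.cong) auto
    also have "\<dots> = j * sum V A + sum V (A \<inter> Y)"
      using fin by (simp add: sum.distrib sum_distrib_left sum.inter_restrict)
    also have "A \<inter> Y = Y" using A(2) by blast
    finally show ?thesis .
  qed
  have 1: "(\<Sum>m\<in>{1..n} - A. c m * (U \<circ> \<sigma>) m) = (\<Sum>m\<in>{1..n} - A. c m * U m)"
    using permutes_not_in[OF \<sigma>] by (intro sum.cong) auto
  have 2: "sum (U \<circ> \<sigma>) A = sum U A" by (rule sum.permute[OF \<sigma>, symmetric])
  have 3: "sum (U \<circ> \<sigma>) Y = sum U (\<sigma> ` Y)" by (rule sum.reindex[OF permutes_inj_on[OF \<sigma>], symmetric])
  show ?thesis unfolding D[of "U \<circ> \<sigma>"] D[of U] 1 2 3 by simp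
qed

text \<open>Exchanging two entries of a column stays in the support and keeps the column level.
  Equal entries would give \<open>v U = - v U\<close>; entries in the wrong order could be exchanged
  to raise the row sum.\<close>

lemma column_strict:
  fixes v :: "(nat \<Rightarrow> nat) \<Rightarrow> 'a::field"
  assumes two: "(2::'a) \<noteq> 0" and v: "alternating v" "v U \<noteq> 0"
    and max: "\<And>W. v W \<noteq> 0 \<Longrightarrow> col_level W = col_level U \<Longrightarrow> (\<Sum>m\<in>{1..n}. r m * W m) \<le> (\<Sum>m\<in>{1..n}. r m * U m)"
    and xy: "x \<in> {1..n}" "y \<in> {1..n}" "c x = c y" "r x < r y"
  shows "U x < U y"
proof (rule ccontr)
  assume "\<not> ?thesis"
  then have le: "U y \<le> U x" by simp
  have ne: "x \<noteq> y" using xy(4) by auto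
  define \<tau> where "\<tau> = transpose x y"
  have \<tau>C: "\<tau> \<in> C" unfolding \<tau>_def using C_transpose xy by blast
  have "sign \<tau> = -1" using ne by (simp add: \<tau>_def sign_swap_id)
  then have neg: "v (U \<circ> \<tau>) = - v U" using v(1) \<tau>C by (simp add: alternating_def)
  have "U x \<noteq> U y"
  proof
    assume "U x = U y"
    then have "U \<circ> \<tau> = U" by (auto simp: \<tau>_def fun_eq_iff transpose_def)
    then show False using neg v(2) eq_uminus_imp_zero[OF two, of "v U"] by simp
  qed
  then have lt: "U y < U x" using le by simp
  have "(\<Sum>m\<in>{1..n}. r m * (U \<circ> \<tau>) m) \<le> (\<Sum>m\<in>{1..n}. r m * U m)"
    by (rule max[OF _ col_level_C[OF \<tau>C]]) (use v(2) in \<open>simp only: neg neg_equal_0_iff_equal not_False_eq_True\<close>)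
  moreover have "(\<Sum>m\<in>{1..n} - {x} - {y}. r m * (U \<circ> \<tau>) m) = (\<Sum>m\<in>{1..n} - {x} - {y}. r m * U m)"
    by (rule sum.cong) (auto simp: \<tau>_def transpose_def)
  moreover have "(U \<circ> \<tau>) x = U y" "(U \<circ> \<tau>) y = U x" by (auto simp: \<tau>_def)
  ultimately have "r x * U y + r y * U x \<le> r x * U x + r y * U y"
    using sum_two[OF finite_atLeastAtMost xy(1,2) ne, of "\<lambda>m. r m * (U \<circ> \<tau>) m"]
      sum_two[OF finite_atLeastAtMost xy(1,2) ne, of "\<lambda>m. r m * U m"] by simp
  moreover obtain a b where "r y = r x + a" "0 < a" "U x = U y + b" "0 < b"
    using xy(4) lt by (metis less_imp_add_positive)
  ultimately show False by (simp add: algebra_simps)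
qed

lemma column_height:
  assumes "(i, j) \<in> young mu"
  shows "i \<le> card {m\<in>{1..n}. c m = j}"
proof -
  have y: "(i', j) \<in> young mu" if "i' \<in> {1..i}" for i' using young_up[OF mu assms] that by simp
  have "inj_on (\<lambda>i'. t (i', j)) {1..i}"
    using row_col_t(1)[OF y] by (intro inj_on_inverseI[where g = r]) blast
  then have "card ((\<lambda>i'. t (i', j)) ` {1..i}) = i" by (simp add: card_image)
  moreover have "(\<lambda>i'. t (i', j)) ` {1..i} \<subseteq> {m\<in>{1..n}. c m = j}" using row_col_t[OF y] by blast
  ultimately show ?thesis using card_mono[of "{m\<in>{1..n}. c m = j}" "(\<lambda>i'. t (i', j)) ` {1..i}"] by simp
qed

text \<open>The classical Garnir argument: \<open>X\<close> is column \<open>c x\<close> from row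
  \<open>r x\<close> down, \<open>Y\<close> is the next column down to that row. At a descent all
  values on \<open>Y\<close> lie below those on \<open>X\<close>, so every other exchange raises the
  column level and leaves the support. The relation is then reduced to
  \<open>g e U = 0\<close>.\<close>

lemma row_weak:
  fixes g :: "((nat \<Rightarrow> nat) \<Rightarrow> 'a::field) \<Rightarrow> (nat \<Rightarrow> nat) \<Rightarrow> 'a"
  assumes two: "(2::'a) \<noteq> 0" and g: "equivariant n mu g" and nz: "g e U \<noteq> 0"
    and max: "\<And>W. g e W \<noteq> 0 \<Longrightarrow> col_level W \<le> col_level U"
    and strict: "\<And>x y. x \<in> {1..n} \<Longrightarrow> y \<in> {1..n} \<Longrightarrow> c x = c y \<Longrightarrow> r x < r y \<Longrightarrow> U x < U y"
    and xy: "x \<in> {1..n}" "y \<in> {1..n}" "r x = r y" "c y = Suc (c x)"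
  shows "U x \<le> U y"
proof (rule ccontr)
  assume "\<not> ?thesis"
  then have gt: "U y < U x" by simp
  let ?q = "r x" and ?j = "c x"
  define X where "X = {m\<in>{1..n}. c m = ?j \<and> ?q \<le> r m}"
  define Y where "Y = {m\<in>{1..n}. c m = Suc ?j \<and> r m \<le> ?q}"
  define A where "A = X \<union> Y"
  have fin: "finite X" "finite Y" "finite A" by (simp_all add: X_def Y_def A_def)
  have An: "A \<subseteq> {1..n}" "Y \<subseteq> A" by (auto simp: A_def X_def Y_def)
  have XY: "X \<inter> Y = {}" "A - Y = X" by (auto simp: A_def X_def Y_def)
  have col: "c m = c m'" if "m \<in> A" "m' \<in> A" "m \<in> Y \<longleftrightarrow> m' \<in> Y" for m m'
    using that by (auto simp: A_def X_def Y_def)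
  define L where "L = card {m\<in>{1..n}. c m = ?j}"
  have L1: "i \<le> L" if "m \<in> A" "(i, c m) \<in> young mu" for m i
  proof -
    have "(i, ?j) \<in> young mu" using that row_col_pos[OF xy(1)] by (auto simp: A_def X_def Y_def young_def)
    then show ?thesis unfolding L_def by (rule column_height)
  qed
  \<comment> \<open>At most \<open>r x - 1\<close> letters of column \<open>c x\<close> are missing
    from \<open>X\<close>, and \<open>Y\<close> supplies at least \<open>r x\<close>.\<close>
  have L2: "L < card A"
  proof -
    let ?Z = "{m\<in>{1..n}. c m = ?j \<and> r m < ?q}"
    have "card ?Z \<le> card {1..<?q}"
    proof (rule card_inj_on_le[of r])
      show "inj_on r ?Z" using box_inj by (auto simp: inj_on_def)
      show "r ` ?Z \<subseteq> {1..<?q}" using row_col_pos by auto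
    qed simp
    moreover have "L = card X + card ?Z"
    proof -
      have "{m\<in>{1..n}. c m = ?j} = X \<union> ?Z" by (auto simp: X_def)
      moreover have "X \<inter> ?Z = {}" by (auto simp: X_def)
      ultimately show ?thesis unfolding L_def using fin by (simp add: card_Un_disjoint)
    qed
    moreover have "?q \<le> card Y"
    proof -
      have y: "(i, Suc ?j) \<in> young mu" if "i \<in> {1..?q}" for i
        using young_up[OF mu box(1)[OF xy(2)]] that xy by simp
      have "inj_on (\<lambda>i. t (i, Suc ?j)) {1..?q}"
        using row_col_t(1)[OF y] by (intro inj_on_inverseI[where g = r]) blast
      moreover have "(\<lambda>i. t (i, Suc ?j)) ` {1..?q} \<subseteq> Y" using row_col_t[OF y] by (auto simp: Y_def)
      ultimately show ?thesis using card_inj_on_le[of "\<lambda>i. t (i, Suc ?j)" "{1..?q}" Y] fin by simp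
    qed
    moreover have "card A = card X + card Y" unfolding A_def using fin XY by (intro card_Un_disjoint)
    moreover have "1 \<le> ?q" using row_col_pos[OF xy(1)] by simp
    ultimately show ?thesis by simp
  qed
  let ?I = "{S. S \<subseteq> A \<and> card S = card Y}"
  let ?h = "\<lambda>S. of_int (sign (coset_rep A Y S)) * g e (U \<circ> coset_rep A Y S)"
  have "(\<Sum>S\<in>?I. ?h S) = 0" by (rule garnir_image[OF two An _ _ L2 g]) (fact col, fact L1)
  moreover have "?h S = 0" if S: "S \<in> ?I - {Y}" for S
  proof -
    let ?\<sigma> = "coset_rep A Y S"
    have P: "?\<sigma> permutes A" "?\<sigma> ` Y = S" using coset_rep[OF fin(3) An(2), of S] S by blast+
    have "sum U Y < sum U S"
    proof (rule sum_subset_less[OF fin(3) An(2)])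
      fix a b assume b: "b \<in> Y" and "a \<in> A - Y"
      then have a: "a \<in> X" using XY by blast
      have "U b \<le> U y" using strict[of b y] b xy box_inj[of b y] by (cases "r b = r y") (auto simp: Y_def)
      moreover have "U x \<le> U a" using strict[of x a] a xy box_inj[of x a] by (cases "r x = r a") (auto simp: X_def)
      ultimately show "U b < U a" using gt by simp
    qed (use S in auto)
    moreover have "col_level (U \<circ> ?\<sigma>) + sum U Y = col_level U + sum U (?\<sigma> ` Y)"
      by (rule col_level_move[OF An P(1), of ?j]) (unfold XY, auto simp: X_def Y_def)
    ultimately have "col_level U < col_level (U \<circ> ?\<sigma>)" unfolding P(2) by linarith
    then have "g e (U \<circ> ?\<sigma>) = 0" using max[of "U \<circ> ?\<sigma>"] by (metis not_le)
    then show ?thesis by simp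
  qed
  moreover have "?h Y = g e U"
  proof -
    have P: "coset_rep A Y Y permutes A" "coset_rep A Y Y ` Y = Y" using coset_rep[OF fin(3) An(2), of Y] An by blast+
    have "?h Y = of_int (sign (id :: nat \<Rightarrow> nat)) * g e (U \<circ> id)"
    proof (rule coset_indep[OF alternating_image[OF g] An])
      show "id permutes A" by (rule permutes_id)
      show "id ` Y = coset_rep A Y Y ` Y" unfolding P(2) by simp
    qed (use P(1) in \<open>auto intro: col\<close>)
    then show ?thesis by simp
  qed
  moreover have "finite ?I" by (intro finite_Collect_conjI disjI1 finite_Collect_subsets[OF fin(3)])
  moreover have "Y \<in> ?I" using An by blast
  ultimately show False using nz sum.remove[of ?I Y ?h] sum.neutral[of "?I - {Y}" ?h] by simp
qed

text \<open>Two maximizations in turn: the column level over the whole support serves the Garnir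
  argument, the row sum among those maxima serves column strictness.\<close>

lemma semistandard_support:
  fixes g :: "((nat \<Rightarrow> nat) \<Rightarrow> 'a::field) \<Rightarrow> (nat \<Rightarrow> nat) \<Rightarrow> 'a"
  assumes two: "(2::'a) \<noteq> 0" and g: "equivariant n mu g" "g e \<in> perm_module n lam" and nz: "g e \<noteq> (\<lambda>_. 0)"
  obtains U where "g e U \<noteq> 0"
    "\<And>x y. x \<in> {1..n} \<Longrightarrow> y \<in> {1..n} \<Longrightarrow> c x = c y \<Longrightarrow> r x < r y \<Longrightarrow> U x < U y"
    "\<And>x y. x \<in> {1..n} \<Longrightarrow> y \<in> {1..n} \<Longrightarrow> r x = r y \<Longrightarrow> c x < c y \<Longrightarrow> U x \<le> U y"
proof -
  have "{U. g e U \<noteq> 0} \<subseteq> tabloids n lam" using g(2) by (auto simp: perm_module_def)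
  then have fin: "finite {U. g e U \<noteq> 0}" using finite_tabloids by (rule finite_subset)
  have ne: "{U. g e U \<noteq> 0} \<noteq> {}" using nz by auto
  obtain u where u0: "u \<in> {U. g e U \<noteq> 0}" "\<And>W. W \<in> {U. g e U \<noteq> 0} \<Longrightarrow> col_level W \<le> col_level u"
    using ex_max_nat[OF fin ne, of col_level] by blast
  have u: "g e u \<noteq> 0" "\<And>W. g e W \<noteq> 0 \<Longrightarrow> col_level W \<le> col_level u" using u0 by blast+
  have fin2: "finite {U. g e U \<noteq> 0 \<and> col_level U = col_level u}" using fin by (rule rev_finite_subset) blast
  have "\<exists>U\<in>{U. g e U \<noteq> 0 \<and> col_level U = col_level u}. \<forall>W\<in>{U. g e U \<noteq> 0 \<and> col_level U = col_level u}.
      (\<Sum>m\<in>{1..n}. r m * W m) \<le> (\<Sum>m\<in>{1..n}. r m * U m)"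
    (is "\<exists>U\<in>?S. \<forall>W\<in>?S. ?l W \<le> ?l U")
  proof (rule ex_max_nat[of ?S ?l])
    show "finite ?S" by (rule fin2)
    show "?S \<noteq> {}" using u(1) by blast
  qed blast
  then obtain U where U0: "U \<in> ?S" "\<forall>W\<in>?S. ?l W \<le> ?l U" by blast
  have U: "g e U \<noteq> 0" "col_level U = col_level u"
    "\<And>W. g e W \<noteq> 0 \<Longrightarrow> col_level W = col_level u \<Longrightarrow> (\<Sum>m\<in>{1..n}. r m * W m) \<le> (\<Sum>m\<in>{1..n}. r m * U m)"
    using U0 by blast+
  have strict: "U x < U y" if "x \<in> {1..n}" "y \<in> {1..n}" "c x = c y" "r x < r y" for x y
  proof (rule column_strict[where v = "g e" and U = U, OF two alternating_image[OF g(1)] U(1) _ that])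
    fix W assume "g e W \<noteq> 0" "col_level W = col_level U"
    then show "(\<Sum>m\<in>{1..n}. r m * W m) \<le> (\<Sum>m\<in>{1..n}. r m * U m)" unfolding U(2) by (rule U(3))
  qed
  have adj: "U x \<le> U y" if "x \<in> {1..n}" "y \<in> {1..n}" "r x = r y" "c y = Suc (c x)" for x y
  proof (rule row_weak[where g = g and U = U, OF two g(1) U(1) _ _ that])
    fix W assume "g e W \<noteq> 0"
    then show "col_level W \<le> col_level U" unfolding U(2) by (rule u(2))
  qed (rule strict)
  have "U x \<le> U y" if "x \<in> {1..n}" "y \<in> {1..n}" "r x = r y" "c x < c y" for x y
    using that(2-4)
  proof (induction "c y" arbitrary: y)
    case (Suc k)
    show ?case
    proof (cases "c x = k")
      case True
      then show ?thesis using adj[of x y] Suc that(1) by simp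
    next
      case False
      then have k: "c x < k" using Suc.hyps(2) Suc.prems(3) by simp
      have yy: "(r y, k) \<in> young mu" using box(1)[OF Suc.prems(1)] k Suc.hyps(2) by (auto simp: young_def)
      note z = row_col_t[OF yy]
      have "U x \<le> U (t (r y, k))" using Suc.hyps(1)[of "t (r y, k)"] z Suc.prems k by simp
      also have "\<dots> \<le> U y" using adj[of "t (r y, k)" y] z Suc by simp
      finally show ?thesis .
    qed
  qed simp
  then show ?thesis using that U(1) strict by blast
qed

end

section \<open>Homomorphisms of permutation modules\<close>

definition joint_content :: "nat \<Rightarrow> (nat \<Rightarrow> nat) \<Rightarrow> (nat \<Rightarrow> nat) \<Rightarrow> nat \<Rightarrow> nat \<Rightarrow> nat" where
  "joint_content n T W i a = card {m\<in>{1..n}. T m = i \<and> W m = a}"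

text \<open>The matrices \<open>N\<close> that occur as a joint content index the orbits of the symmetric group on
  pairs of tabloids.\<close>

definition theta :: "nat \<Rightarrow> (nat \<Rightarrow> nat) \<Rightarrow> (nat \<Rightarrow> nat) \<Rightarrow> (nat \<Rightarrow> nat \<Rightarrow> nat) \<Rightarrow>
    ((nat \<Rightarrow> nat) \<Rightarrow> 'a::field) \<Rightarrow> (nat \<Rightarrow> nat) \<Rightarrow> 'a" where
  "theta n mu lam N x W = (if W \<in> tabloids n lam
     then \<Sum>T\<in>tabloids n mu. if joint_content n T W = N then x T else 0 else 0)"

lemma joint_content_comp:
  assumes \<sigma>: "\<sigma> permutes {1..n}"
  shows "joint_content n (T \<circ> \<sigma>) (W \<circ> \<sigma>) = joint_content n T W"
proof (intro ext)
  fix i a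
  have "bij_betw \<sigma> {m\<in>{1..n}. (T \<circ> \<sigma>) m = i \<and> (W \<circ> \<sigma>) m = a} {m\<in>{1..n}. T m = i \<and> W m = a}"
    by (rule bij_betwI[where g = "inv \<sigma>"])
      (use permutes_in_image[OF \<sigma>] permutes_in_image[OF permutes_inv[OF \<sigma>]] permutes_inverses[OF \<sigma>] in auto)
  then show "joint_content n (T \<circ> \<sigma>) (W \<circ> \<sigma>) i a = joint_content n T W i a"
    unfolding joint_content_def by (rule bij_betw_same_card)
qed

lemma theta_perm_module: "theta n mu lam N x \<in> perm_module n lam"
  by (simp add: perm_module_def theta_def)

lemma theta_perm_act:
  assumes \<sigma>: "\<sigma> permutes {1..n}"
  shows "theta n mu lam N (perm_act \<sigma> x) = perm_act \<sigma> (theta n mu lam N x)"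
proof
  fix W
  have "(\<Sum>T\<in>tabloids n mu. if joint_content n T W = N then x (T \<circ> \<sigma>) else 0) =
        (\<Sum>T\<in>tabloids n mu. if joint_content n T (W \<circ> \<sigma>) = N then x T else 0)"
  proof (rule sum.reindex_bij_witness[where i = "\<lambda>T. T \<circ> inv \<sigma>" and j = "\<lambda>T. T \<circ> \<sigma>"])
    fix T assume T: "T \<in> tabloids n mu"
    show "T \<circ> \<sigma> \<circ> inv \<sigma> = T" "T \<circ> inv \<sigma> \<circ> \<sigma> = T" by (auto simp: fun_eq_iff permutes_inverses[OF \<sigma>])
    show "T \<circ> \<sigma> \<in> tabloids n mu" "T \<circ> inv \<sigma> \<in> tabloids n mu"
      using T tabloids_comp[OF \<sigma>] tabloids_comp[OF permutes_inv[OF \<sigma>]] by blast+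
    show "(if joint_content n (T \<circ> \<sigma>) (W \<circ> \<sigma>) = N then x (T \<circ> \<sigma>) else 0) =
      (if joint_content n T W = N then x (T \<circ> \<sigma>) else 0)" unfolding joint_content_comp[OF \<sigma>] ..
  qed
  then show "theta n mu lam N (perm_act \<sigma> x) W = perm_act \<sigma> (theta n mu lam N x) W"
    by (simp add: theta_def perm_act_def tabloids_comp[OF \<sigma>])
qed

lemma theta_lin: "theta n mu lam N (\<lambda>T. k * x T + y T) = (\<lambda>W. k * theta n mu lam N x W + theta n mu lam N y W)"
proof
  fix W
  have "(\<Sum>T\<in>tabloids n mu. if joint_content n T W = N then k * x T + y T else 0) =
    (\<Sum>T\<in>tabloids n mu. k * (if joint_content n T W = N then x T else 0) + (if joint_content n T W = N then y T else 0))"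
    by (rule sum.cong) auto
  then show "theta n mu lam N (\<lambda>T. k * x T + y T) W = k * theta n mu lam N x W + theta n mu lam N y W"
    by (simp add: theta_def sum.distrib sum_distrib_left)
qed

lemma theta_equivariant: "equivariant n mu (theta n mu lam N)"
  unfolding equivariant_def using theta_lin theta_perm_act by blast

context tableau
begin

text \<open>Rows of a semistandard \<open>U\<close> are sorted, so by the rearrangement inequality the row
  rearrangements of \<open>U\<close> have smaller column level.\<close>

lemma theta_leading:
  assumes row: "\<And>x y. x \<in> {1..n} \<Longrightarrow> y \<in> {1..n} \<Longrightarrow> r x = r y \<Longrightarrow> c x < c y \<Longrightarrow> U x \<le> U y"
    and \<pi>: "\<pi> \<in> C" and N: "joint_content n (r \<circ> inv \<pi>) W = joint_content n r U"
  shows "col_level W \<le> col_level U" "col_level W = col_level U \<Longrightarrow> m \<in> {1..n} \<Longrightarrow> W (\<pi> m) = U m"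
proof -
  note P = C_permutes[OF \<pi>]
  have "joint_content n r (W \<circ> \<pi>) = joint_content n r U"
    using joint_content_comp[OF P, of "r \<circ> inv \<pi>" W] N permutes_inv_o(2)[OF P] by (simp add: comp_assoc)
  then have cnt: "card {x\<in>{1..n}. r x = i \<and> (W \<circ> \<pi>) x = a} = card {x\<in>{1..n}. r x = i \<and> U x = a}" for i a
    unfolding joint_content_def by meson
  have "col_level (W \<circ> \<pi>) \<le> col_level U"
    by (rule rearrangement_classes(1)[where q = r, OF finite_atLeastAtMost _ _ cnt]) (use box_inj row in blast)+
  then show "col_level W \<le> col_level U" using col_level_C[OF \<pi>] by simp
  assume "col_level W = col_level U" and m: "m \<in> {1..n}"
  then have eq: "col_level (W \<circ> \<pi>) = col_level U" using col_level_C[OF \<pi>] by simp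
  have "(W \<circ> \<pi>) m = U m"
    by (rule rearrangement_classes(2)[where q = r, OF finite_atLeastAtMost _ _ cnt eq m]) (use box_inj row in blast)+
  then show "W (\<pi> m) = U m" by simp
qed

lemma theta_e_nonzeroD:
  assumes "theta n mu lam N e W \<noteq> 0"
  obtains \<pi> where "\<pi> \<in> C" "joint_content n (r \<circ> inv \<pi>) W = N"
proof -
  have "\<exists>T. joint_content n T W = N \<and> (e T :: 'a) \<noteq> 0"
  proof (rule ccontr)
    assume "\<not> ?thesis"
    then have "theta n mu lam N e W = (0 :: 'a)" by (auto simp: theta_def intro!: sum.neutral)
    then show False using assms by simp
  qed
  then show ?thesis using that poly_nonzeroD by metis
qed

text \<open>If a column permutation contributes, the equality case of \<open>theta_leading\<close>
  shows that it preserves \<open>U\<close>. Strict columns then make it trivial, so only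
  \<open>e r = 1\<close> is counted.\<close>

lemma theta_e_self:
  assumes U: "U \<in> tabloids n lam"
    and col: "\<And>x y. x \<in> {1..n} \<Longrightarrow> y \<in> {1..n} \<Longrightarrow> c x = c y \<Longrightarrow> r x < r y \<Longrightarrow> U x < U y"
    and row: "\<And>x y. x \<in> {1..n} \<Longrightarrow> y \<in> {1..n} \<Longrightarrow> r x = r y \<Longrightarrow> c x < c y \<Longrightarrow> U x \<le> U y"
  shows "theta n mu lam (joint_content n r U) e U = (1::'a::field)"
proof -
  let ?N = "joint_content n r U"
  have zero: "(if joint_content n T U = ?N then e T else 0) = (0::'a)" if "T \<noteq> r" for T
  proof (rule ccontr)
    assume "\<not> ?thesis"
    then have T: "joint_content n T U = ?N" "(e T :: 'a) \<noteq> 0" by (auto split: if_splits)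
    obtain \<pi> where p: "\<pi> \<in> C" "T = r \<circ> inv \<pi>" using poly_nonzeroD[OF T(2)] .
    note P = C_permutes[OF p(1)]
    have Ufix: "U (\<pi> m) = U m" if "m \<in> {1..n}" for m
      by (rule theta_leading(2)[OF _ p(1) _ refl that]) (use row T(1) p(2) in blast)+
    have "\<pi> m = m" for m
    proof (cases "m \<in> {1..n}")
      case True
      have m': "\<pi> m \<in> {1..n}" using permutes_in_image[OF P] True by blast
      have "r (\<pi> m) = r m"
        using col[OF m' True] col[OF True m'] Ufix[OF True] C_col[OF p(1) True] by (metis less_irrefl linorder_neqE_nat)
      then show ?thesis using box_inj[OF m' True] C_col[OF p(1) True] by simp
    qed (use permutes_not_in[OF P] in blast)
    then have "\<pi> = id" by auto
    then show False using that p(2) by simp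
  qed
  have "(\<Sum>T\<in>tabloids n mu. if joint_content n T U = ?N then e T else 0) =
      (\<Sum>T\<in>{r}. if joint_content n T U = ?N then e T else (0::'a))"
    using row_tabloid zero finite_tabloids by (intro sum.mono_neutral_right) auto
  then show ?thesis using U poly_row[where 'a = 'a] by (simp add: theta_def)
qed

text \<open>The semistandard homomorphism theorem, phrased as an induction principle so that
  properties pass from orbit sums to all homomorphisms. In the subtracted vector, the terms at the
  level of \<open>U\<close> are column permutations of \<open>U\<close>. There \<open>x\<close> is
  nonzero as well, because it alternates, so nothing new appears at this level.\<close>

theorem theta_span:
  fixes g :: "((nat \<Rightarrow> nat) \<Rightarrow> 'a::field) \<Rightarrow> (nat \<Rightarrow> nat) \<Rightarrow> 'a"
  assumes two: "(2::'a) \<noteq> 0" and g: "equivariant n mu g" "g e \<in> perm_module n lam"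
    and zero: "P (\<lambda>_. 0)"
    and add: "\<And>x N k. P x \<Longrightarrow> P (\<lambda>W. x W + k * theta n mu lam N e W)"
  shows "P (g e)"
proof (rule elimination[where I = "tabloids n lam" and V = "{v \<in> perm_module n lam. \<exists>g. equivariant n mu g \<and> v = g e}"
      and D = "range (\<lambda>N. theta n mu lam N e)" and l = col_level and P = P])
  fix x b :: "(nat \<Rightarrow> nat) \<Rightarrow> 'a" and k
  assume "x \<in> {v \<in> perm_module n lam. \<exists>g. equivariant n mu g \<and> v = g e}" and "b \<in> range (\<lambda>N. theta n mu lam N e)"
  then obtain f N where f: "x \<in> perm_module n lam" "equivariant n mu f" "x = f e" "b = theta n mu lam N e" by blast
  define h where "h = (\<lambda>v T. (- k) * theta n mu lam N v T + f v T)"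
  have "equivariant n mu h" unfolding h_def by (rule equivariant_comb[OF theta_equivariant f(2)])
  moreover have "(\<lambda>w. x w - k * b w) = h e" unfolding h_def f(3,4) by auto
  moreover have "h e \<in> perm_module n lam"
    unfolding h_def using f(1,3) by (intro perm_module_lin theta_perm_module) simp
  ultimately show "(\<lambda>w. x w - k * b w) \<in> {v \<in> perm_module n lam. \<exists>g. equivariant n mu g \<and> v = g e}" by auto
next
  fix x :: "(nat \<Rightarrow> nat) \<Rightarrow> 'a"
  assume "x \<in> {v \<in> perm_module n lam. \<exists>g. equivariant n mu g \<and> v = g e}" and nz: "x \<noteq> (\<lambda>_. 0)"
  then obtain f where f: "x \<in> perm_module n lam" "equivariant n mu f" "x = f e" by blast
  obtain U where U: "f e U \<noteq> 0"
    "\<And>x y. x \<in> {1..n} \<Longrightarrow> y \<in> {1..n} \<Longrightarrow> c x = c y \<Longrightarrow> r x < r y \<Longrightarrow> U x < U y"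
    "\<And>x y. x \<in> {1..n} \<Longrightarrow> y \<in> {1..n} \<Longrightarrow> r x = r y \<Longrightarrow> c x < c y \<Longrightarrow> U x \<le> U y"
    using semistandard_support[OF two f(2)] f(1,3) nz by metis
  have UT: "U \<in> tabloids n lam" using f(1,3) U(1) by (auto simp: perm_module_def)
  let ?b = "theta n mu lam (joint_content n r U) e :: (nat \<Rightarrow> nat) \<Rightarrow> 'a"
  show "\<exists>b\<in>range (\<lambda>N. theta n mu lam N e :: (nat \<Rightarrow> nat) \<Rightarrow> 'a). \<exists>u. x u \<noteq> 0 \<and> b u \<noteq> 0 \<and>
    (\<forall>w. b w \<noteq> 0 \<longrightarrow> x w \<noteq> 0 \<or> col_level w < col_level u)"
  proof (intro bexI[of _ ?b] exI[of _ U] conjI allI impI)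
    show "x U \<noteq> 0" using U(1) f(3) by simp
    have "?b U = 1" by (rule theta_e_self[OF UT]) (fact U(2), fact U(3))
    then show "?b U \<noteq> 0" by simp
    show "?b \<in> range (\<lambda>N. theta n mu lam N e)" by blast
    fix w assume w: "?b w \<noteq> 0"
    obtain \<pi> where p: "\<pi> \<in> C" "joint_content n (r \<circ> inv \<pi>) w = joint_content n r U"
      using theta_e_nonzeroD[OF w] .
    note P = C_permutes[OF p(1)]
    have wT: "w \<in> tabloids n lam" using w theta_perm_module[of n mu lam] unfolding perm_module_def by blast
    show "x w \<noteq> 0 \<or> col_level w < col_level U"
    proof (cases "col_level w = col_level U")
      case False
      moreover have "col_level w \<le> col_level U" by (rule theta_leading(1)[OF _ p]) (fact U(3))
      ultimately show ?thesis by (meson le_neq_implies_less)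
    next
      case True
      have "(w \<circ> \<pi>) m = U m" for m
      proof (cases "m \<in> {1..n}")
        case mn: True
        have "w (\<pi> m) = U m" by (rule theta_leading(2)[OF U(3) p True mn])
        then show ?thesis by simp
      next
        case False
        then show ?thesis using wT UT permutes_not_in[OF P False] by (auto simp: tabloids_def)
      qed
      then have "w \<circ> \<pi> = U" by auto
      then have "x U = of_int (sign \<pi>) * x w"
        using alternating_image[OF f(2)] p(1) unfolding alternating_def f(3) by metis
      then show ?thesis using \<open>x U \<noteq> 0\<close> by auto
    qed
  qed
next
  show "g e \<in> {v \<in> perm_module n lam. \<exists>g. equivariant n mu g \<and> v = g e}" using g by blast
  show "finite (tabloids n lam)" by (rule finite_tabloids)
  show "P (\<lambda>w. x w + k * b w)" if "P x" "b \<in> range (\<lambda>N. theta n mu lam N e)" for x b k using that add by blast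
qed (use zero in \<open>auto simp: perm_module_def\<close>)

end

section \<open>Lengthening the first row\<close>

context tableau
begin

lemma row_one: "m \<in> {1..n} \<Longrightarrow> mu 2 < c m \<Longrightarrow> r m = 1"
  using row_col_pos[of m] is_partition_antimono[OF mu, of 2 "r m"] by (cases "2 \<le> r m") auto

text \<open>By column strictness the ones of a semistandard filling lie in the first row, and at most
  \<open>mu 2\<close> of them in a column of height at least two; the others can be permuted freely.\<close>

lemma first_row_support:
  fixes g :: "((nat \<Rightarrow> nat) \<Rightarrow> 'a::field) \<Rightarrow> (nat \<Rightarrow> nat) \<Rightarrow> 'a"
  assumes two: "(2::'a) \<noteq> 0" and g: "equivariant n mu g" "g e \<in> perm_module n nu" and nz: "g e \<noteq> (\<lambda>_. 0)"
    and nu: "nu 0 = 0" "mu 2 + card E \<le> nu 1" and E: "E \<subseteq> {m\<in>{1..n}. mu 2 < c m}"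
  obtains W where "g e W \<noteq> 0" "\<And>m. m \<in> E \<Longrightarrow> W m = 1" "\<And>m. m \<in> {1..n} \<Longrightarrow> W m = 1 \<Longrightarrow> r m = 1"
proof -
  obtain U where U: "g e U \<noteq> 0"
    "\<And>x y. x \<in> {1..n} \<Longrightarrow> y \<in> {1..n} \<Longrightarrow> c x = c y \<Longrightarrow> r x < r y \<Longrightarrow> U x < U y"
    using semistandard_support[OF two g nz] by metis
  have UT: "U \<in> tabloids n nu" using g(2) U(1) by (auto simp: perm_module_def)
  have pos: "U m \<noteq> 0" if "m \<in> {1..n}" for m
  proof
    assume "U m = 0"
    then have "m \<in> fibre n U 0" using that by simp
    moreover have "card (fibre n U 0) = 0" using UT nu(1) by (simp add: tabloids_def)
    moreover have "finite (fibre n U 0)" by simp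
    ultimately show False unfolding card_eq_0_iff by blast
  qed
  have ones: "r m = 1" if m: "m \<in> {1..n}" "U m = 1" for m
  proof (rule ccontr)
    assume "r m \<noteq> 1"
    then have gt: "1 < r m" using row_col_pos[OF m(1)] by simp
    have y: "(1, c m) \<in> young mu" using young_up[OF mu box(1)[OF m(1)]] gt by simp
    have "U (t (1, c m)) < U m" using U(2)[of "t (1, c m)" m] row_col_t[OF y] m(1) gt by simp
    then show False using pos[OF row_col_t(3)[OF y]] m(2) by simp
  qed
  let ?D = "{m\<in>{1..n}. mu 2 < c m}" and ?F = "fibre n U 1"
  have "card (?F - ?D) \<le> card {1..mu 2}"
  proof (rule card_inj_on_le[of c])
    show "inj_on c (?F - ?D)" using box_inj ones by (auto intro!: inj_onI)
    show "c ` (?F - ?D) \<subseteq> {1..mu 2}" using row_col_pos by auto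
  qed simp
  moreover have "card ?F = nu 1" using UT by (simp add: tabloids_def)
  moreover have "card ?F = card (?F \<inter> ?D) + card (?F - ?D)"
    by (rule card_Int_Diff) simp
  ultimately have le: "card E \<le> card (?F \<inter> ?D)" using nu(2) by simp
  obtain E' where E': "E' \<subseteq> ?F \<inter> ?D" "card E' = card E"
    using obtain_subset_with_card_n[OF le] by blast
  obtain \<pi> where \<pi>: "\<pi> permutes ?D" "\<pi> ` E = E'"
  proof (rule ex_permutes_image)
    show "finite ?D" by simp
    show "E \<subseteq> ?D" by (rule E)
    show "E' \<subseteq> ?D" "card E = card E'" using E' by auto
  qed
  show ?thesis
  proof (rule that[of "U \<circ> \<pi>"])
    show "g e (U \<circ> \<pi>) \<noteq> 0" using symmetric_image[OF g(1) \<pi>(1) subset_refl] U(1) by simp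
    show "(U \<circ> \<pi>) m = 1" if "m \<in> E" for m using that \<pi>(2) E'(1) by auto
    show "r m = 1" if "m \<in> {1..n}" "(U \<circ> \<pi>) m = 1" for m
    proof (cases "m \<in> ?D")
      case True
      then show ?thesis using row_one by blast
    next
      case False
      then show ?thesis using ones[of m] that permutes_not_in[OF \<pi>(1) False] by simp
    qed
  qed
qed

text \<open>At a fixed content, \<open>lower n i (g e)\<close> is the value at \<open>e\<close> of
  an equivariant map \<open>h\<close>. Hence a violation of the kernel condition at any
  \<open>U\<close> can be moved to a filling of the form supplied by
  \<open>first_row_support\<close>.\<close>

lemma kernel_test:
  fixes g :: "((nat \<Rightarrow> nat) \<Rightarrow> 'a::field) \<Rightarrow> (nat \<Rightarrow> nat) \<Rightarrow> 'a"
  assumes two: "(2::'a) \<noteq> 0" and g: "equivariant n mu g" "g e \<in> perm_module n lam"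
    and lam: "lam 0 = 0" "mu 2 + card E \<le> lam 1" and E: "E \<subseteq> {m\<in>{1..n}. mu 2 < c m}"
    and test: "\<And>i U. 1 \<le> i \<Longrightarrow> lam i < card (fibre n U i) \<Longrightarrow> (\<And>m. m \<in> {1..n} \<Longrightarrow> U m = 1 \<Longrightarrow> r m = 1) \<Longrightarrow>
      (\<And>m. m \<in> E \<Longrightarrow> U m = 1) \<Longrightarrow> (\<And>m. m \<notin> {1..n} \<Longrightarrow> U m = junk_row) \<Longrightarrow> lower n i (g e) U = 0"
  shows "in_kernel n lam (g e)"
  unfolding in_kernel_def
proof (intro allI impI, rule ccontr)
  fix i U assume i: "1 \<le> i" and less: "lam i < card (fibre n U i)" and nz: "lower n i (g e) U \<noteq> 0"
  \<comment> \<open>The content of the offending \<open>U\<close>. Cutting off at this content puts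
    \<open>h e\<close> in a permutation module, as \<open>first_row_support\<close> demands.\<close>
  define nu where "nu a = card (fibre n U a)" for a
  define h where "h x = (\<lambda>W. if W \<in> tabloids n nu then lower n i (g x) W else 0)" for x
  have h: "equivariant n mu h"
    unfolding equivariant_def
  proof (intro conjI allI ballI impI ext)
    fix k and v w :: "(nat \<Rightarrow> nat) \<Rightarrow> 'a" and W assume "v \<in> specht n mu" "w \<in> specht n mu"
    then show "h (\<lambda>T. k * v T + w T) W = k * h v W + h w W"
      by (simp add: h_def equivariant_lin[OF g(1)] lower_lin)
  next
    fix \<sigma> and v :: "(nat \<Rightarrow> nat) \<Rightarrow> 'a" and W assume \<sigma>: "\<sigma> permutes {1..n}" and "v \<in> specht n mu"
    then show "h (perm_act \<sigma> v) W = perm_act \<sigma> (h v) W"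
      unfolding h_def equivariant_perm[OF g(1) \<sigma> \<open>v \<in> specht n mu\<close>] lower_perm_act[OF \<sigma>]
      by (simp add: perm_act_def tabloids_comp[OF \<sigma>])
  qed
  obtain S where S: "S \<subseteq> fibre n U i" "g e (set_on S (Suc i) U) \<noteq> 0"
    using nz unfolding lower_def by (meson PowD sum.neutral)
  then have T: "set_on S (Suc i) U \<in> tabloids n lam" using g(2) by (auto simp: perm_module_def)
  have cnt: "card (fibre n (set_on S (Suc i) U) a) = lam a" for a using T by (simp add: tabloids_def)
  have out: "U m = junk_row" if "m \<notin> {1..n}" for m
  proof -
    have "m \<notin> S" using S(1) that by blast
    then show ?thesis using T that by (auto simp: tabloids_def set_on_def)
  qed
  have UT: "U \<in> tabloids n nu" using out by (simp add: tabloids_def nu_def)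
  have "fibre n U 0 = fibre n (set_on S (Suc i) U) 0" using S(1) i by (auto simp: set_on_def)
  then have nu0: "nu 0 = 0" using cnt[of 0] lam(1) by (simp add: nu_def)
  have "fibre n (set_on S (Suc i) U) 1 \<subseteq> fibre n U 1" using i by (auto simp: set_on_def)
  then have "card (fibre n (set_on S (Suc i) U) 1) \<le> nu 1" unfolding nu_def by (intro card_mono) auto
  then have nu1: "mu 2 + card E \<le> nu 1" using lam(2) unfolding cnt[of 1] by simp
  have "h e U \<noteq> 0" using nz UT by (simp add: h_def)
  then have hnz: "h e \<noteq> (\<lambda>_. 0)" by auto
  have hM: "h e \<in> perm_module n nu" by (simp add: h_def perm_module_def)
  obtain W where W: "h e W \<noteq> 0" "\<And>m. m \<in> E \<Longrightarrow> W m = 1" "\<And>m. m \<in> {1..n} \<Longrightarrow> W m = 1 \<Longrightarrow> r m = 1"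
    using first_row_support[OF two h hM hnz nu0 nu1 E] by blast
  have WT: "W \<in> tabloids n nu" using W(1) hM by (auto simp: perm_module_def)
  then have "card (fibre n W i) = nu i" by (simp add: tabloids_def)
  moreover have "lower n i (g e) W \<noteq> 0" using W(1) WT by (simp add: h_def)
  moreover have "W m = junk_row" if "m \<notin> {1..n}" for m using WT that by (simp add: tabloids_def)
  ultimately show False using test[OF i, of W] W(2,3) less unfolding nu_def by metis
qed

end

section \<open>Old and new tableaux, tabloids and polytabloids\<close>

locale extension = tableau +
  fixes K :: nat
begin

text \<open>The new boxes receive the letters after \<open>n\<close>, so that permutations of
  \<open>{1..n}\<close> act on both sides and fix the new letters.\<close>

definition t' :: "nat \<times> nat \<Rightarrow> nat" where
  "t' = (\<lambda>(i, j). if i = 1 \<and> mu 1 < j then n + (j - mu 1) else t (i, j))"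

abbreviation "n' \<equiv> n + K"
abbreviation "mu' \<equiv> add_first mu K"
abbreviation "new \<equiv> {n + 1..n + K}"

lemma young_ext: "(i, j) \<in> young mu' \<longleftrightarrow> (i, j) \<in> young mu \<or> (i = 1 \<and> mu 1 < j \<and> j \<le> mu 1 + K)"
  by (auto simp: young_def add_first_def)

lemma t'_old: "(i, j) \<in> young mu \<Longrightarrow> t' (i, j) = t (i, j)"
  by (auto simp: t'_def young_def)

lemma t'_new: "mu 1 < j \<Longrightarrow> t' (1, j) = n + (j - mu 1)"
  by (simp add: t'_def)

lemma t'_tableau: "t' \<in> tableaux n' mu'"
  unfolding tableaux_def mem_Collect_eq bij_betw_def
proof (intro conjI inj_onI)
  fix x y assume xy: "x \<in> young mu'" "y \<in> young mu'" "t' x = t' y"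
  obtain i j a b where x: "x = (i, j)" and y: "y = (a, b)" by fastforce
  have inj: "inj_on t (young mu)" using bij_t by (simp add: bij_betw_def)
  consider "(i, j) \<in> young mu" "(a, b) \<in> young mu" | "(i, j) \<in> young mu" "a = 1" "mu 1 < b"
    | "i = 1" "mu 1 < j" "(a, b) \<in> young mu" | "i = 1" "mu 1 < j" "a = 1" "mu 1 < b"
    using xy(1,2) unfolding x y young_ext by blast
  then show "x = y"
  proof cases
    case 1
    then show ?thesis using xy(3) inj unfolding x y t'_old[OF 1(1)] t'_old[OF 1(2)] by (simp add: inj_on_eq_iff)
  next
    case 2
    then show ?thesis using xy(3) t'_old[OF 2(1)] t'_new[OF 2(3)] row_col_t(3)[OF 2(1)] unfolding x y by auto
  next
    case 3
    then show ?thesis using xy(3) t'_old[OF 3(3)] t'_new[OF 3(2)] row_col_t(3)[OF 3(3)] unfolding x y by auto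
  next
    case 4
    then show ?thesis using xy(3) t'_new[OF 4(2)] t'_new[OF 4(4)] unfolding x y by auto
  qed
next
  show "t' ` young mu' = {1..n'}"
  proof (intro equalityI subsetI)
    fix m assume "m \<in> t' ` young mu'"
    then obtain i j where ij: "(i, j) \<in> young mu'" "m = t' (i, j)" by auto
    then show "m \<in> {1..n'}"
      using row_col_t(3)[of i j] t'_old[of i j] t'_new[of j] unfolding young_ext by auto
  next
    fix m assume m: "m \<in> {1..n'}"
    show "m \<in> t' ` young mu'"
    proof (cases "m \<le> n")
      case True
      then have "m \<in> {1..n}" using m by simp
      then have "t' (r m, c m) = m" "(r m, c m) \<in> young mu'" using box t'_old young_ext by auto
      then show ?thesis by (metis imageI)
    next
      case False
      then have "t' (1, mu 1 + (m - n)) = m" "(1, mu 1 + (m - n)) \<in> young mu'"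
        using m t'_new[of "mu 1 + (m - n)"] young_ext by auto
      then show ?thesis by (metis imageI)
    qed
  qed
qed

sublocale ext: tableau n' mu' t'
  using add_first_partition[OF mu] t'_tableau by unfold_locales

lemma ext_old: 
  assumes "m \<in> {1..n}"
  shows "ext.r m = r m" "ext.c m = c m"
  using ext.row_col_t[of "r m" "c m"] box[OF assms] t'_old young_ext by auto

lemma ext_new:
  assumes "m \<in> new"
  shows "ext.r m = 1" "ext.c m = mu 1 + (m - n)"
proof -
  have "t' (1, mu 1 + (m - n)) = m" "(1, mu 1 + (m - n)) \<in> young mu'"
    using assms t'_new[of "mu 1 + (m - n)"] young_ext by auto
  then show "ext.r m = 1" "ext.c m = mu 1 + (m - n)" using ext.row_col_t by metis+
qed

text \<open>Tabloids on \<open>{1..n}\<close> have the value \<open>junk_row\<close> on the new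
  letters; \<open>lift\<close> replaces it by row 1 and \<open>unlift\<close> restores it.\<close>

definition lift :: "(nat \<Rightarrow> nat) \<Rightarrow> nat \<Rightarrow> nat" where
  "lift W m = (if m \<in> new then 1 else W m)"

definition unlift :: "(nat \<Rightarrow> nat) \<Rightarrow> nat \<Rightarrow> nat" where
  "unlift W m = (if m \<in> new then junk_row else W m)"

lemma unlift_lift: "(\<And>m. m \<in> new \<Longrightarrow> W m = junk_row) \<Longrightarrow> unlift (lift W) = W"
  by (auto simp: lift_def unlift_def fun_eq_iff)

lemma lift_unlift: "(\<And>m. m \<in> new \<Longrightarrow> W m = 1) \<Longrightarrow> lift (unlift W) = W"
  by (auto simp: lift_def unlift_def fun_eq_iff)

lemma fibre_lift: "fibre n' (lift W) a = fibre n W a \<union> (if a = 1 then new else {})"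
  by (auto simp: lift_def)

lemma card_fibre_lift: "card (fibre n' (lift W) a) = card (fibre n W a) + (if a = 1 then K else 0)"
proof -
  have "card (fibre n W a \<union> (if a = 1 then new else {})) = card (fibre n W a) + card (if a = 1 then new else {})"
    by (intro card_Un_disjoint) auto
  then show ?thesis unfolding fibre_lift by simp
qed

lemma lift_tabloids:
  assumes "\<And>m. m \<in> new \<Longrightarrow> W m = junk_row"
  shows "lift W \<in> tabloids n' (add_first lam K) \<longleftrightarrow> W \<in> tabloids n lam"
proof -
  have "(\<forall>m. m \<notin> {1..n'} \<longrightarrow> lift W m = junk_row) \<longleftrightarrow> (\<forall>m. m \<notin> {1..n} \<longrightarrow> W m = junk_row)"
  proof -
    have "lift W m = W m" if "m \<notin> {1..n'}" for m using that by (auto simp: lift_def)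
    moreover have "m \<notin> {1..n} \<longleftrightarrow> m \<notin> {1..n'} \<or> m \<in> new" for m by auto
    ultimately show ?thesis using assms by metis
  qed
  moreover have "card (fibre n' (lift W) a) = add_first lam K a \<longleftrightarrow> card (fibre n W a) = lam a" for a
    unfolding card_fibre_lift by (simp add: add_first_def)
  ultimately show ?thesis unfolding tabloids_def by blast
qed

lemma tabloid_new: "W \<in> tabloids n lam \<Longrightarrow> m \<in> new \<Longrightarrow> W m = junk_row"
  by (simp add: tabloids_def)

lemma lift_comp:
  assumes "\<sigma> permutes {1..n}"
  shows "lift W \<circ> \<sigma> = lift (W \<circ> \<sigma>)" "unlift W \<circ> \<sigma> = unlift (W \<circ> \<sigma>)"
proof -
  have "\<sigma> m \<in> new \<longleftrightarrow> m \<in> new" for m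
  proof (cases "m \<in> {1..n}")
    case True
    then have "\<sigma> m \<in> {1..n}" using permutes_in_image[OF assms] by blast
    then show ?thesis using True by auto
  qed (use permutes_not_in[OF assms] in auto)
  then show "lift W \<circ> \<sigma> = lift (W \<circ> \<sigma>)" "unlift W \<circ> \<sigma> = unlift (W \<circ> \<sigma>)"
    by (auto simp: lift_def unlift_def fun_eq_iff)
qed

lemma ext_r: "ext.r = lift r"
proof
  fix m
  consider "m \<in> {1..n}" | "m \<in> new" | "m \<notin> {1..n'}" "m \<notin> {1..n}" "m \<notin> new" by fastforce
  then show "ext.r m = lift r m"
  proof cases
    case 1
    then show ?thesis using ext_old by (simp add: lift_def)
  next
    case 2
    then show ?thesis using ext_new by (simp add: lift_def)
  next
    case 3
    then show ?thesis using ext.row_out[OF 3(1)] row_out[OF 3(2)] unfolding lift_def by presburger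
  qed
qed

text \<open>New letters stand alone in columns beyond \<open>mu 1\<close>, so column permutations
  fix them.\<close>

lemma ext_C: "ext.C = C"
proof (intro equalityI subsetI)
  fix \<pi> assume \<pi>: "\<pi> \<in> ext.C"
  note P = ext.C_permutes[OF \<pi>]
  have "\<pi> m = m" if m: "m \<in> new" for m
  proof -
    have mn: "m \<in> {1..n'}" using m by auto
    then have pm: "\<pi> m \<in> {1..n'}" using permutes_in_image[OF P] by blast
    have c: "ext.c (\<pi> m) = ext.c m" using ext.C_col[OF \<pi> mn] .
    have "mu' 2 < ext.c m"
      using ext_new(2)[OF m] m is_partition_antimono[OF mu, of 1 2] by (auto simp: add_first_def)
    then have "ext.r (\<pi> m) = ext.r m" using ext.row_one[OF pm] ext.row_one[OF mn] c by simp
    then show ?thesis using ext.box_inj[OF pm mn] c by blast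
  qed
  moreover have "{1..n'} - {1..n} = new" by auto
  ultimately have Pn: "\<pi> permutes {1..n}" by (intro permutes_superset[OF P]) blast
  have "c (\<pi> m) = c m" if m: "m \<in> {1..n}" for m
  proof -
    have "\<pi> m \<in> {1..n}" using permutes_in_image[OF Pn] m by blast
    then show ?thesis using ext.C_col[OF \<pi>, of m] ext_old(2) m by simp
  qed
  then show "\<pi> \<in> C" using Pn by (simp add: col_stab_def)
next
  fix \<pi> assume \<pi>: "\<pi> \<in> C"
  note P = C_permutes[OF \<pi>]
  have "ext.c (\<pi> m) = ext.c m" if "m \<in> {1..n'}" for m
  proof (cases "m \<in> {1..n}")
    case True
    then have "\<pi> m \<in> {1..n}" using permutes_in_image[OF P] by blast
    then show ?thesis using C_col[OF \<pi> True] ext_old(2) True by simp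
  qed (use permutes_not_in[OF P] in simp)
  moreover have "\<pi> permutes {1..n'}" by (rule permutes_subset[OF P]) auto
  ultimately show "\<pi> \<in> ext.C" by (simp add: col_stab_def)
qed

text \<open>Extension by zero along \<open>lift\<close>, with \<open>rho\<close> as the
  corresponding restriction. Since \<open>iota\<close> sends \<open>e\<close> to
  \<open>ext.e\<close>, it embeds the old Specht module in the new one compatibly with the smaller
  symmetric group.\<close>

definition iota :: "((nat \<Rightarrow> nat) \<Rightarrow> 'a::field) \<Rightarrow> (nat \<Rightarrow> nat) \<Rightarrow> 'a" where
  "iota x T = (if \<forall>m\<in>new. T m = 1 then x (unlift T) else 0)"

definition rho :: "((nat \<Rightarrow> nat) \<Rightarrow> 'a::field) \<Rightarrow> (nat \<Rightarrow> nat) \<Rightarrow> 'a" where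
  "rho y W = (if \<forall>m\<in>new. W m = junk_row then y (lift W) else 0)"

lemma iota_e: "iota e = ext.e"
proof
  fix T
  have lr: "lift r \<circ> inv \<pi> = lift (r \<circ> inv \<pi>)" if "\<pi> \<in> C" for \<pi>
    using lift_comp(1)[OF permutes_inv[OF C_permutes[OF that]]] .
  show "(iota e T :: 'a::field) = ext.e T"
  proof (cases "\<forall>m\<in>new. T m = 1")
    case True
    have "lift (r \<circ> inv \<pi>) = T \<longleftrightarrow> r \<circ> inv \<pi> = unlift T" if "\<pi> \<in> C" for \<pi>
    proof -
      have "r \<circ> inv \<pi> \<in> tabloids n mu"
        using row_tabloid tabloids_comp[OF permutes_inv[OF C_permutes[OF that]]] by blast
      then have "unlift (lift (r \<circ> inv \<pi>)) = r \<circ> inv \<pi>" using unlift_lift tabloid_new by blast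
      moreover have "lift (unlift T) = T" using lift_unlift True by blast
      ultimately show ?thesis by metis
    qed
    then have "{\<pi>\<in>C. lift r \<circ> inv \<pi> = T} = {\<pi>\<in>C. r \<circ> inv \<pi> = unlift T}"
      by (intro Collect_cong conj_cong refl) (simp add: lr)
    then show ?thesis unfolding iota_def polytabloid_def ext_r ext_C using True by simp
  next
    case False
    have "(ext.e T :: 'a) = 0"
    proof (rule ccontr)
      assume "(ext.e T :: 'a) \<noteq> 0"
      then obtain \<pi> where "\<pi> \<in> ext.C" "T = ext.r \<circ> inv \<pi>" using ext.poly_nonzeroD by blast
      then have "T = lift (r \<circ> inv \<pi>)" using lr unfolding ext_C ext_r by simp
      then show False using False by (auto simp: lift_def)
    qed
    then show ?thesis using False by (auto simp: iota_def)
  qed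
qed

lemma iota_lin: "iota (\<lambda>T. k * v T + w T) = (\<lambda>T. k * iota v T + iota w T)"
  by (auto simp: iota_def)

lemma rho_lin: "rho (\<lambda>T. k * v T + w T) = (\<lambda>T. k * rho v T + rho w T)"
  by (auto simp: rho_def)

lemma new_comp:
  assumes "\<sigma> permutes {1..n}" "m \<in> new"
  shows "\<sigma> m = m"
  using permutes_not_in[OF assms(1)] assms(2) by auto

lemma iota_perm_act:
  assumes "\<sigma> permutes {1..n}"
  shows "iota (perm_act \<sigma> v) = perm_act \<sigma> (iota v)"
proof
  fix T :: "nat \<Rightarrow> nat"
  have "(\<forall>m\<in>new. (T \<circ> \<sigma>) m = 1) \<longleftrightarrow> (\<forall>m\<in>new. T m = 1)" using new_comp[OF assms] by auto
  then show "iota (perm_act \<sigma> v) T = perm_act \<sigma> (iota v) T"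
    unfolding iota_def perm_act_def lift_comp(2)[OF assms] by presburger
qed

lemma rho_perm_act:
  assumes "\<sigma> permutes {1..n}"
  shows "rho (perm_act \<sigma> v) = perm_act \<sigma> (rho v)"
proof
  fix T
  have "(\<forall>m\<in>new. (T \<circ> \<sigma>) m = junk_row) \<longleftrightarrow> (\<forall>m\<in>new. T m = junk_row)" using new_comp[OF assms] by auto
  then show "rho (perm_act \<sigma> v) T = perm_act \<sigma> (rho v) T"
    unfolding rho_def perm_act_def lift_comp(1)[OF assms] by presburger
qed

lemma permutes_n': "\<sigma> permutes {1..n} \<Longrightarrow> \<sigma> permutes {1..n'}"
  by (erule permutes_subset) auto

lemma iota_specht:
  assumes "(v :: (nat \<Rightarrow> nat) \<Rightarrow> 'a::field) \<in> specht n mu"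
  shows "iota v \<in> specht n' mu'"
  using assms
proof (induction rule: specht_generated)
  case zero
  have "iota (\<lambda>T. 0 :: 'a) = (\<lambda>T. 0)" by (auto simp: iota_def)
  then show ?case by (simp only: specht_zero)
next
  case (add k \<sigma> w)
  show ?case unfolding iota_lin iota_perm_act[OF add(1)] iota_e
    by (rule specht_lin[OF specht_perm_act[OF ext.mu permutes_n'[OF add(1)] ext.e_specht] add(3)])
qed

lemma rho_perm_module:
  assumes "y \<in> perm_module n' (add_first lam K)"
  shows "rho y \<in> perm_module n lam"
  using assms lift_tabloids[of _ lam] unfolding perm_module_def rho_def by (auto split: if_splits)

lemma rho_unlift:
  assumes "\<And>m. m \<in> new \<Longrightarrow> W m = 1"
  shows "y W = rho y (unlift W)"
proof -
  have "\<forall>m\<in>new. unlift W m = junk_row" by (simp add: unlift_def)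
  then show ?thesis using lift_unlift[of W] assms by (simp add: rho_def)
qed

lemma down:
  fixes f :: "((nat \<Rightarrow> nat) \<Rightarrow> 'a::field) \<Rightarrow> (nat \<Rightarrow> nat) \<Rightarrow> 'a"
  assumes f: "equivariant n' mu' f"
  shows "equivariant n mu (\<lambda>v. rho (f (iota v)))" and "rho (f (iota e)) = rho (f ext.e)"
proof -
  show "equivariant n mu (\<lambda>v. rho (f (iota v)))"
    unfolding equivariant_def
  proof (intro conjI allI ballI impI)
    fix k and v w :: "(nat \<Rightarrow> nat) \<Rightarrow> 'a" assume v: "v \<in> specht n mu" and w: "w \<in> specht n mu"
    show "rho (f (iota (\<lambda>T. k * v T + w T))) = (\<lambda>T. k * rho (f (iota v)) T + rho (f (iota w)) T)"
      unfolding iota_lin equivariant_lin[OF f iota_specht[OF v] iota_specht[OF w]] rho_lin ..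
  next
    fix \<sigma> and v :: "(nat \<Rightarrow> nat) \<Rightarrow> 'a" assume \<sigma>: "\<sigma> permutes {1..n}" and v: "v \<in> specht n mu"
    show "rho (f (iota (perm_act \<sigma> v))) = perm_act \<sigma> (rho (f (iota v)))"
      unfolding iota_perm_act[OF \<sigma>] equivariant_perm[OF f permutes_n'[OF \<sigma>] iota_specht[OF v]] rho_perm_act[OF \<sigma>] ..
  qed
  show "rho (f (iota e)) = rho (f ext.e)" unfolding iota_e ..
qed

text \<open>The effect of lifting on a joint content: the \<open>K\<close> new letters are in row 1
  of both tabloids.\<close>

definition add_corner :: "(nat \<Rightarrow> nat \<Rightarrow> nat) \<Rightarrow> nat \<Rightarrow> nat \<Rightarrow> nat" where
  "add_corner N i a = N i a + (if i = 1 \<and> a = 1 then K else 0)"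

lemma joint_content_lift: "joint_content n' (lift T) (lift W) = add_corner (joint_content n T W)"
proof (intro ext)
  fix i a
  have "{m\<in>{1..n'}. lift T m = i \<and> lift W m = a} =
    {m\<in>{1..n}. T m = i \<and> W m = a} \<union> (if i = 1 \<and> a = 1 then new else {})"
    by (auto simp: lift_def)
  moreover have "card ({m\<in>{1..n}. T m = i \<and> W m = a} \<union> (if i = 1 \<and> a = 1 then new else {})) =
    card {m\<in>{1..n}. T m = i \<and> W m = a} + card (if i = 1 \<and> a = 1 then new else {})"
    by (intro card_Un_disjoint) auto
  ultimately show "joint_content n' (lift T) (lift W) i a = add_corner (joint_content n T W) i a"
    by (simp add: joint_content_def add_corner_def)
qed

lemma add_corner_inj: "add_corner N = add_corner N' \<longleftrightarrow> N = N'"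
  by (auto simp: add_corner_def fun_eq_iff)

text \<open>Tabloids in the support of \<open>ext.e\<close> have the new letters in row 1, hence are
  lifts. Only these contribute, and lifting both arguments changes the joint content at the corner
  alone.\<close>

lemma theta_lift: "rho (theta n' mu' (add_first lam K) (add_corner N) ext.e) = theta n mu lam N e"
proof
  fix W
  show "rho (theta n' mu' (add_first lam K) (add_corner N) ext.e) W = (theta n mu lam N e W :: 'a::field)"
  proof (cases "W \<in> tabloids n lam")
    case False
    then show ?thesis using lift_tabloids[of W lam] by (auto simp: rho_def theta_def)
  next
    case True
    then have W: "\<forall>m\<in>new. W m = junk_row" using tabloid_new by blast
    let ?F = "\<lambda>T. if joint_content n' T (lift W) = add_corner N then ext.e T else (0::'a)"
    have "(\<Sum>T\<in>tabloids n' mu'. ?F T) = (\<Sum>T\<in>lift ` tabloids n mu. ?F T)"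
    proof (rule sum.mono_neutral_right)
      show "finite (tabloids n' mu')" by (rule finite_tabloids)
      show "lift ` tabloids n mu \<subseteq> tabloids n' mu'" using lift_tabloids tabloid_new by blast
      show "\<forall>T\<in>tabloids n' mu' - lift ` tabloids n mu. ?F T = 0"
      proof
        fix T assume T: "T \<in> tabloids n' mu' - lift ` tabloids n mu"
        have "(ext.e T :: 'a) = 0"
        proof (rule ccontr)
          assume nz: "(ext.e T :: 'a) \<noteq> 0"
          then have one: "\<forall>m\<in>new. T m = 1" unfolding iota_e[symmetric] iota_def by presburger
          then have "lift (unlift T) = T" using lift_unlift by blast
          moreover have "unlift T \<in> tabloids n mu"
            using lift_tabloids[of "unlift T" mu] calculation T by (auto simp: unlift_def)
          ultimately show False using T by (metis DiffD2 imageI)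
        qed
        then show "?F T = 0" by simp
      qed
    qed
    also have "\<dots> = (\<Sum>T\<in>tabloids n mu. ?F (lift T))"
    proof (rule sum.reindex_cong[where l = lift])
      show "inj_on lift (tabloids n mu)"
        using unlift_lift tabloid_new by (intro inj_on_inverseI[where g = unlift]) blast
    qed auto
    also have "\<dots> = (\<Sum>T\<in>tabloids n mu. if joint_content n T W = N then e T else 0)"
    proof (rule sum.cong[OF refl])
      fix T assume T: "T \<in> tabloids n mu"
      have "unlift (lift T) = T" using unlift_lift tabloid_new[OF T] by blast
      then have "(ext.e (lift T) :: 'a) = e T" unfolding iota_e[symmetric] by (simp add: iota_def lift_def)
      then show "?F (lift T) = (if joint_content n T W = N then e T else 0)"
        unfolding joint_content_lift add_corner_inj by simp
    qed
    finally show ?thesis using True W lift_tabloids[of W lam] by (simp add: rho_def theta_def)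
  qed
qed

text \<open>Orbit sums are equivariant under the larger group by construction. So write
  \<open>g e\<close> as a combination of vectors \<open>theta n mu lam N e\<close> and take the same
  combination of the orbit sums for \<open>add_corner N\<close>.\<close>

lemma up:
  fixes g :: "((nat \<Rightarrow> nat) \<Rightarrow> 'a::field) \<Rightarrow> (nat \<Rightarrow> nat) \<Rightarrow> 'a"
  assumes two: "(2::'a) \<noteq> 0" and g: "equivariant n mu g" "g e \<in> perm_module n lam"
  obtains f where "equivariant n' mu' f" "f ext.e \<in> perm_module n' (add_first lam K)" "rho (f ext.e) = g e"
proof -
  have "\<exists>f. equivariant n' mu' f \<and> f ext.e \<in> perm_module n' (add_first lam K) \<and> rho (f ext.e) = g e"
  proof (rule theta_span[OF two g, where P = "\<lambda>v. \<exists>f. equivariant n' mu' f \<and>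
        f ext.e \<in> perm_module n' (add_first lam K) \<and> rho (f ext.e) = v"])
    have "equivariant n' mu' (\<lambda>v T. 0 :: 'a)" by (simp add: equivariant_def perm_act_def)
    moreover have "rho (\<lambda>T. 0 :: 'a) = (\<lambda>_. 0)" by (auto simp: rho_def)
    ultimately show "\<exists>f. equivariant n' mu' f \<and> f ext.e \<in> perm_module n' (add_first lam K) \<and>
        rho (f ext.e) = (\<lambda>_. 0 :: 'a)" using perm_module_zero by (intro exI[of _ "\<lambda>v T. 0"]) blast
  next
    fix x :: "(nat \<Rightarrow> nat) \<Rightarrow> 'a" and N and k :: 'a
    assume "\<exists>f. equivariant n' mu' f \<and> f ext.e \<in> perm_module n' (add_first lam K) \<and> rho (f ext.e) = x"
    then obtain f where f: "equivariant n' mu' f" "f ext.e \<in> perm_module n' (add_first lam K)" "rho (f ext.e) = x"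
      by blast
    let ?th = "theta n' mu' (add_first lam K) (add_corner N)"
    show "\<exists>f. equivariant n' mu' f \<and> f ext.e \<in> perm_module n' (add_first lam K) \<and>
        rho (f ext.e) = (\<lambda>W. x W + k * theta n mu lam N e W)"
    proof (intro exI[of _ "\<lambda>v T. k * ?th v T + f v T"] conjI)
      show "equivariant n' mu' (\<lambda>v T. k * ?th v T + f v T)"
        by (rule equivariant_comb[OF theta_equivariant f(1)])
      show "(\<lambda>T. k * ?th ext.e T + f ext.e T) \<in> perm_module n' (add_first lam K)"
        by (rule perm_module_lin[OF theta_perm_module f(2)])
      show "rho (\<lambda>T. k * ?th ext.e T + f ext.e T) = (\<lambda>W. x W + k * theta n mu lam N e W)"
        unfolding rho_lin theta_lift f(3) by (simp add: add.commute)
    qed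
  qed
  then show ?thesis using that by blast
qed

end

section \<open>Kernel conditions before and after lengthening\<close>

context extension
begin

lemma lift_set_on:
  assumes "S \<subseteq> {1..n}"
  shows "set_on S i (lift W) = lift (set_on S i W)"
  using assms by (auto simp: set_on_def lift_def fun_eq_iff)

lemma rho_set_on:
  assumes W: "\<And>m. m \<in> new \<Longrightarrow> W m = junk_row" and S: "S \<subseteq> {1..n}"
  shows "rho y (set_on S i W) = y (set_on S i (lift W))"
proof -
  have "\<forall>m\<in>new. set_on S i W m = junk_row" using W S by (auto simp: set_on_def)
  then show ?thesis by (simp add: rho_def lift_set_on[OF S])
qed

lemma lower_lift_other:
  assumes W: "\<And>m. m \<in> new \<Longrightarrow> W m = junk_row" and i: "i \<noteq> 1"
  shows "lower n' i y (lift W) = lower n i (rho y) W"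
proof -
  have "fibre n' (lift W) i = fibre n W i" using i fibre_lift[of W i] by simp
  moreover have "rho y (set_on S (Suc i) W) = y (set_on S (Suc i) (lift W))" if "S \<in> Pow (fibre n W i)" for S
    using that by (intro rho_set_on W) auto
  ultimately show ?thesis unfolding lower_def by simp
qed

text \<open>Split the set of moved letters into old and new ones. By \<open>sym\<close> a term
  depends only on the number \<open>j\<close> of new letters moved, so these occur with the factor
  \<open>K choose j\<close>; the contents keep \<open>j\<close> in the range where this factor
  vanishes, and only \<open>j = 0\<close> survives.\<close>

lemma lower_lift_one:
  fixes y :: "(nat \<Rightarrow> nat) \<Rightarrow> 'a::field"
  assumes y: "y \<in> perm_module n' (add_first lam K)"
    and sym: "\<And>\<pi> T. \<pi> permutes new \<Longrightarrow> y (T \<circ> \<pi>) = y T"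
    and W: "\<And>m. m \<in> new \<Longrightarrow> W m = junk_row" and le: "card (fibre n W 1) \<le> mu 1"
    and choose: "\<And>j. 0 < j \<Longrightarrow> j \<le> min (lam 2) (mu 1 - lam 1) \<Longrightarrow> of_nat (K choose j) = (0::'a)"
  shows "lower n' 1 y (lift W) = lower n 1 (rho y) W"
proof -
  let ?F = "fibre n W 1" and ?L = "lift W"
  have disj: "?F \<inter> new = {}" by auto
  have F': "fibre n' ?L 1 = ?F \<union> new" using fibre_lift[of W 1] by simp
  have "lower n' 1 y ?L = (\<Sum>S\<in>Pow (?F \<union> new). y (set_on S 2 ?L))"
    unfolding lower_def F' by (simp add: numeral_2_eq_2)
  also have "\<dots> = (\<Sum>(S1, S2)\<in>Pow ?F \<times> Pow new. y (set_on (S1 \<union> S2) 2 ?L))"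
    by (rule sum.reindex_bij_witness[where i = "\<lambda>(S1, S2). S1 \<union> S2" and j = "\<lambda>S. (S \<inter> ?F, S \<inter> new)"])
      (use disj in \<open>auto intro!: arg_cong[where f = "\<lambda>S. y (set_on S 2 ?L)"]\<close>)
  also have "\<dots> = (\<Sum>S1\<in>Pow ?F. \<Sum>S2\<in>Pow new. y (set_on (S1 \<union> S2) 2 ?L))"
    by (rule sum.cartesian_product[symmetric])
  also have "\<dots> = (\<Sum>S1\<in>Pow ?F. y (set_on S1 2 ?L))"
  proof (rule sum.cong[OF refl])
    fix S1 assume S1: "S1 \<in> Pow ?F"
    have "(\<Sum>S2\<in>Pow new. y (set_on (S1 \<union> S2) 2 ?L)) = y (set_on (S1 \<union> {}) 2 ?L)"
    proof (rule sum_Pow_choose)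
      show "finite new" by simp
    next
      fix S S' assume S: "S \<subseteq> new" "S' \<subseteq> new" "card S = card S'"
      obtain \<pi> where \<pi>: "\<pi> permutes new" "\<pi> ` S' = S"
      proof (rule ex_permutes_image[of new S' S])
        show "finite new" "S' \<subseteq> new" "S \<subseteq> new" "card S' = card S" using S by auto
      qed
      have mem: "\<pi> m \<in> S \<longleftrightarrow> m \<in> S'" for m using \<pi> permutes_inj[OF \<pi>(1)] by (metis inj_image_mem_iff)
      have "set_on (S1 \<union> S) 2 ?L \<circ> \<pi> = set_on (S1 \<union> S') 2 ?L"
      proof
        fix m
        show "(set_on (S1 \<union> S) 2 ?L \<circ> \<pi>) m = set_on (S1 \<union> S') 2 ?L m"
        proof (cases "m \<in> new")
          case True
          then have "\<pi> m \<in> new" using permutes_in_image[OF \<pi>(1)] by blast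
          moreover have "x \<notin> S1" "?L x = 1" if "x \<in> new" for x using S1 that by (auto simp: lift_def)
          ultimately show ?thesis using True mem[of m] by (simp add: set_on_def)
        next
          case False
          then have "\<pi> m = m" using permutes_not_in[OF \<pi>(1)] by blast
          then show ?thesis using mem[of m] by (simp add: set_on_def)
        qed
      qed
      then show "y (set_on (S1 \<union> S) 2 ?L) = y (set_on (S1 \<union> S') 2 ?L)"
        using sym[OF \<pi>(1), of "set_on (S1 \<union> S) 2 ?L"] by simp
    next
      fix S assume S: "S \<subseteq> new" "S \<noteq> {}" and nz: "y (set_on (S1 \<union> S) 2 ?L) \<noteq> 0"
      let ?T = "set_on (S1 \<union> S) 2 ?L"
      have fin: "finite S1" "finite S"
        using finite_subset[of S1 ?F] finite_subset[of S new] S1 S(1) by auto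
      have cnt: "card (fibre n' ?T a) = add_first lam K a" for a
        using nz y by (auto simp: perm_module_def tabloids_def)
      have cu: "card (S1 \<union> S) = card S1 + card S"
        using S1 S disj fin by (intro card_Un_disjoint) auto
      \<comment> \<open>All moved letters land in row 2, whose length is \<open>lam 2\<close> also
        after lengthening.\<close>
      have "S1 \<union> S \<subseteq> fibre n' ?T 2" using S1 S by (auto simp: set_on_def)
      then have "card S1 + card S \<le> add_first lam K 2"
        unfolding cnt[symmetric] cu[symmetric] by (intro card_mono) auto
      then have 2: "card S \<le> lam 2" by (simp add: add_first_def)
      have "fibre n' ?T 1 = (?F \<union> new) - (S1 \<union> S)" using F' S1 S by (auto simp: set_on_def)
      then have "lam 1 + K = card ((?F \<union> new) - (S1 \<union> S))" using cnt[of 1] by (simp add: add_first_def)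
      also have "\<dots> = card (?F \<union> new) - (card S1 + card S)"
        using S1 S fin cu by (subst card_Diff_subset) auto
      also have "card (?F \<union> new) = card ?F + K" using disj by (subst card_Un_disjoint) auto
      finally have "lam 1 + K = card ?F + K - (card S1 + card S)" .
      moreover have pos: "0 < card S" using S fin by (simp add: card_gt_0_iff)
      moreover have "card S \<le> K" using card_mono[OF _ S(1)] by simp
      \<comment> \<open>Row 1 keeps \<open>lam 1 + K\<close> letters out of at most
        \<open>mu 1 + K\<close>. By \<open>0 < card S \<le> K\<close> the number kept is positive,
        so the subtraction above is not truncated.\<close>
      ultimately have "card S \<le> mu 1 - lam 1" using le by arith
      then show "of_nat (card new choose card S) = (0::'a)" using choose[OF pos] 2 by simp
    qed
    then show "(\<Sum>S2\<in>Pow new. y (set_on (S1 \<union> S2) 2 ?L)) = y (set_on S1 2 ?L)" by simp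
  qed
  also have "\<dots> = lower n 1 (rho y) W"
    unfolding lower_def
  proof (rule sum.cong[OF refl])
    fix S assume "S \<in> Pow ?F"
    then have "rho y (set_on S 2 W) = y (set_on S 2 ?L)" by (intro rho_set_on W) auto
    then show "y (set_on S 2 ?L) = rho y (set_on S (Suc 1) W)" by (simp add: numeral_2_eq_2)
  qed
  finally show ?thesis .
qed

lemma new_cols: "new \<subseteq> {m\<in>{1..n'}. mu' 2 < ext.c m}"
  using ext_new(2) is_partition_antimono[OF mu, of 1 2] by (auto simp: add_first_def)

lemma symmetric_new:
  assumes "equivariant n' mu' f" "\<pi> permutes new"
  shows "f ext.e (T \<circ> \<pi>) = f ext.e T"
  by (rule ext.symmetric_image[OF assms new_cols])

text \<open>\<open>kernel_test\<close> with \<open>E = new\<close> leaves only arguments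
  \<open>lift W\<close> whose ones lie in the first row of the diagram. This bounds the ones of
  \<open>W\<close> by \<open>mu 1\<close>, as \<open>lower_lift_one\<close> requires.\<close>

lemma kernel_up:
  fixes f :: "((nat \<Rightarrow> nat) \<Rightarrow> 'a::field) \<Rightarrow> (nat \<Rightarrow> nat) \<Rightarrow> 'a"
  assumes two: "(2::'a) \<noteq> 0" and lam: "lam 0 = 0" "mu 2 \<le> lam 1"
    and choose: "\<And>j. 0 < j \<Longrightarrow> j \<le> min (lam 2) (mu 1 - lam 1) \<Longrightarrow> of_nat (K choose j) = (0::'a)"
    and f: "equivariant n' mu' f" "f ext.e \<in> perm_module n' (add_first lam K)"
    and ker: "in_kernel n lam (rho (f ext.e))"
  shows "in_kernel n' (add_first lam K) (f ext.e)"
proof (rule ext.kernel_test[OF two f _ _ new_cols])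
  show "add_first lam K 0 = 0" "mu' 2 + card new \<le> add_first lam K 1"
    using lam by (simp_all add: add_first_def)
next
  fix i U assume i: "1 \<le> i" and less: "add_first lam K i < card (fibre n' U i)"
    and ones: "\<And>m. m \<in> {1..n'} \<Longrightarrow> U m = 1 \<Longrightarrow> ext.r m = 1" and one: "\<And>m. m \<in> new \<Longrightarrow> U m = 1"
  define W where "W = unlift U"
  have U: "U = lift W" using lift_unlift[of U] one by (simp add: W_def)
  have Wj: "W m = junk_row" if "m \<in> new" for m using that by (simp add: W_def unlift_def)
  have "lam i < card (fibre n W i)" using less unfolding U card_fibre_lift by (simp add: add_first_def split: if_splits)
  then have low: "lower n i (rho (f ext.e)) W = 0" using ker i by (simp add: in_kernel_def)
  show "lower n' i (f ext.e) U = 0"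
  proof (cases "i = 1")
    case False
    then show ?thesis unfolding U using lower_lift_other[of W i "f ext.e"] Wj low by simp
  next
    case True
    have "fibre n W 1 \<subseteq> fibre n r 1"
    proof
      fix m assume m: "m \<in> fibre n W 1"
      then have "m \<notin> new" by auto
      then have "U m = 1" using m by (auto simp: W_def unlift_def)
      then show "m \<in> fibre n r 1" using ones[of m] ext_old(1)[of m] m by auto
    qed
    then have "card (fibre n W 1) \<le> card (fibre n r 1)" by (intro card_mono) auto
    then have "card (fibre n W 1) \<le> mu 1" by (simp only: card_row)
    from lower_lift_one[OF f(2) symmetric_new[OF f(1)] Wj this choose]
    show ?thesis using low unfolding U True by simp
  qed
qed

text \<open>Here \<open>kernel_test\<close> supplies just the bound on the ones of \<open>W\<close>.
  It needs the restricted vector as the value at \<open>e\<close> of an equivariant map; this is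
  \<open>g\<close>, obtained from \<open>down\<close>.\<close>

lemma kernel_down:
  fixes f :: "((nat \<Rightarrow> nat) \<Rightarrow> 'a::field) \<Rightarrow> (nat \<Rightarrow> nat) \<Rightarrow> 'a"
  assumes two: "(2::'a) \<noteq> 0" and lam: "lam 0 = 0" "mu 2 \<le> lam 1"
    and choose: "\<And>j. 0 < j \<Longrightarrow> j \<le> min (lam 2) (mu 1 - lam 1) \<Longrightarrow> of_nat (K choose j) = (0::'a)"
    and f: "equivariant n' mu' f" "f ext.e \<in> perm_module n' (add_first lam K)"
    and g: "equivariant n mu g" "g e = rho (f ext.e)"
    and ker: "in_kernel n' (add_first lam K) (f ext.e)"
  shows "in_kernel n lam (g e)"
proof (rule kernel_test[OF two g(1), where E = "{}"])
  show "g e \<in> perm_module n lam" unfolding g(2) by (rule rho_perm_module[OF f(2)])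
next
  fix i W assume i: "1 \<le> i" and less: "lam i < card (fibre n W i)"
    and ones: "\<And>m. m \<in> {1..n} \<Longrightarrow> W m = 1 \<Longrightarrow> r m = 1" and out: "\<And>m. m \<notin> {1..n} \<Longrightarrow> W m = junk_row"
  have Wj: "W m = junk_row" if "m \<in> new" for m using that by (intro out) auto
  have "add_first lam K i < card (fibre n' (lift W) i)"
    using less unfolding card_fibre_lift by (cases "i = 1") (simp_all add: add_first_def)
  then have low: "lower n' i (f ext.e) (lift W) = 0" using ker i by (simp add: in_kernel_def)
  show "lower n i (g e) W = 0"
  proof (cases "i = 1")
    case False
    then show ?thesis unfolding g(2) using lower_lift_other[of W i "f ext.e"] Wj low by simp
  next
    case True
    have "fibre n W 1 \<subseteq> fibre n r 1" using ones by auto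
    then have "card (fibre n W 1) \<le> card (fibre n r 1)" by (intro card_mono) auto
    then have "card (fibre n W 1) \<le> mu 1" by (simp only: card_row)
    from lower_lift_one[OF f(2) symmetric_new[OF f(1)] Wj this choose]
    show ?thesis using low unfolding g(2) True by simp
  qed
qed (use lam in auto)

text \<open>A nonzero value of \<open>f ext.e\<close> can be moved to a filling with ones on all new
  letters, where \<open>rho\<close> sees it.\<close>

lemma rho_eq_zero:
  fixes f :: "((nat \<Rightarrow> nat) \<Rightarrow> 'a::field) \<Rightarrow> (nat \<Rightarrow> nat) \<Rightarrow> 'a"
  assumes two: "(2::'a) \<noteq> 0" and lam: "lam 0 = 0" "mu 2 \<le> lam 1"
    and f: "equivariant n' mu' f" "f ext.e \<in> perm_module n' (add_first lam K)"
    and zero: "rho (f ext.e) = (\<lambda>_. 0)"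
  shows "f ext.e = (\<lambda>_. 0)"
proof (rule ccontr)
  assume nz: "f ext.e \<noteq> (\<lambda>_. 0)"
  have l: "add_first lam K 0 = 0" "mu' 2 + card new \<le> add_first lam K 1"
    using lam by (simp_all add: add_first_def)
  obtain W where W: "f ext.e W \<noteq> 0" "\<And>m. m \<in> new \<Longrightarrow> W m = 1"
    using ext.first_row_support[OF two f nz l new_cols] by metis
  have "f ext.e W = rho (f ext.e) (unlift W)" by (rule rho_unlift) (rule W(2))
  then show False using W(1) zero by simp
qed

end

section \<open>Homomorphism spaces and the isomorphism\<close>

lemma hom_specht_iff:
  "f \<in> hom_specht n mu lam \<longleftrightarrow> equivariant n mu f \<and> (\<forall>v\<in>specht n mu. f v \<in> specht n lam) \<and>
    (\<forall>v. v \<notin> specht n mu \<longrightarrow> f v = (\<lambda>T. 0))"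
  unfolding hom_specht_def equivariant_def by blast

lemma hom_specht_comb:
  assumes "f \<in> hom_specht n mu lam" "g \<in> hom_specht n mu lam"
  shows "(\<lambda>v T. k * f v T + g v T) \<in> hom_specht n mu lam"
  unfolding hom_specht_iff
proof (intro conjI ballI allI impI)
  show "equivariant n mu (\<lambda>v T. k * f v T + g v T)"
    using assms by (intro equivariant_comb) (simp_all add: hom_specht_iff)
  show "(\<lambda>T. k * f v T + g v T) \<in> specht n lam" if "v \<in> specht n mu" for v
    using assms that by (intro specht_lin) (simp_all add: hom_specht_iff)
  show "(\<lambda>T. k * f v T + g v T) = (\<lambda>T. 0)" if "v \<notin> specht n mu" for v
    using assms that by (simp add: hom_specht_iff)
qed

context tableau
begin

lemma hom_spechtD:
  fixes f :: "((nat \<Rightarrow> nat) \<Rightarrow> 'a::field) \<Rightarrow> (nat \<Rightarrow> nat) \<Rightarrow> 'a"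
  assumes "(2::'a) \<noteq> 0" "is_partition n lam" "f \<in> hom_specht n mu lam"
  shows "equivariant n mu f" "f e \<in> perm_module n lam" "in_kernel n lam (f e)"
proof -
  have "f e \<in> specht n lam" using assms(3) e_specht unfolding hom_specht_iff by blast
  then show "f e \<in> perm_module n lam" "in_kernel n lam (f e)"
    using specht_perm_module[OF assms(2)] specht_in_kernel[OF assms(1,2)] by blast+
  show "equivariant n mu f" using assms(3) unfolding hom_specht_iff by blast
qed

lemma hom_specht_eqI:
  assumes "f \<in> hom_specht n mu lam" "g \<in> hom_specht n mu lam" "f e = g e"
  shows "f = g"
proof
  fix v show "f v = g v"
    using assms equivariant_eqI[of f g v] unfolding hom_specht_iff by (cases "v \<in> specht n mu") auto
qed

text \<open>Kernel conditions pass from \<open>f e\<close> to the whole image, and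
  \<open>kernel_intersection\<close> turns them into membership in the Specht module. Cutting off
  outside the domain makes the map extensional.\<close>

lemma hom_specht_restrict:
  fixes f :: "((nat \<Rightarrow> nat) \<Rightarrow> 'a::field) \<Rightarrow> (nat \<Rightarrow> nat) \<Rightarrow> 'a"
  assumes two: "(2::'a) \<noteq> 0" and lam: "is_partition n lam"
    and f: "equivariant n mu f" "f e \<in> perm_module n lam" "in_kernel n lam (f e)"
  obtains g where "g \<in> hom_specht n mu lam" "g e = f e"
proof
  let ?g = "\<lambda>v. if v \<in> specht n mu then f v else (\<lambda>T. 0)"
  have "equivariant n mu ?g"
    unfolding equivariant_def
  proof (intro conjI allI ballI impI)
    fix k and v w :: "(nat \<Rightarrow> nat) \<Rightarrow> 'a" assume v: "v \<in> specht n mu" and w: "w \<in> specht n mu"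
    show "?g (\<lambda>T. k * v T + w T) = (\<lambda>T. k * ?g v T + ?g w T)"
      using equivariant_lin[OF f(1) v w, of k] specht_lin[OF v w, of k] v w by simp
  next
    fix \<sigma> and v :: "(nat \<Rightarrow> nat) \<Rightarrow> 'a" assume \<sigma>: "\<sigma> permutes {1..n}" and v: "v \<in> specht n mu"
    show "?g (perm_act \<sigma> v) = perm_act \<sigma> (?g v)"
      using equivariant_perm[OF f(1) \<sigma> v] specht_perm_act[OF mu \<sigma> v] v by simp
  qed
  moreover have "f v \<in> specht n lam" if v: "v \<in> specht n mu" for v
  proof -
    have "f v \<in> perm_module n lam \<and> in_kernel n lam (f v)"
    proof (rule equivariant_image[where Q = "\<lambda>x. x \<in> perm_module n lam \<and> in_kernel n lam x", OF f(1) v])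
      show "f e \<in> perm_module n lam \<and> in_kernel n lam (f e)" using f by simp
      show "(\<lambda>T. 0) \<in> perm_module n lam \<and> in_kernel n lam (\<lambda>T. 0 :: 'a)"
        using perm_module_zero in_kernel_zero by blast
    qed (simp_all add: perm_module_lin in_kernel_lin perm_module_perm_act in_kernel_perm_act)
    then show ?thesis using kernel_intersection[OF two lam] by blast
  qed
  ultimately show "?g \<in> hom_specht n mu lam" unfolding hom_specht_iff by simp
  show "?g e = f e" by (simp add: e_specht)
qed

end

lemma ex_tableau:
  assumes "is_partition n mu"
  obtains t where "t \<in> tableaux n mu"
proof -
  have "young mu = (SIGMA i:{1..n}. {1..mu i})"
  proof -
    have "i \<le> n" if "0 < mu i" for i using assms that by (metis is_partition_def not_le not_less_zero)
    then show ?thesis by (fastforce simp: young_def)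
  qed
  then have "card (young mu) = card {1..n}" "finite (young mu)"
    using assms by (simp_all add: is_partition_def)
  then obtain t where "bij_betw t (young mu) {1..n}" by (metis finite_atLeastAtMost finite_same_card_bij)
  then show ?thesis using that by (simp add: tableaux_def)
qed

text \<open>A linear correspondence that is total and unique in both directions is an isomorphism. A
  relation is convenient because partners are only known to exist, and uniqueness makes the chosen
  map linear.\<close>

lemma lin_isoI:
  assumes total: "\<And>f. f \<in> H1 \<Longrightarrow> \<exists>g\<in>H2. R f g" and surj: "\<And>g. g \<in> H2 \<Longrightarrow> \<exists>f\<in>H1. R f g"
    and uniq: "\<And>f g g'. f \<in> H1 \<Longrightarrow> g \<in> H2 \<Longrightarrow> g' \<in> H2 \<Longrightarrow> R f g \<Longrightarrow> R f g' \<Longrightarrow> g = g'"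
    and inj: "\<And>f f' g. f \<in> H1 \<Longrightarrow> f' \<in> H1 \<Longrightarrow> g \<in> H2 \<Longrightarrow> R f g \<Longrightarrow> R f' g \<Longrightarrow> f = f'"
    and clo1: "\<And>k f g. f \<in> H1 \<Longrightarrow> g \<in> H1 \<Longrightarrow> (\<lambda>v T. k * f v T + g v T) \<in> H1"
    and clo2: "\<And>k f g. f \<in> H2 \<Longrightarrow> g \<in> H2 \<Longrightarrow> (\<lambda>v T. k * f v T + g v T) \<in> H2"
    and lin: "\<And>k f g f' g'. f \<in> H1 \<Longrightarrow> g \<in> H1 \<Longrightarrow> R f f' \<Longrightarrow> R g g' \<Longrightarrow>
      R (\<lambda>v T. k * f v T + g v T) (\<lambda>v T. k * f' v T + g' v T)"
  shows "lin_iso H1 H2"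
proof -
  define \<Phi> where "\<Phi> f = (SOME g. g \<in> H2 \<and> R f g)" for f
  have \<Phi>: "\<Phi> f \<in> H2" "R f (\<Phi> f)" if "f \<in> H1" for f
    using someI_ex[of "\<lambda>g. g \<in> H2 \<and> R f g"] total[OF that] unfolding \<Phi>_def by blast+
  have "bij_betw \<Phi> H1 H2"
    unfolding bij_betw_def
  proof (intro conjI inj_onI equalityI subsetI)
    show "f = g" if "f \<in> H1" "g \<in> H1" "\<Phi> f = \<Phi> g" for f g using that \<Phi> inj by metis
    show "g \<in> \<Phi> ` H1" if g: "g \<in> H2" for g
    proof -
      obtain f where "f \<in> H1" "R f g" using surj[OF g] by blast
      then have "\<Phi> f = g" using uniq \<Phi> g by blast
      then show ?thesis using \<open>f \<in> H1\<close> by blast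
    qed
  qed (use \<Phi> in blast)
  moreover have "\<Phi> (\<lambda>v T. k * f v T + g v T) = (\<lambda>v T. k * \<Phi> f v T + \<Phi> g v T)" if fg: "f \<in> H1" "g \<in> H1" for k f g
    by (rule uniq[OF clo1[OF fg] \<Phi>(1)[OF clo1[OF fg]] clo2[OF \<Phi>(1)[OF fg(1)] \<Phi>(1)[OF fg(2)]]
          \<Phi>(2)[OF clo1[OF fg]] lin[OF fg \<Phi>(2)[OF fg(1)] \<Phi>(2)[OF fg(2)]]])
  ultimately show ?thesis unfolding lin_iso_def by blast
qed

theorem theorem1p1:
  fixes K_type :: "'a::field itself"
    and p n k d :: nat and lam mu :: "nat \<Rightarrow> nat"
  assumes "infinite (UNIV :: 'a set)"
    and "CHAR('a) = p" and "p > 2"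
    and "is_partition n lam" and "is_partition n mu"
    and "k > 0" and "d > 0"
    and "p ^ d > min (lam 2) (mu 1 - lam 1)"
    and "mu 2 \<le> lam 1"
  shows "lin_iso (hom_specht n mu lam :: (((nat \<Rightarrow> nat) \<Rightarrow> 'a) \<Rightarrow> ((nat \<Rightarrow> nat) \<Rightarrow> 'a)) set)
           (hom_specht (n + k * p ^ d) (add_first mu (k * p ^ d)) (add_first lam (k * p ^ d))
              :: (((nat \<Rightarrow> nat) \<Rightarrow> 'a) \<Rightarrow> ((nat \<Rightarrow> nat) \<Rightarrow> 'a)) set)"
proof -
  obtain t where t: "t \<in> tableaux n mu" using ex_tableau[OF assms(5)] .
  define K where "K = k * p ^ d"
  interpret extension n mu t K using assms(5) t by unfold_locales
  \<comment> \<open>The characteristic of a field is zero or prime, and \<open>p > 2\<close> rules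
    out zero.\<close>
  have prime: "prime p" using prime_CHAR_semidom[where 'a = 'a] assms(2,3) by simp
  have two: "(2::'a) \<noteq> 0"
  proof
    assume "(2::'a) = 0"
    then have "of_nat 2 = (0::'a)" by simp
    then have "p dvd 2" unfolding of_nat_eq_0_iff_char_dvd assms(2) .
    then show False using assms(3) by (auto dest: dvd_imp_le)
  qed
  have choose: "of_nat (K choose j) = (0::'a)" if "0 < j" "j \<le> min (lam 2) (mu 1 - lam 1)" for j
    unfolding of_nat_eq_0_iff_char_dvd assms(2) K_def
    using prime_dvd_choose_mult_power[OF prime that(1), of d k] that(2) assms(8) by linarith
  have lam0: "lam 0 = 0" using assms(4) by (simp add: is_partition_def)
  let ?lam = "add_first lam K"
  have lam': "is_partition n' ?lam" by (rule add_first_partition[OF assms(4)])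
  let ?H1 = "hom_specht n mu lam :: (((nat \<Rightarrow> nat) \<Rightarrow> 'a) \<Rightarrow> ((nat \<Rightarrow> nat) \<Rightarrow> 'a)) set"
  let ?H2 = "hom_specht n' mu' ?lam :: (((nat \<Rightarrow> nat) \<Rightarrow> 'a) \<Rightarrow> ((nat \<Rightarrow> nat) \<Rightarrow> 'a)) set"
  note D1 = hom_spechtD[OF two assms(4)] and D2 = ext.hom_spechtD[OF two lam']
  \<comment> \<open>Homomorphisms are compared at the generators: two of them correspond when the
    value at \<open>ext.e\<close> restricts along \<open>lift\<close> to the value at
    \<open>e\<close>.\<close>
  have "lin_iso ?H1 ?H2"
  proof (rule lin_isoI[where R = "\<lambda>f g. rho (g ext.e) = f e"])
    fix f assume f: "f \<in> ?H1"
    obtain g where g: "equivariant n' mu' g" "g ext.e \<in> perm_module n' ?lam" "rho (g ext.e) = f e"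
      using up[OF two D1(1,2)[OF f]] .
    have "in_kernel n' ?lam (g ext.e)"
      by (rule kernel_up[OF two lam0 assms(9) _ g(1,2)]) (use choose g(3) D1(3)[OF f] in simp_all)
    then obtain h where "h \<in> ?H2" "h ext.e = g ext.e"
      using ext.hom_specht_restrict[OF two lam' g(1,2)] by blast
    then show "\<exists>g\<in>?H2. rho (g ext.e) = f e" using g(3) by (intro bexI[of _ h]) simp_all
  next
    fix g assume g: "g \<in> ?H2"
    note d = down[OF D2(1)[OF g]]
    have "in_kernel n lam (rho (g (iota e)))"
      by (rule kernel_down[OF two lam0 assms(9) _ D2(1,2)[OF g] d D2(3)[OF g]]) (use choose in simp)
    moreover have "rho (g (iota e)) \<in> perm_module n lam"
      unfolding d(2) by (rule rho_perm_module[OF D2(2)[OF g]])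
    ultimately obtain h where "h \<in> ?H1" "h e = rho (g (iota e))"
      using hom_specht_restrict[OF two assms(4) d(1)] by blast
    then show "\<exists>f\<in>?H1. rho (g ext.e) = f e" using d(2) by (intro bexI[of _ h]) simp_all
  next
    fix f g g' assume f: "f \<in> ?H1" and g: "g \<in> ?H2" "g' \<in> ?H2" and R: "rho (g ext.e) = f e" "rho (g' ext.e) = f e"
    \<comment> \<open>The difference of two partners of \<open>f\<close> restricts to zero at the
      generator, where \<open>rho_eq_zero\<close> applies.\<close>
    have h: "(\<lambda>v T. (-1) * g v T + g' v T) \<in> ?H2" by (rule hom_specht_comb[OF g])
    have "(\<lambda>T. (-1) * g ext.e T + g' ext.e T) = (\<lambda>_. 0)"
      by (rule rho_eq_zero[OF two lam0 assms(9) D2(1,2)[OF h]]) (unfold rho_lin R, simp)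
    then have "g ext.e = g' ext.e" by (simp add: fun_eq_iff)
    then show "g = g'" by (rule ext.hom_specht_eqI[OF g])
  next
    fix f f' and g :: "((nat \<Rightarrow> nat) \<Rightarrow> 'a) \<Rightarrow> (nat \<Rightarrow> nat) \<Rightarrow> 'a"
    assume f: "f \<in> ?H1" "f' \<in> ?H1" and R: "rho (g ext.e) = f e" "rho (g ext.e) = f' e"
    show "f = f'" by (rule hom_specht_eqI[OF f]) (use R in simp)
  next
    fix k and f g f' g' :: "((nat \<Rightarrow> nat) \<Rightarrow> 'a) \<Rightarrow> (nat \<Rightarrow> nat) \<Rightarrow> 'a"
    assume "rho (f' ext.e) = f e" "rho (g' ext.e) = g e"
    then show "rho (\<lambda>T. k * f' ext.e T + g' ext.e T) = (\<lambda>T. k * f e T + g e T)" by (simp add: rho_lin)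
  qed (rule hom_specht_comb; assumption)+
  then show ?thesis unfolding K_def .
qed

end
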